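(* Let $\gamma>\gamma^\star$. Then the set $\mathcal{K}_{\gamma}$ of full-order stabilizing dynamical controllers whose closed-loop transfer function from $w$ to $z$ has $\mathcal{H}_\infty$ norm less than $\gamma$ has at most two path-connected components.
   Context: Consider the continuous-time linear plant $\dot x=Ax+B_1w+B_2u$, $z=C_1x+D_{11}w+D_{12}u$, $y=C_2x+D_{21}w$, with state $x\in\mathbb{R}^{n_x}$, disturbance $w\in\mathbb{R}^{n_w}$, control input $u\in\mathbb{R}^{n_u}$, measured output $y\in\mathbb{R}^{n_y}$, performance output $z\in\mathbb{R}^{n_z}$, and real matrices of compatible dimensions. Assume $(A,B_2)$ is stabilizable and $(C_2,A)$ is detectable. A full-order dynamical controller $\dot\xi=A_K\xi+B_Ky$, $u=C_K\xi+D_Ky$ with $\xi\in\mathbb{R}^{n_x}$ is identified with the matrix $K=\begin{bmatrix}D_K & C_K\\ B_K & A_K\end{bmatrix}\in\mathbb{R}^{(n_u+n_x)\times(n_y+n_x)}$. The closed-loop matrices are $A_{cl}=\begin{bmatrix}A+B_2D_KC_2 & B_2C_K\\ B_KC_2 & A_K\end{bmatrix}$, $B_{cl}=\begin{bmatrix}B_1+B_2D_KD_{21}\\ B_KD_{21}\end{bmatrix}$, $C_{cl}=\begin{bmatrix}C_1+D_{12}D_KC_2 & D_{12}C_K\end{bmatrix}$, $D_{cl}=D_{11}+D_{12}D_KD_{21}$. Let $\mathcal{C}_{stab}$ be the set of all $K$ with $A_{cl}$ Hurwitz, and $\mathbf{T}_{zw}(s)=C_{cl}(sI-A_{cl})^{-1}B_{cl}+D_{cl}$,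 with $\|\mathbf{T}_{zw}\|_\infty=\sup_{\omega\in\mathbb{R}}\sigma_{\max}(\mathbf{T}_{zw}(j\omega))$. For $\gamma>0$, $\mathcal{K}_\gamma=\{K\in\mathcal{C}_{stab}: \|\mathbf{T}_{zw}\|_\infty<\gamma\}$, and $\gamma^\star=\inf_{K\in\mathcal{C}_{stab}}\|\mathbf{T}_{zw}\|_\infty$ (finite under the assumptions). *)

theory Defs
  imports "HOL-Analysis.Analysis"
begin

definition cmat :: "real^'n^'m \<Rightarrow> complex^'n^'m" where
  "cmat M = (\<chi> i j. complex_of_real (M $ i $ j))"

definition hurwitz :: "real^'n^'n \<Rightarrow> bool" where
  "hurwitz M \<longleftrightarrow> (\<forall>s::complex. det (mat s - cmat M) = 0 \<longrightarrow> Re s < 0)"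

definition stabilizable :: "real^'n^'n \<Rightarrow> real^'u^'n \<Rightarrow> bool" where
  "stabilizable A B \<longleftrightarrow> (\<exists>F :: real^'n^'u. hurwitz (A + B ** F))"

definition detectable :: "real^'n^'y \<Rightarrow> real^'n^'n \<Rightarrow> bool" where
  "detectable C A \<longleftrightarrow> (\<exists>L :: real^'y^'n. hurwitz (A + L ** C))"

text \<open>A full-order controller K = [DK CK; BK AK] is represented as the tuple (DK, CK, BK, AK);
  this is the same Euclidean space (with the same topology) as the block matrix.\<close>
type_synonym ('x,'u,'y) ctrl = "(real^'y^'u) \<times> (real^'x^'u) \<times> (real^'y^'x) \<times> (real^'x^'x)"

definition blk :: "real^'b^'a \<Rightarrow> real^'d^'a \<Rightarrow> real^'b^'c \<Rightarrow> real^'d^'c \<Rightarrow> real^('b+'d)^('a+'c)" where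
  "blk M11 M12 M21 M22 = (\<chi> i j. case i of
      Inl a \<Rightarrow> (case j of Inl b \<Rightarrow> M11 $ a $ b | Inr d \<Rightarrow> M12 $ a $ d)
    | Inr c \<Rightarrow> (case j of Inl b \<Rightarrow> M21 $ c $ b | Inr d \<Rightarrow> M22 $ c $ d))"

definition vblk :: "real^'b^'a \<Rightarrow> real^'b^'c \<Rightarrow> real^'b^('a+'c)" where
  "vblk M1 M2 = (\<chi> i j. case i of Inl a \<Rightarrow> M1 $ a $ j | Inr c \<Rightarrow> M2 $ c $ j)"

definition hblk :: "real^'b^'a \<Rightarrow> real^'d^'a \<Rightarrow> real^('b+'d)^'a" where
  "hblk M1 M2 = (\<chi> i j. case j of Inl b \<Rightarrow> M1 $ i $ b | Inr d \<Rightarrow> M2 $ i $ d)"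

definition Acl :: "real^'x^'x \<Rightarrow> real^'u^'x \<Rightarrow> real^'x^'y \<Rightarrow> ('x,'u,'y) ctrl \<Rightarrow> real^('x+'x)^('x+'x)" where
  "Acl A B2 C2 K = (case K of (DK, CK, BK, AK) \<Rightarrow>
     blk (A + B2 ** DK ** C2) (B2 ** CK) (BK ** C2) AK)"

definition Bcl :: "real^'w^'x \<Rightarrow> real^'u^'x \<Rightarrow> real^'w^'y \<Rightarrow> ('x,'u,'y) ctrl \<Rightarrow> real^'w^('x+'x)" where
  "Bcl B1 B2 D21 K = (case K of (DK, CK, BK, AK) \<Rightarrow>
     vblk (B1 + B2 ** DK ** D21) (BK ** D21))"

definition Ccl :: "real^'x^'z \<Rightarrow> real^'u^'z \<Rightarrow> real^'x^'y \<Rightarrow> ('x,'u,'y) ctrl \<Rightarrow> real^('x+'x)^'z" where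
  "Ccl C1 D12 C2 K = (case K of (DK, CK, BK, AK) \<Rightarrow>
     hblk (C1 + D12 ** DK ** C2) (D12 ** CK))"

definition Dcl :: "real^'w^'z \<Rightarrow> real^'u^'z \<Rightarrow> real^'w^'y \<Rightarrow> ('x,'u,'y) ctrl \<Rightarrow> real^'w^'z" where
  "Dcl D11 D12 D21 K = (case K of (DK, CK, BK, AK) \<Rightarrow> D11 + D12 ** DK ** D21)"

definition Cstab :: "real^'x^'x \<Rightarrow> real^'u^'x \<Rightarrow> real^'x^'y \<Rightarrow> ('x,'u,'y) ctrl set" where
  "Cstab A B2 C2 = {K. hurwitz (Acl A B2 C2 K)}"

definition Tzw ::
  "real^'x^'x \<Rightarrow> real^'w^'x \<Rightarrow> real^'u^'x \<Rightarrow> real^'x^'z \<Rightarrow> real^'w^'z \<Rightarrow> real^'u^'z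
   \<Rightarrow> real^'x^'y \<Rightarrow> real^'w^'y \<Rightarrow> ('x,'u,'y) ctrl \<Rightarrow> complex \<Rightarrow> complex^'w^'z" where
  "Tzw A B1 B2 C1 D11 D12 C2 D21 K s =
     cmat (Ccl C1 D12 C2 K) ** matrix_inv (mat s - cmat (Acl A B2 C2 K)) ** cmat (Bcl B1 B2 D21 K)
     + cmat (Dcl D11 D12 D21 K)"

definition sigma_max :: "complex^'n^'m \<Rightarrow> real" where
  "sigma_max M = onorm (\<lambda>v. M *v v)"

definition hinf_norm ::
  "real^'x^'x \<Rightarrow> real^'w^'x \<Rightarrow> real^'u^'x \<Rightarrow> real^'x^'z \<Rightarrow> real^'w^'z \<Rightarrow> real^'u^'z
   \<Rightarrow> real^'x^'y \<Rightarrow> real^'w^'y \<Rightarrow> ('x,'u,'y) ctrl \<Rightarrow> real" where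
  "hinf_norm A B1 B2 C1 D11 D12 C2 D21 K =
     (SUP \<omega>::real. sigma_max (Tzw A B1 B2 C1 D11 D12 C2 D21 K (\<i> * complex_of_real \<omega>)))"

definition Kgamma ::
  "real^'x^'x \<Rightarrow> real^'w^'x \<Rightarrow> real^'u^'x \<Rightarrow> real^'x^'z \<Rightarrow> real^'w^'z \<Rightarrow> real^'u^'z
   \<Rightarrow> real^'x^'y \<Rightarrow> real^'w^'y \<Rightarrow> real \<Rightarrow> ('x,'u,'y) ctrl set" where
  "Kgamma A B1 B2 C1 D11 D12 C2 D21 \<gamma> =
     {K \<in> Cstab A B2 C2. hinf_norm A B1 B2 C1 D11 D12 C2 D21 K < \<gamma>}"

definition gamma_star ::
  "real^'x^'x \<Rightarrow> real^'w^'x \<Rightarrow> real^'u^'x \<Rightarrow> real^'x^'z \<Rightarrow> real^'w^'z \<Rightarrow> real^'u^'z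
   \<Rightarrow> real^'x^'y \<Rightarrow> real^'w^'y \<Rightarrow> real" where
  "gamma_star A B1 B2 C1 D11 D12 C2 D21 =
     (INF K \<in> Cstab A B2 C2. hinf_norm A B1 B2 C1 D11 D12 C2 D21 K)"

end

theory Submission
  imports Defs "HOL-Computational_Algebra.Fundamental_Theorem_Algebra"
begin

text \<open>By the bounded real lemma a controller lies in \<open>\<K>\<^sub>\<gamma>\<close> iff its closed loop admits a positive definite
  Lyapunov matrix \<open>P\<close> satisfying a strict matrix inequality; perturbing \<open>P\<close>, its off-diagonal block may be
  taken invertible. A congruence built from the blocks of \<open>P\<close> and its inverse turns the inequality into a
  convex condition on transformed variables, and the controller is recovered continuously from a point
  of this convex set together with an invertible matrix \<open>W\<close>. Since the general linear group has at
  most two path components, so has \<open>\<K>\<^sub>\<gamma>\<close>. The necessity part of the bounded real lemma is proved by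
  separating hyperplanes, following Rantzer.\<close>

subsection \<open>Path components of the general linear group\<close>

text \<open>The change of variables needs a square invertible \<open>W\<close>: full order makes it
  square, and strictness of the matrix inequality leaves room to perturb \<open>P\<close> until its
  off-diagonal block is nonsingular. The components of \<open>GL\<close> enter only through an upper
  bound, so two base points suffice and no determinant sign has to be tracked. The hard point is
  necessity. A point of the convex hull to be separated is a whole family of pairs
  \<open>(x, w)\<close>, while the frequency bound speaks of a single pair with
  \<open>A x + B w = i \<omega> x\<close>. Mixing the family by a unitary matrix preserves the sums
  of squared norms and the skew condition, so pairs that satisfy this equation or have
  \<open>x = 0\<close> can be split off one at a time. Separation yields a symmetric
  \<open>P\<close> of unknown sign; positivity comes from comparing it with a Lyapunov operator,
  which is assembled from finitely many linear factors \<open>A - s\<close> instead of an integral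
  of matrix exponentials.\<close>

lemma path_component_continuous_image:
  assumes "path_component S x y" "continuous_on S f" "f ` S \<subseteq> T"
  shows "path_component T (f x) (f y)"
proof -
  obtain g where g: "path g" "path_image g \<subseteq> S" "pathstart g = x" "pathfinish g = y"
    using assms(1) by (auto simp: path_component_def)
  have "path (f \<circ> g)"
    using g assms(2) by (meson continuous_on_subset path_continuous_image)
  then show ?thesis
    unfolding path_component_def
    using g assms(3) by (intro exI[of _ "f \<circ> g"]) (auto simp: path_image_compose pathstart_compose pathfinish_compose)
qed

lemma path_component_param:
  fixes g :: "real \<Rightarrow> 'a::topological_space"
  assumes "continuous_on {0..1} g" "\<And>t. t \<in> {0..1} \<Longrightarrow> g t \<in> S"
  shows "path_component S (g 0) (g 1)"
  unfolding path_component_def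
  by (rule exI[of _ g]) (use assms in \<open>auto simp: path_def path_image_def pathstart_def pathfinish_def\<close>)

abbreviation GL :: "(real^'n^'n) set" where
  "GL \<equiv> {M. invertible M}"

lemma continuous_on_matrix_mult [continuous_intros]:
  fixes f :: "'a::topological_space \<Rightarrow> real^'n^'m" and g :: "'a \<Rightarrow> real^'k^'n"
  assumes "continuous_on S f" "continuous_on S g"
  shows "continuous_on S (\<lambda>x. f x ** g x)"
  unfolding matrix_matrix_mult_def
  by (intro continuous_intros assms)

lemma path_component_GL_mult_left:
  assumes "path_component GL U V" "invertible M"
  shows "path_component GL (M ** U) (M ** V)"
  by (rule path_component_continuous_image[OF assms(1)])
     (use assms(2) in \<open>auto intro!: continuous_intros simp: invertible_mult\<close>)

lemma path_component_GL_mult_right: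
  assumes "path_component GL U V" "invertible M"
  shows "path_component GL (U ** M) (V ** M)"
  by (rule path_component_continuous_image[OF assms(1)])
     (use assms(2) in \<open>auto intro!: continuous_intros simp: invertible_mult\<close>)

text \<open>The matrix \<open>1 - 2 v v^T / (v \<bullet> v)\<close>. Dividing by
  \<open>v \<bullet> v\<close> makes it depend only on the line through \<open>v\<close>, so
  \<open>v\<close> can be moved without normalisation.\<close>

definition reflection :: "real^'n \<Rightarrow> real^'n^'n" where
  "reflection v = (\<chi> i j. of_bool (i = j) - 2 * v $ i * v $ j / (v \<bullet> v))"

lemma reflection_mult_self:
  assumes "v \<noteq> 0"
  shows "reflection v ** reflection v = mat 1"
proof -
  define s where "s = v \<bullet> v"
  have s: "s \<noteq> 0" "(\<Sum>k\<in>UNIV. v $ k * v $ k) = s"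
    using assms by (simp add: s_def) (simp add: s_def inner_vec_def)
  have delta: "(\<Sum>k\<in>UNIV. of_bool (i = k) * f k) = f i" "(\<Sum>k\<in>UNIV. of_bool (k = i) * f k) = f i"
    for f :: "'a \<Rightarrow> real" and i
    by (simp_all add: of_bool_def if_distrib[of "\<lambda>x. x * y" for y] cong: if_cong)
  have "(\<Sum>k\<in>UNIV. (of_bool (i = k) - 2 * v $ i * v $ k / s) * (of_bool (k = j) - 2 * v $ k * v $ j / s))
      = of_bool (i = j)" (is "?L = _") for i j
  proof -
    have "?L = (\<Sum>k\<in>UNIV. of_bool (i = k) * of_bool (k = j) - of_bool (i = k) * (2 * v $ k * v $ j / s)
        - of_bool (k = j) * (2 * v $ i * v $ k / s)
        + (4 * v $ i * v $ j / s^2) * (v $ k * v $ k))"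
      by (rule sum.cong) (auto simp: algebra_simps power2_eq_square)
    also have "\<dots> = of_bool (i = j) - 2 * v $ i * v $ j / s - 2 * v $ i * v $ j / s
        + (4 * v $ i * v $ j / s^2) * s"
      by (simp only: sum.distrib sum_subtractf delta flip: sum_distrib_left s(2))
    also have "\<dots> = of_bool (i = j)"
      using s by (simp add: power2_eq_square)
    finally show ?thesis .
  qed
  then show ?thesis
    by (simp add: reflection_def matrix_matrix_mult_def mat_def vec_eq_iff of_bool_def flip: s_def)
qed

lemma invertible_reflection: "v \<noteq> 0 \<Longrightarrow> invertible (reflection v)"
  using reflection_mult_self invertible_def by blast

lemma reflection_scaleR: "c \<noteq> 0 \<Longrightarrow> reflection (c *\<^sub>R v) = reflection v"
  by (simp add: reflection_def vec_eq_iff divide_simps)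

text \<open>A segment from \<open>v\<close> to \<open>w\<close> that avoids 0 carries the
  reflections along. If it hits 0, the vectors span the same line and the two reflections
  coincide.\<close>

lemma path_component_reflection:
  assumes "v \<noteq> 0" "w \<noteq> 0"
  shows "path_component GL (reflection v) (reflection w)"
proof (cases "\<exists>t\<in>{0..1}. (1 - t) *\<^sub>R v + t *\<^sub>R w = 0")
  case True
  then obtain t where t: "t \<in> {0..1}" "(1 - t) *\<^sub>R v + t *\<^sub>R w = 0" by blast
  have "t \<noteq> 0" using t assms by auto
  have "t \<noteq> 1" using t assms by auto
  have "w = (-(1 - t) / t) *\<^sub>R v"
    using t(2) \<open>t \<noteq> 0\<close> by (simp add: field_simps vec_eq_iff)
  then have "reflection w = reflection v"
    using reflection_scaleR[of "-(1 - t) / t" v] \<open>t \<noteq> 0\<close> \<open>t \<noteq> 1\<close> by simp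
  then show ?thesis
    using invertible_reflection[OF assms(1)] by (simp add: path_component_refl)
next
  case False
  let ?g = "\<lambda>t. (1 - t) *\<^sub>R v + t *\<^sub>R w"
  have "path_component GL (reflection (?g 0)) (reflection (?g 1))"
  proof (rule path_component_param)
    show "continuous_on {0..1} (\<lambda>t. reflection (?g t))"
      unfolding reflection_def
      by (intro continuous_intros) (use False in \<open>auto\<close>)
    fix t :: real assume "t \<in> {0..1}"
    then show "reflection (?g t) \<in> GL" using False invertible_reflection[of "?g t"] by blast
  qed
  then show ?thesis by simp
qed

text \<open>Swapping two coordinates negates the difference of their basis vectors and fixes its
  orthogonal complement.\<close>

lemma transposition_eq_reflection:
  assumes "m \<noteq> n"
  shows "(\<chi> i j. mat 1 $ i $ Transposition.transpose m n j) = reflection (axis m 1 - axis n (1::real))"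
proof -
  have "(axis m 1 - axis n (1::real)) \<bullet> (axis m 1 - axis n 1) = 2"
    using assms by (simp add: inner_diff_left inner_diff_right inner_axis_axis)
  then show ?thesis
    using assms by (auto simp: reflection_def vec_eq_iff mat_def axis_def Transposition.transpose_def)
qed

definition diagmat :: "('n \<Rightarrow> real) \<Rightarrow> real^'n^'n" where
  "diagmat d = (\<chi> i j. if i = j then d i else 0)"

lemma diagmat_mult: "diagmat d ** diagmat e = diagmat (\<lambda>i. d i * e i)"
  by (simp add: diagmat_def matrix_matrix_mult_def vec_eq_iff if_distrib[of "\<lambda>x. x * y" for y] cong: if_cong)

lemma invertible_diagmat: "(\<And>i. d i \<noteq> 0) \<Longrightarrow> invertible (diagmat d)"
  by (auto simp: invertible_det_nz diagmat_def det_diagonal)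

lemma invertible_diagmatD:
  assumes "invertible (diagmat d)" shows "d i \<noteq> 0"
  using assms by (auto simp: invertible_det_nz diagmat_def det_diagonal)

text \<open>Elementary matrices generate all matrices, and each invertible one is joined to
  \<open>mat 1\<close> or to a product of reflections. All reflections lie in one component and the
  base reflection squares to 1, so the property \<open>Q\<close> is closed under products.\<close>

lemma path_component_GL_cases:
  fixes M :: "real^'n^'n" and k :: 'n
  assumes "invertible M"
  shows "path_component GL (mat 1) M \<or> path_component GL (reflection (axis k 1)) M"
proof -
  let ?R = "reflection (axis k 1) :: real^'n^'n"
  have R: "invertible ?R" "?R ** ?R = mat 1"
    using invertible_reflection[of "axis k 1"] reflection_mult_self[of "axis k 1"] by (auto simp: axis_eq_0_iff)
  define Q :: "real^'n^'n \<Rightarrow> bool" where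
    "Q A \<longleftrightarrow> path_component GL (mat 1) A \<or> path_component GL ?R A" for A
  have Qinv: "invertible A" if "Q A" for A
    using that path_component_mem[of GL _ A] unfolding Q_def by blast
  have Q1: "Q (mat 1)"
    by (auto simp: Q_def intro!: path_component_refl invertible_det_nz[THEN iffD2])
  have Qtrans: "Q B" if "Q A" "path_component GL A B" for A B
    using that unfolding Q_def by (meson path_component_trans)
  have Qmult: "Q (A ** B)" if "Q A" "Q B" for A B
  proof -
    have invA: "invertible A" and invB: "invertible B" using that Qinv by auto
    have "path_component GL (A ** mat 1) (A ** B) \<or> path_component GL (A ** ?R) (A ** B)"
      using that(2) invA path_component_GL_mult_left unfolding Q_def by blast
    moreover have "Q (A ** mat 1)" using that by simp
    moreover have "Q (A ** ?R)"
    proof -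
      have "path_component GL (mat 1 ** ?R) (A ** ?R) \<or> path_component GL (?R ** ?R) (A ** ?R)"
        using that(1) R path_component_GL_mult_right unfolding Q_def by blast
      then show ?thesis using R(2) unfolding Q_def by auto
    qed
    ultimately show ?thesis using Qtrans by blast
  qed
  have Qrefl: "Q (reflection v)" if "v \<noteq> 0" for v
    using path_component_reflection[OF _ that, of "axis k 1"] by (auto simp: Q_def axis_eq_0_iff)
  have Qsign: "Q (diagmat (\<lambda>i. if i \<in> S then -1 else 1))" if "finite S" for S
    using that
  proof (induction S)
    case empty
    have "diagmat (\<lambda>i. 1) = (mat 1 :: real^'n^'n)" by (simp add: diagmat_def mat_def vec_eq_iff)
    then show ?case using Q1 by (simp only: empty_iff if_False)
  next
    case (insert a S)
    have "diagmat (\<lambda>i. if i \<in> insert a S then -1 else 1)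
        = reflection (axis a 1) ** diagmat (\<lambda>i. if i \<in> S then -1 else 1)"
    proof -
      have "reflection (axis a 1) = diagmat (\<lambda>i. if i = a then -1 else 1)"
        by (simp add: reflection_def diagmat_def vec_eq_iff inner_axis_axis) (simp add: axis_def)
      moreover have "(\<lambda>i. if i \<in> insert a S then -1 else (1::real)) = (\<lambda>i. (if i = a then -1 else 1) * (if i \<in> S then -1 else 1))"
        using insert.hyps by auto
      ultimately show ?thesis by (simp only: diagmat_mult)
    qed
    then show ?case using Qmult[OF Qrefl insert.IH, of "axis a 1"] by (simp add: axis_eq_0_iff)
  qed
  have Qdiag: "Q (diagmat d)" if "invertible (diagmat d)" for d
  proof -
    have nz: "d i \<noteq> 0" for i using that by (rule invertible_diagmatD)
    \<comment> \<open>The diagonal entries move straight to their signs and never cross 0.\<close>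
    let ?s = "\<lambda>i. if i \<in> {i. d i < 0} then -1 else (1::real)"
    let ?g = "\<lambda>t. diagmat (\<lambda>i. (1 - t) * ?s i + t * d i)"
    have "path_component GL (?g 0) (?g 1)"
    proof (rule path_component_param)
      show "continuous_on {0..1} ?g"
        unfolding diagmat_def
      proof (intro continuous_on_vec_lambda)
        show "continuous_on {0..1} (\<lambda>t. if i = j then (1 - t) * ?s i + t * d i else 0)" for i j
          by (cases "i = j") (auto intro!: continuous_intros)
      qed
      fix t :: real assume t: "t \<in> {0..1}"
      have "(1 - t) * ?s i + t * d i \<noteq> 0" for i
      proof (cases "d i < 0")
        case True
        have "(1 - t) * 1 + t * (- d i) > 0"
          using t True mult_pos_pos[of t "- d i"] by (cases "t = 0") auto
        then show ?thesis using True by (auto simp: algebra_simps)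
      next
        case False
        then have "d i > 0" using nz[of i] by auto
        then have "(1 - t) * 1 + t * d i > 0"
          using t mult_pos_pos[of t "d i"] by (cases "t = 0") (auto simp del: zero_less_mult_iff intro: add_nonneg_pos)
        then show ?thesis using False by auto
      qed
      then show "?g t \<in> GL" by (auto intro!: invertible_diagmat)
    qed
    then show ?thesis using Qtrans[OF Qsign[of "{i. d i < 0}"]] by auto
  qed
  have "invertible M \<longrightarrow> Q M"
  proof (rule induct_matrix_elementary[where P = "\<lambda>M. invertible M \<longrightarrow> Q M"])
    fix A B :: "real^'n^'n"
    assume *: "invertible A \<longrightarrow> Q A" "invertible B \<longrightarrow> Q B"
    show "invertible (A ** B) \<longrightarrow> Q (A ** B)"
      using * Qmult by (auto simp: invertible_det_nz det_mul)
  next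
    fix A :: "real^'n^'n" and i assume "row i A = 0"
    then show "invertible A \<longrightarrow> Q A" by (metis det_zero_row(1) invertible_det_nz)
  next
    fix A :: "real^'n^'n" assume "\<And>i j. i \<noteq> j \<Longrightarrow> A $ i $ j = 0"
    then have "A = diagmat (\<lambda>i. A $ i $ i)" by (auto simp: diagmat_def vec_eq_iff)
    then show "invertible A \<longrightarrow> Q A" using Qdiag by metis
  next
    fix m n :: 'n assume "m \<noteq> n"
    then have "axis m 1 - axis n (1::real) \<noteq> 0" by (auto simp: axis_eq_axis)
    then show "invertible ((\<chi> i j. mat 1 $ i $ Transposition.transpose m n j)::real^'n^'n)
        \<longrightarrow> Q (\<chi> i j. mat 1 $ i $ Transposition.transpose m n j)"
      using Qrefl transposition_eq_reflection[OF \<open>m \<noteq> n\<close>] by metis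
  next
    fix m n :: 'n and c :: real assume mn: "m \<noteq> n"
    let ?E = "\<lambda>c. (\<chi> i j. if i = m \<and> j = n then c else of_bool (i = j)) :: real^'n^'n"
    have inv: "?E a ** ?E (- a) = mat 1" for a
      using mn by (auto simp: matrix_matrix_mult_def mat_def vec_eq_iff of_bool_def
          if_distrib[of "\<lambda>x. x * y" for y] sum.remove[of _ n] sum.remove[of _ m] cong: if_cong intro!: sum.neutral)
    \<comment> \<open>A shear is joined to \<open>mat 1\<close> by shrinking its off-diagonal entry;
      it stays invertible because the opposite entry gives the inverse.\<close>
    have "path_component GL (?E (0 * c)) (?E (1 * c))"
    proof (rule path_component_param)
      show "continuous_on {0..1} (\<lambda>t. ?E (t * c))"
      proof (intro continuous_on_vec_lambda)
        show "continuous_on {0..1} (\<lambda>t. if i = m \<and> j = n then t * c else of_bool (i = j))" for i j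
          by (cases "i = m \<and> j = n") (auto intro!: continuous_intros)
      qed
      show "?E (t * c) \<in> GL" for t
        using inv[of "t * c"] inv[of "- (t * c)"] unfolding mem_Collect_eq invertible_def minus_minus by blast
    qed
    moreover have "?E 0 = mat 1" using mn by (auto simp: mat_def vec_eq_iff)
    ultimately have "Q (?E c)" unfolding Q_def mult_zero_left mult_1 by metis
    then show "invertible (?E c) \<longrightarrow> Q (?E c)" by simp
  qed
  then show ?thesis using assms unfolding Q_def by blast
qed

subsection \<open>Rayleigh quotients\<close>

lemma quadratic_nonneg_imp_linear_zero:
  fixes b c :: real
  assumes "\<And>t. 0 \<le> 2 * t * b + t\<^sup>2 * c"
  shows "b = 0"
proof (rule ccontr)
  assume b: "b \<noteq> 0"
  \<comment> \<open>For any \<open>m\<close> above both 0 and \<open>c\<close>, the choice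
    \<open>t = - b / m\<close> makes the quadratic negative.\<close>
  define m where "m = \<bar>c\<bar> + 1"
  have m: "m > 0" "c < m" by (auto simp: m_def)
  have "2 * (- b / m) * b + (- b / m)\<^sup>2 * c = (b\<^sup>2 / m) * (c / m - 2)"
    using m by (simp add: field_simps power2_eq_square)
  also have "\<dots> < 0"
    using b m by (intro mult_pos_neg) (auto simp: field_simps)
  finally show False using assms[of "- b / m"] by linarith
qed

text \<open>The maximiser \<open>f\<close> of the quotient \<open>T f \<bullet> f / (G f \<bullet> f)\<close> makes the semidefinite form
  \<open>\<lambda> G - T\<close> vanish, hence lies in its kernel.\<close>

lemma generalized_rayleigh:
  fixes T G :: "'a::euclidean_space \<Rightarrow> 'a"
  assumes W: "subspace W" "W \<noteq> {0}"
    and T: "linear T" "T ` W \<subseteq> W" "\<And>f g. T f \<bullet> g = f \<bullet> T g"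
    and G: "linear G" "G ` W \<subseteq> W" "\<And>f g. G f \<bullet> g = f \<bullet> G g"
    and pos: "\<And>f. f \<in> W \<Longrightarrow> f \<noteq> 0 \<Longrightarrow> G f \<bullet> f > 0"
  obtains f l where "f \<in> W" "f \<noteq> 0" "T f = l *\<^sub>R G f" "\<And>g. g \<in> W \<Longrightarrow> T g \<bullet> g \<le> l * (G g \<bullet> g)"
proof -
  let ?S = "W \<inter> sphere 0 1"
  let ?r = "\<lambda>f. (T f \<bullet> f) / (G f \<bullet> f)"
  have cont: "continuous_on UNIV T" "continuous_on UNIV G"
    using T(1) G(1) linear_continuous_on linear_conv_bounded_linear by blast+
  obtain v where v: "v \<in> W" "v \<noteq> 0" using W subspace_0 by blast
  have nonzero: "f \<noteq> 0" if "f \<in> ?S" for f using that by auto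
  have "v /\<^sub>R norm v \<in> ?S" using v W(1) by (auto simp: subspace_scale)
  moreover have "compact ?S"
    using closed_subspace[OF W(1)] by (simp add: closed_Int_compact)
  moreover have "continuous_on ?S ?r"
    by (intro continuous_intros continuous_on_subset[OF cont(1)] continuous_on_subset[OF cont(2)])
       (use pos nonzero in \<open>auto simp: less_le\<close>)
  ultimately obtain f where f: "f \<in> ?S" and max: "\<And>g. g \<in> ?S \<Longrightarrow> ?r g \<le> ?r f"
    using continuous_attains_sup[of ?S ?r] by blast
  define l where "l = ?r f"
  have f0: "f \<in> W" "f \<noteq> 0" using f nonzero by auto
  have le: "T g \<bullet> g \<le> l * (G g \<bullet> g)" if g: "g \<in> W" for g
  proof (cases "g = 0")
    case True
    then show ?thesis using T(1) G(1) by (simp add: linear_0)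
  next
    case False
    define h where "h = g /\<^sub>R norm g"
    have gh: "g = norm g *\<^sub>R h" and hS: "h \<in> ?S"
      using False g W(1) by (auto simp: h_def subspace_scale)
    have "G h \<bullet> h > 0" using hS nonzero pos by blast
    then have "T h \<bullet> h \<le> l * (G h \<bullet> h)"
      using max[OF hS] by (simp add: l_def pos_divide_le_eq)
    then have "(norm g)\<^sup>2 * (T h \<bullet> h) \<le> (norm g)\<^sup>2 * (l * (G h \<bullet> h))"
      by (intro mult_left_mono) auto
    moreover have "T g \<bullet> g = (norm g)\<^sup>2 * (T h \<bullet> h)" "G g \<bullet> g = (norm g)\<^sup>2 * (G h \<bullet> h)"
      by (subst (1 2) gh, simp add: linear_scale[OF T(1)] linear_scale[OF G(1)] power2_eq_square)+
    ultimately show ?thesis by (simp add: algebra_simps)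
  qed
  \<comment> \<open>The residual itself is the direction of variation, so that the first-order
    condition reads \<open>d \<bullet> d = 0\<close>. Invariance of \<open>W\<close> keeps the
    varied vector admissible.\<close>
  define d where "d = l *\<^sub>R G f - T f"
  have dW: "d \<in> W"
    using f0 T(2) G(2) W(1) by (auto simp: d_def intro!: subspace_diff subspace_scale)
  have eq: "l * (G f \<bullet> f) = T f \<bullet> f"
    using pos[OF f0] by (simp add: l_def)
  have "0 \<le> 2 * t * (d \<bullet> d) + t\<^sup>2 * (l * (G d \<bullet> d) - T d \<bullet> d)" for t
  proof -
    have "f + t *\<^sub>R d \<in> W" using f0 dW W(1) by (simp add: subspace_add subspace_scale)
    from le[OF this]
    have "T f \<bullet> f + 2 * t * (T f \<bullet> d) + t\<^sup>2 * (T d \<bullet> d)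
        \<le> l * (G f \<bullet> f + 2 * t * (G f \<bullet> d) + t\<^sup>2 * (G d \<bullet> d))"
      using T(3)[of d f] G(3)[of d f]
      by (simp add: linear_add[OF T(1)] linear_add[OF G(1)] linear_scale[OF T(1)] linear_scale[OF G(1)]
          inner_add_left inner_add_right power2_eq_square algebra_simps inner_commute)
    then show ?thesis
      using eq by (simp add: d_def inner_diff_left algebra_simps)
  qed
  then have "d \<bullet> d = 0" by (rule quadratic_nonneg_imp_linear_zero)
  then have "T f = l *\<^sub>R G f" by (simp add: d_def)
  then show ?thesis using that f0 le by blast
qed

subsection \<open>Hermitian pencils of vector families\<close>

lemma inner_complex_vec: "(f::complex^'n) \<bullet> g = Re (\<Sum>i\<in>UNIV. f $ i * cnj (g $ i))"
  by (simp add: inner_vec_def inner_complex_def)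

lemma norm_complex_vec: "(norm (f::complex^'n))\<^sup>2 = Re (\<Sum>i\<in>UNIV. f $ i * cnj (f $ i))"
  by (simp add: power2_norm_eq_inner inner_complex_vec)

text \<open>With \<open>X\<close>, \<open>Y\<close> the matrices with columns \<open>x k\<close>, \<open>y k\<close>, the hypothesis reads \<open>X Y\<^sup>* + Y X\<^sup>* = 0\<close>.
  Then \<open>i Y X\<^sup>*\<close> and \<open>X X\<^sup>*\<close> are Hermitian and preserve the range of \<open>X\<close>, on which the latter is
  definite; the vector \<open>e\<close> is \<open>X\<^sup>* f\<close> for an eigenvector \<open>f\<close> of this pair.\<close>

lemma skew_pencil_eigenvector:
  fixes x y :: "'k \<Rightarrow> complex^'n"
  assumes fin: "finite I" and k0: "k0 \<in> I" "x k0 \<noteq> 0"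
    and skew: "\<And>i j. (\<Sum>k\<in>I. x k $ i * cnj (y k $ j) + y k $ i * cnj (x k $ j)) = 0"
  obtains e :: "'k \<Rightarrow> complex" and \<omega> :: real
  where "\<exists>k\<in>I. e k \<noteq> 0"
    "\<And>i. (\<Sum>k\<in>I. e k * y k $ i) = \<i> * of_real \<omega> * (\<Sum>k\<in>I. e k * x k $ i)"
proof -
  define comb where "comb z e = (\<chi> i. \<Sum>k\<in>I. e k * z k $ i)" for z :: "'k \<Rightarrow> complex^'n" and e
  define xs where "xs f k = (\<Sum>i\<in>UNIV. cnj (x k $ i) * f $ i)" for f :: "complex^'n" and k
  define ys where "ys f k = (\<Sum>i\<in>UNIV. cnj (y k $ i) * f $ i)" for f :: "complex^'n" and k
  define W where "W = range (comb x)"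
  define G where "G f = comb x (xs f)" for f
  define T where "T f = comb y (\<lambda>k. \<i> * xs f k)" for f
  have comb_add: "comb z (\<lambda>k. e k + e' k) = comb z e + comb z e'"
    and comb_scale: "comb z (\<lambda>k. c *\<^sub>R e k) = c *\<^sub>R comb z e" for z e e' c
    by (simp_all add: comb_def vec_eq_iff algebra_simps sum.distrib flip: scaleR_sum_right)
  have xs_add: "xs (f + g) = (\<lambda>k. xs f k + xs g k)" and xs_scale: "xs (c *\<^sub>R f) = (\<lambda>k. c *\<^sub>R xs f k)" for f g c
    by (simp_all add: xs_def fun_eq_iff algebra_simps sum.distrib flip: scaleR_sum_right)
  have linG: "linear G"
    by (rule linearI) (simp_all add: G_def xs_add xs_scale comb_add comb_scale)
  have linT: "linear T"
  proof (rule linearI)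
    show "T (f + g) = T f + T g" for f g
      by (simp add: T_def xs_add distrib_left comb_add)
    show "T (c *\<^sub>R f) = c *\<^sub>R T f" for c f
      by (simp add: T_def xs_scale comb_scale)
  qed
  \<comment> \<open>The skew hypothesis rewrites \<open>Y X^*\<close> as \<open>- X Y^*\<close>.
    This puts the range of \<open>T\<close> inside \<open>W\<close> and makes \<open>T\<close>
    symmetric.\<close>
  have T_alt: "T f = comb x (\<lambda>k. - \<i> * ys f k)" for f
  proof -
    have "(\<Sum>k\<in>I. \<i> * xs f k * y k $ i) = (\<Sum>k\<in>I. - \<i> * ys f k * x k $ i)" for i
    proof -
      have "(\<Sum>k\<in>I. \<i> * xs f k * y k $ i) - (\<Sum>k\<in>I. - \<i> * ys f k * x k $ i)
          = (\<Sum>k\<in>I. \<Sum>j\<in>UNIV. \<i> * f $ j * (x k $ i * cnj (y k $ j) + y k $ i * cnj (x k $ j)))"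
        unfolding xs_def ys_def
        by (simp add: sum_distrib_left sum_distrib_right algebra_simps sum.distrib flip: sum_subtractf)
      also have "\<dots> = (\<Sum>j\<in>UNIV. \<i> * f $ j * (\<Sum>k\<in>I. x k $ i * cnj (y k $ j) + y k $ i * cnj (x k $ j)))"
        by (subst sum.swap) (simp add: sum_distrib_left)
      also have "\<dots> = 0" by (simp only: skew) simp
      finally show ?thesis by simp
    qed
    then show ?thesis by (simp add: T_def comb_def vec_eq_iff)
  qed
  have inner_comb_x: "comb x e \<bullet> g = Re (\<Sum>k\<in>I. e k * cnj (xs g k))" for e g
    unfolding inner_complex_vec comb_def xs_def
    by (simp add: sum_distrib_left sum_distrib_right mult.assoc) (subst sum.swap, simp)
  have inner_comb_y: "comb y e \<bullet> g = Re (\<Sum>k\<in>I. e k * cnj (ys g k))" for e g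
    unfolding inner_complex_vec comb_def ys_def
    by (simp add: sum_distrib_left sum_distrib_right mult.assoc) (subst sum.swap, simp)
  have symG: "G f \<bullet> g = f \<bullet> G g" for f g
    by (subst (2) inner_commute) (simp add: G_def inner_comb_x mult.commute)
  have symT: "T f \<bullet> g = f \<bullet> T g" for f g
  proof -
    have "f \<bullet> T g = Re (\<Sum>k\<in>I. - \<i> * ys g k * cnj (xs f k))"
      by (subst inner_commute) (simp add: T_alt inner_comb_x)
    also have "\<dots> = Re (\<Sum>k\<in>I. \<i> * xs f k * cnj (ys g k))"
      by (simp add: mult.commute)
    also have "\<dots> = T f \<bullet> g"
      by (simp add: T_def inner_comb_y)
    finally show ?thesis by simp
  qed
  have subW: "subspace W"
    unfolding subspace_def W_def
  proof (intro conjI ballI allI)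
    show "0 \<in> range (comb x)" by (rule image_eqI[of _ _ "\<lambda>_. 0"]) (simp_all add: comb_def vec_eq_iff)
    show "a + b \<in> range (comb x)" if "a \<in> range (comb x)" "b \<in> range (comb x)" for a b
      using that by (auto simp flip: comb_add)
    show "c *\<^sub>R a \<in> range (comb x)" if "a \<in> range (comb x)" for a c
      using that by (auto simp flip: comb_scale)
  qed
  have posG: "G f \<bullet> f > 0" if f: "f \<in> W" "f \<noteq> 0" for f
  proof -
    have GG: "G f \<bullet> f = (\<Sum>k\<in>I. (cmod (xs f k))\<^sup>2)"
      unfolding G_def inner_comb_x by (simp add: cmod_power2) (simp add: power2_eq_square)
    obtain e where e: "f = comb x e" using f(1) by (auto simp: W_def)
    have "\<exists>k\<in>I. xs f k \<noteq> 0"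
    proof (rule ccontr)
      assume "\<not> ?thesis"
      then have "f \<bullet> f = 0" by (subst (1) e) (simp add: inner_comb_x)
      then show False using f(2) by simp
    qed
    then show ?thesis unfolding GG using fin by (auto intro!: sum_pos2)
  qed
  have "x k0 \<in> W"
  proof -
    have "x k0 = comb x (\<lambda>k. of_bool (k = k0))"
      using fin k0 by (simp add: comb_def vec_eq_iff of_bool_def if_distrib[of "\<lambda>x. x * y" for y] cong: if_cong)
    then show ?thesis by (auto simp: W_def)
  qed
  then have W0: "W \<noteq> {0}" using k0(2) by auto
  have TW: "T ` W \<subseteq> W" and GW: "G ` W \<subseteq> W" by (auto simp: T_alt G_def W_def)
  obtain f l where f: "f \<in> W" "f \<noteq> 0" "T f = l *\<^sub>R G f"
    by (rule generalized_rayleigh[OF subW W0 linT TW symT linG GW symG posG]) (assumption | rule that)+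
  show ?thesis
  \<comment> \<open>\<open>T f = l G f\<close> reads \<open>i Y e = l X e\<close>, hence
    \<open>\<omega> = - l\<close>.\<close>
  proof (rule that[of "xs f" "- l"])
    show "\<exists>k\<in>I. xs f k \<noteq> 0"
    proof (rule ccontr)
      assume "\<not> ?thesis"
      then have "G f = 0" by (simp add: G_def comb_def vec_eq_iff)
      then show False using posG[OF f(1,2)] by simp
    qed
    show "(\<Sum>k\<in>I. xs f k * y k $ i) = \<i> * of_real (- l) * (\<Sum>k\<in>I. xs f k * x k $ i)" for i
    proof -
      have "T f $ i = \<i> * (\<Sum>k\<in>I. xs f k * y k $ i)"
        by (simp add: T_def comb_def sum_distrib_left mult.assoc)
      moreover have "(l *\<^sub>R G f) $ i = of_real l * (\<Sum>k\<in>I. xs f k * x k $ i)"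
        by (simp only: vector_scaleR_component) (simp add: G_def comb_def scaleR_conv_of_real)
      ultimately have "\<i> * (\<Sum>k\<in>I. xs f k * y k $ i) = of_real l * (\<Sum>k\<in>I. xs f k * x k $ i)"
        using f(3) by simp
      then have "\<i> * (\<i> * (\<Sum>k\<in>I. xs f k * y k $ i)) = \<i> * (of_real l * (\<Sum>k\<in>I. xs f k * x k $ i))"
        by simp
      then show ?thesis by (simp add: minus_equation_iff[of "\<Sum>k\<in>I. xs f k * y k $ i"] flip: mult.assoc)
    qed
  qed
qed

text \<open>For a unit vector \<open>e\<close> with \<open>e p\<close> real and nonpositive, the next transformation is multiplication
  by the Householder unitary exchanging \<open>e\<close> with the \<open>p\<close>-th basis vector.\<close>

definition householder :: "'k set \<Rightarrow> 'k \<Rightarrow> ('k \<Rightarrow> complex) \<Rightarrow> ('k \<Rightarrow> complex) \<Rightarrow> 'k \<Rightarrow> complex" where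
  "householder I p e a k = a k - cnj (e k - of_bool (k = p)) * (\<Sum>j\<in>I. (e j - of_bool (j = p)) * a j) / (1 - e p)"

text \<open>As \<open>e p\<close> is real, \<open>cnj (e p - 1)\<close> cancels the denominator up
  to sign, and \<open>r \<le> 0\<close> keeps that denominator away from 0. In this way the
  combination with coefficients \<open>e\<close> becomes one member of the family.\<close>

lemma householder_pivot:
  assumes "finite I" "p \<in> I" "e p = complex_of_real r" "r \<le> 0"
  shows "householder I p e a p = (\<Sum>k\<in>I. e k * a k)"
proof -
  have ne: "1 - e p \<noteq> 0" using assms by (simp add: complex_eq_iff)
  have "(\<Sum>j\<in>I. (e j - of_bool (j = p)) * a j) = (\<Sum>k\<in>I. e k * a k) - a p"
    using assms by (simp add: left_diff_distrib sum_subtractf of_bool_def if_distrib[of "\<lambda>x. x * y" for y] cong: if_cong)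
  moreover have "cnj (e p - 1) = - (1 - e p)" using assms by simp
  ultimately have "householder I p e a p = a p - - (1 - e p) * ((\<Sum>k\<in>I. e k * a k) - a p) / (1 - e p)"
    by (simp only: householder_def of_bool_eq simp_thms)
  also have "\<dots> = (\<Sum>k\<in>I. e k * a k)"
    using ne by (simp only: mult_minus_left minus_divide_left[symmetric] nonzero_mult_div_cancel_left)
      simp
  finally show ?thesis .
qed

lemma householder_preserves:
  assumes fin: "finite I" "p \<in> I" and e: "e p = complex_of_real r" "r \<le> 0" "(\<Sum>k\<in>I. (cmod (e k))\<^sup>2) = 1"
  shows "(\<Sum>k\<in>I. householder I p e a k * cnj (householder I p e b k)) = (\<Sum>k\<in>I. a k * cnj (b k))"
proof -
  define u where "u k = e k - of_bool (k = p)" for k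
  define c where "c = complex_of_real (1 - r)"
  have c: "c \<noteq> 0" "1 - e p = c" "cnj c = c" using e by (auto simp: c_def complex_eq_iff)
  define va where "va = (\<Sum>j\<in>I. u j * a j)"
  define vb where "vb = (\<Sum>j\<in>I. u j * b j)"
  \<comment> \<open>Unit length of \<open>e\<close> gives \<open>|u|^2 = 2 * (1 - r)\<close>, so
    \<open>1 / c\<close> is the factor \<open>2 / |u|^2\<close> of a unitary reflection.\<close>
  have uu: "(\<Sum>k\<in>I. cnj (u k) * u k) = 2 * c"
  proof -
    have "(\<Sum>k\<in>I. cnj (u k) * u k) = (\<Sum>k\<in>I. of_real ((cmod (e k))\<^sup>2) - of_bool (k = p) * (e k + cnj (e k) - 1))"
      by (rule sum.cong) (auto simp: u_def complex_norm_square algebra_simps simp del: of_real_power)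
    also have "\<dots> = of_real 1 - (e p + cnj (e p) - 1)"
      using fin by (simp add: sum_subtractf e(3) of_bool_def if_distrib[of "\<lambda>x. x * y" for y] cong: if_cong
          flip: of_real_sum del: of_real_power)
    also have "\<dots> = 2 * c" using e by (simp add: c_def)
    finally show ?thesis .
  qed
  have "(\<Sum>k\<in>I. householder I p e a k * cnj (householder I p e b k))
      = (\<Sum>k\<in>I. a k * cnj (b k) - (u k * a k) * cnj vb / c - cnj (u k * b k) * va / c
          + (cnj (u k) * u k) * (va * cnj vb / c\<^sup>2))"
    unfolding householder_def c u_def[symmetric] va_def[symmetric] vb_def[symmetric]
    by (rule sum.cong) (use c in \<open>auto simp: field_simps power2_eq_square\<close>)
  also have "\<dots> = (\<Sum>k\<in>I. a k * cnj (b k)) - va * cnj vb / c - cnj vb * va / c + 2 * c * (va * cnj vb / c\<^sup>2)"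
    unfolding sum.distrib sum_subtractf uu[symmetric] va_def vb_def cnj_sum
    by (simp add: sum_distrib_right sum_divide_distrib)
  also have "\<dots> = (\<Sum>k\<in>I. a k * cnj (b k))"
    using c by (simp add: field_simps power2_eq_square)
  finally show ?thesis .
qed

lemma householder_linear:
  "householder I p e (\<lambda>k. a k + b k) k = householder I p e a k + householder I p e b k"
  "householder I p e (\<lambda>k. s * a k) k = s * householder I p e a k"
proof -
  let ?S = "\<lambda>a. \<Sum>j\<in>I. (e j - of_bool (j = p)) * a j"
  have "?S (\<lambda>k. a k + b k) = ?S a + ?S b" "?S (\<lambda>k. s * a k) = s * ?S a"
    by (simp_all add: distrib_left sum.distrib sum_distrib_left mult.left_commute)
  then show "householder I p e (\<lambda>k. a k + b k) k = householder I p e a k + householder I p e b k"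
    "householder I p e (\<lambda>k. s * a k) k = s * householder I p e a k"
    by (simp_all add: householder_def distrib_left right_diff_distrib add_divide_distrib)
qed

lemma householder_sum:
  assumes "finite J"
  shows "householder I p e (\<lambda>k. \<Sum>j\<in>J. a j k) k = (\<Sum>j\<in>J. householder I p e (a j) k)"
  using assms
proof (induction J)
  case empty
  then show ?case by (simp add: householder_def)
next
  case (insert j J)
  then show ?case by (simp add: householder_linear)
qed

text \<open>The transformation mixes the members \<open>k\<close> of the family, whereas
  \<open>M\<close> acts on the coordinates \<open>i\<close> of each member, so the two
  commute.\<close>

lemma householder_matrix_vector:
  fixes M :: "complex^'n^'m"
  shows "(\<chi> i. householder I p e (\<lambda>k. (M *v x k) $ i) k) = M *v (\<chi> i. householder I p e (\<lambda>k. x k $ i) k)"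
  by (simp add: matrix_vector_mult_def vec_eq_iff householder_sum householder_linear)

lemma sum_norm_householder:
  fixes z :: "'k \<Rightarrow> complex^'n"
  assumes "finite I" "p \<in> I" "e p = complex_of_real r" "r \<le> 0" "(\<Sum>k\<in>I. (cmod (e k))\<^sup>2) = 1"
  shows "(\<Sum>k\<in>I. (norm ((\<chi> i. householder I p e (\<lambda>k. z k $ i) k) :: complex^'n))\<^sup>2) = (\<Sum>k\<in>I. (norm (z k))\<^sup>2)"
proof -
  have "(\<Sum>k\<in>I. (norm ((\<chi> i. f k i) :: complex^'n))\<^sup>2) = Re (\<Sum>i\<in>UNIV. \<Sum>k\<in>I. f k i * cnj (f k i))" for f
    unfolding norm_complex_vec by (subst sum.swap) simp
  from this[of "\<lambda>k i. householder I p e (\<lambda>k. z k $ i) k"] this[of "\<lambda>k i. z k $ i"]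
  show ?thesis by (simp only: householder_preserves[of I p e r, OF assms] vec_lambda_eta)
qed

text \<open>Splitting off the eigenvector of the pencil as one member of the family reduces the quadratic
  inequality to single vectors satisfying \<open>A x + B w = i \<omega> x\<close>.\<close>

lemma frequency_inequality_family:
  fixes A :: "complex^'n^'n" and B :: "complex^'w^'n" and C :: "complex^'n^'z" and D :: "complex^'w^'z"
  assumes fin: "finite I"
    and freq: "\<And>\<omega> x w. A *v x + B *v w = (\<i> * complex_of_real \<omega>) *s x \<Longrightarrow>
        (norm (C *v x + D *v w))\<^sup>2 + d * (norm x)\<^sup>2 \<le> g * (norm w)\<^sup>2"
    and zero: "\<And>w. (norm (D *v w))\<^sup>2 \<le> g * (norm w)\<^sup>2"
    and skew: "\<And>i j. (\<Sum>k\<in>I. x k $ i * cnj ((A *v x k + B *v w k) $ j) + (A *v x k + B *v w k) $ i * cnj (x k $ j)) = 0"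
  shows "(\<Sum>k\<in>I. (norm (C *v x k + D *v w k))\<^sup>2 + d * (norm (x k))\<^sup>2) \<le> g * (\<Sum>k\<in>I. (norm (w k))\<^sup>2)"
  using fin skew
proof (induction "card I" arbitrary: I x w)
  case 0
  then show ?case by simp
next
  case (Suc n)
  define y where "y k = A *v x k + B *v w k" for k
  note skew = Suc.prems(2)[folded y_def]
  have "I \<noteq> {}" using Suc.hyps(2) by auto
  then obtain p where p: "p \<in> I" by blast
  \<comment> \<open>If some \<open>x k\<close> is nonzero, the pencil supplies \<open>e\<close>; if
    all vanish, any nonzero \<open>e\<close> makes the combination of the \<open>x k\<close>
    zero.\<close>
  have "\<exists>e \<omega>. (\<exists>k\<in>I. e k \<noteq> 0) \<and> ((\<forall>i. (\<Sum>k\<in>I. e k * x k $ i) = 0) \<or>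
      (\<forall>i. (\<Sum>k\<in>I. e k * y k $ i) = \<i> * complex_of_real \<omega> * (\<Sum>k\<in>I. e k * x k $ i)))"
  proof (cases "\<exists>k\<in>I. x k \<noteq> 0")
    case True
    then obtain k0 where "k0 \<in> I" "x k0 \<noteq> 0" by blast
    from skew_pencil_eigenvector[OF Suc.prems(1) this skew] show ?thesis by metis
  next
    case False
    then show ?thesis using p by (intro exI[of _ "\<lambda>_. 1"]) auto
  qed
  then obtain e0 :: "'a \<Rightarrow> complex" and \<omega> where e0: "\<exists>k\<in>I. e0 k \<noteq> 0"
    and e0x: "(\<forall>i. (\<Sum>k\<in>I. e0 k * x k $ i) = 0) \<or>
      (\<forall>i. (\<Sum>k\<in>I. e0 k * y k $ i) = \<i> * complex_of_real \<omega> * (\<Sum>k\<in>I. e0 k * x k $ i))" by blast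
  define N where "N = sqrt (\<Sum>k\<in>I. (cmod (e0 k))\<^sup>2)"
  have Npos: "(\<Sum>k\<in>I. (cmod (e0 k))\<^sup>2) > 0"
    using e0 Suc.prems(1) by (auto intro!: sum_pos2)
  then have N: "N > 0" "N\<^sup>2 = (\<Sum>k\<in>I. (cmod (e0 k))\<^sup>2)" by (auto simp: N_def)
  \<comment> \<open>The phase that turns \<open>e p\<close> into a nonpositive real, as the
    Householder formula requires; any phase does when \<open>e0 p = 0\<close>.\<close>
  define q where "q = (if e0 p = 0 then 1 else - cnj (sgn (e0 p)))"
  define s where "s = q / complex_of_real N"
  define e where "e k = s * e0 k" for k
  define r where "r = - cmod (e0 p) / N"
  have q: "cmod q = 1" by (simp add: q_def norm_sgn)
  have er: "e p = complex_of_real r"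
  proof (cases "e0 p = 0")
    case False
    have "cnj (sgn (e0 p)) * e0 p = of_real (cmod (e0 p))"
      using False by (simp add: sgn_div_norm scaleR_conv_of_real mult.commute[of _ "e0 p"] complex_norm_square[symmetric]
           power2_eq_square divide_simps)
    then show ?thesis using False by (simp add: e_def s_def q_def r_def)
  qed (simp add: e_def r_def)
  have r: "r \<le> 0" using N by (simp add: r_def)
  have e1: "(\<Sum>k\<in>I. (cmod (e k))\<^sup>2) = 1"
  proof -
    have "(cmod (e k))\<^sup>2 = (cmod (e0 k))\<^sup>2 / N\<^sup>2" for k
      using q N(1) by (simp add: e_def s_def norm_mult norm_divide power_mult_distrib power_divide)
    then have "(\<Sum>k\<in>I. (cmod (e k))\<^sup>2) = (\<Sum>k\<in>I. (cmod (e0 k))\<^sup>2) / N\<^sup>2"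
      by (simp only: sum_divide_distrib)
    also have "\<dots> = 1" unfolding N(2) using Npos by (intro divide_self) linarith
    finally show ?thesis .
  qed
  have comb_e: "(\<Sum>k\<in>I. e k * f k) = s * (\<Sum>k\<in>I. e0 k * f k)" for f
    by (simp add: e_def sum_distrib_left mult.assoc)
  have ex: "(\<forall>i. (\<Sum>k\<in>I. e k * x k $ i) = 0) \<or>
      (\<forall>i. (\<Sum>k\<in>I. e k * y k $ i) = \<i> * complex_of_real \<omega> * (\<Sum>k\<in>I. e k * x k $ i))"
    using e0x by (auto simp: comb_e)
  define x' :: "'a \<Rightarrow> complex^'n" where "x' k = (\<chi> i. householder I p e (\<lambda>k. x k $ i) k)" for k
  define w' :: "'a \<Rightarrow> complex^'w" where "w' k = (\<chi> i. householder I p e (\<lambda>k. w k $ i) k)" for k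
  have tr_add: "(\<chi> i. householder I p e (\<lambda>k. (M *v x k + L *v w k) $ i) k) = M *v x' k + L *v w' k"
    for M :: "complex^'n^'m" and L :: "complex^'w^'m" and k
    unfolding x'_def w'_def householder_matrix_vector[symmetric]
    by (simp add: vec_eq_iff householder_linear)
  define y' where "y' k = A *v x' k + B *v w' k" for k
  have y': "y' k $ i = householder I p e (\<lambda>k. y k $ i) k" for k i
    unfolding y'_def y_def tr_add[symmetric] by simp
  have x': "x' k $ i = householder I p e (\<lambda>k. x k $ i) k" for k i
    by (simp add: x'_def)
  note pres = householder_preserves[of I p e r, OF Suc.prems(1) p er r e1]
  note pivot = householder_pivot[of I p e r, OF Suc.prems(1) p er r]
  have skew': "(\<Sum>k\<in>I. x' k $ i * cnj (y' k $ j) + y' k $ i * cnj (x' k $ j)) = 0" for i j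
    using skew[of i j] by (simp add: x' y' sum.distrib pres)
  have dicho: "x' p = 0 \<or> y' p = (\<i> * complex_of_real \<omega>) *s x' p"
    using ex by (auto simp: x' y' vec_eq_iff pivot)
  \<comment> \<open>The pivot member satisfies the skew condition by itself, so the remaining
    members satisfy it too and the induction hypothesis applies to them.\<close>
  have skewp: "x' p $ i * cnj (y' p $ j) + y' p $ i * cnj (x' p $ j) = 0" for i j
    using dicho by auto
  have IH: "(\<Sum>k\<in>I - {p}. (norm (C *v x' k + D *v w' k))\<^sup>2 + d * (norm (x' k))\<^sup>2) \<le> g * (\<Sum>k\<in>I - {p}. (norm (w' k))\<^sup>2)"
  proof (rule Suc.hyps(1))
    show "n = card (I - {p})" using Suc.hyps(2) p by simp
    show "finite (I - {p})" using Suc.prems(1) by simp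
    show "(\<Sum>k\<in>I - {p}. x' k $ i * cnj ((A *v x' k + B *v w' k) $ j) + (A *v x' k + B *v w' k) $ i * cnj (x' k $ j)) = 0" for i j
      using skew'[of i j] unfolding y'_def[symmetric]
      by (subst (asm) sum.remove[OF Suc.prems(1) p]) (simp only: skewp add_0)
  qed
  have single: "(norm (C *v x' p + D *v w' p))\<^sup>2 + d * (norm (x' p))\<^sup>2 \<le> g * (norm (w' p))\<^sup>2"
    using dicho
  proof
    assume "x' p = 0" then show ?thesis using zero[of "w' p"] by simp
  next
    assume "y' p = (\<i> * complex_of_real \<omega>) *s x' p"
    then show ?thesis by (intro freq[where \<omega> = \<omega>]) (simp only: y'_def)
  qed
  note sn = sum_norm_householder[of I p e r, OF Suc.prems(1) p er r e1]
  have "(\<Sum>k\<in>I. (norm (C *v x' k + D *v w' k))\<^sup>2 + d * (norm (x' k))\<^sup>2) \<le> g * (\<Sum>k\<in>I. (norm (w' k))\<^sup>2)"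
    using add_mono[OF single IH]
    unfolding sum.remove[OF Suc.prems(1) p, of "\<lambda>k. (norm (w' k))\<^sup>2"] distrib_left
    by (subst sum.remove[OF Suc.prems(1) p])
  moreover have "(\<Sum>k\<in>I. (norm (C *v x' k + D *v w' k))\<^sup>2) = (\<Sum>k\<in>I. (norm (C *v x k + D *v w k))\<^sup>2)"
    unfolding tr_add[symmetric] by (rule sn)
  moreover have "(\<Sum>k\<in>I. (norm (x' k))\<^sup>2) = (\<Sum>k\<in>I. (norm (x k))\<^sup>2)" "(\<Sum>k\<in>I. (norm (w' k))\<^sup>2) = (\<Sum>k\<in>I. (norm (w k))\<^sup>2)"
    unfolding x'_def w'_def by (rule sn)+
  ultimately show ?case by (simp add: sum.distrib flip: sum_distrib_left)
qed

subsection \<open>Complexification of real matrices\<close>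

definition cvec :: "real^'n \<Rightarrow> complex^'n" where "cvec x = (\<chi> i. complex_of_real (x $ i))"
definition re_vec :: "complex^'n \<Rightarrow> real^'n" where "re_vec x = (\<chi> i. Re (x $ i))"
definition im_vec :: "complex^'n \<Rightarrow> real^'n" where "im_vec x = (\<chi> i. Im (x $ i))"

lemma cmat_mult_cvec: "cmat M *v cvec x = cvec (M *v x)"
  by (simp add: cmat_def cvec_def matrix_vector_mult_def vec_eq_iff)

lemma re_vec_cmat: "re_vec (cmat M *v x) = M *v re_vec x"
  and im_vec_cmat: "im_vec (cmat M *v x) = M *v im_vec x"
  by (simp_all add: cmat_def re_vec_def im_vec_def matrix_vector_mult_def vec_eq_iff)

lemma cvec_add: "cvec (x + y) = cvec x + cvec y"
  by (simp add: cvec_def vec_eq_iff)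

lemma re_vec_add: "re_vec (x + y) = re_vec x + re_vec y"
  and im_vec_add: "im_vec (x + y) = im_vec x + im_vec y"
  and re_vec_scale: "re_vec (s *s x) = Re s *\<^sub>R re_vec x - Im s *\<^sub>R im_vec x"
  and im_vec_scale: "im_vec (s *s x) = Re s *\<^sub>R im_vec x + Im s *\<^sub>R re_vec x"
  by (simp_all add: re_vec_def im_vec_def vec_eq_iff)

lemma inner_re_im: "x \<bullet> y = re_vec x \<bullet> re_vec y + im_vec x \<bullet> im_vec y"
  by (simp add: inner_vec_def re_vec_def im_vec_def inner_complex_def sum.distrib)

lemma norm_re_im: "(norm x)\<^sup>2 = (norm (re_vec x))\<^sup>2 + (norm (im_vec x))\<^sup>2"
  by (simp add: power2_norm_eq_inner inner_re_im)

lemma norm_cvec: "norm (cvec x) = norm x"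
  by (simp add: norm_vec_def cvec_def)

lemma re_im_vec_eq_0_iff: "re_vec x = 0 \<and> im_vec x = 0 \<longleftrightarrow> x = 0"
  by (auto simp: re_vec_def im_vec_def vec_eq_iff complex_eq_iff)

lemma mat_mult_vector: "mat s *v x = s *s (x :: complex^'n)"
  by (simp add: mat_def matrix_vector_mult_def vec_eq_iff if_distrib[of "\<lambda>x. x * y" for y] cong: if_cong)

lemma matrix_inv_inverse:
  assumes "invertible M"
  shows "M ** matrix_inv M = mat 1" "matrix_inv M ** M = mat 1"
  using someI_ex[OF assms[unfolded invertible_def]] unfolding matrix_inv_def by auto

lemma det_zero_iff_kernel: "det (M :: complex^'n^'n) = 0 \<longleftrightarrow> (\<exists>x. x \<noteq> 0 \<and> M *v x = 0)"
  using invertible_det_nz[of M] invertible_left_inverse[of M] matrix_left_invertible_ker[of M] by blast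

lemma hurwitz_iff_eigenvalues:
  "hurwitz M \<longleftrightarrow> (\<forall>s x. x \<noteq> 0 \<longrightarrow> cmat M *v x = s *s x \<longrightarrow> Re s < 0)"
proof -
  have "det (mat s - cmat M) = 0 \<longleftrightarrow> (\<exists>x. x \<noteq> 0 \<and> cmat M *v x = s *s x)" for s
    unfolding det_zero_iff_kernel by (auto simp: matrix_vector_mult_diff_rdistrib mat_mult_vector)
  then show ?thesis unfolding hurwitz_def by blast
qed

subsection \<open>Frequency response bounds\<close>

definition transfer :: "real^'n^'n \<Rightarrow> real^'w^'n \<Rightarrow> real^'n^'z \<Rightarrow> real^'w^'z \<Rightarrow> complex \<Rightarrow> complex^'w^'z" where
  "transfer A B C D s = cmat C ** matrix_inv (mat s - cmat A) ** cmat B + cmat D"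

lemma norm_matrix_vector_bound:
  fixes M :: "complex^'n^'m"
  obtains b where "b \<ge> 0" "\<And>x. norm (M *v x) \<le> b * norm x"
  using bounded_linear.nonneg_bounded[OF matrix_vector_mul_bounded_linear[of M]] by (metis mult.commute)

lemma norm_scale_complex_vec: "norm (s *s (x :: complex^'n)) = cmod s * norm x"
  by (simp add: norm_vec_def norm_mult L2_set_right_distrib)

text \<open>For \<open>|\<omega>| > a + 1\<close> the term \<open>i \<omega> x\<close> dominates
  \<open>A x\<close>. The remaining frequencies, paired with unit vectors, form a compact set on
  which the residual cannot vanish, since a Hurwitz matrix has no imaginary eigenvalue.\<close>

lemma resolvent_bound:
  fixes A :: "real^'n^'n"
  assumes "hurwitz A"
  obtains c where "c > 0" "\<And>\<omega> x. norm x \<le> c * norm ((\<i> * complex_of_real \<omega>) *s x - cmat A *v x)"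
proof -
  obtain a where a: "a \<ge> 0" "\<And>x. norm (cmat A *v x) \<le> a * norm x"
    by (rule norm_matrix_vector_bound[of "cmat A"]) blast
  let ?K = "{- (a + 1)..a + 1} \<times> sphere (0::complex^'n) 1"
  let ?f = "\<lambda>p::real \<times> (complex^'n). norm ((\<i> * complex_of_real (fst p)) *s snd p - cmat A *v snd p)"
  have "compact ?K" by (intro compact_Times) auto
  moreover have "axis undefined 1 \<in> sphere (0::complex^'n) 1" by simp
  then have "?K \<noteq> {}" using a(1) by auto
  moreover have "continuous_on ?K ?f"
    unfolding vector_scalar_mult_def matrix_vector_mult_def
    by (intro continuous_intros)
  ultimately obtain p where p: "p \<in> ?K" "\<And>q. q \<in> ?K \<Longrightarrow> ?f p \<le> ?f q"
    using continuous_attains_inf[of ?K ?f] by blast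
  define m where "m = ?f p"
  have "snd p \<noteq> 0" using p(1) by auto
  have "m \<noteq> 0"
  proof
    assume "m = 0"
    then have "cmat A *v snd p = (\<i> * complex_of_real (fst p)) *s snd p" by (simp add: m_def)
    then have "Re (\<i> * complex_of_real (fst p)) < 0"
      using assms \<open>snd p \<noteq> 0\<close> unfolding hurwitz_iff_eigenvalues by blast
    then show False by simp
  qed
  then have m: "m > 0" unfolding m_def by simp
  define c where "c = max 1 (1 / m)"
  show ?thesis
  proof (rule that[of c])
    show "c > 0" by (simp add: c_def)
    fix \<omega> :: real and x :: "complex^'n"
    let ?r = "(\<i> * complex_of_real \<omega>) *s x - cmat A *v x"
    show "norm x \<le> c * norm ?r"
    proof (cases "\<bar>\<omega>\<bar> \<le> a + 1")
      case True
      show ?thesis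
      proof (cases "x = 0")
        case False
        have "(\<omega>, x /\<^sub>R norm x) \<in> ?K" using True False by auto
        from p(2)[OF this] have "m \<le> norm ((\<i> * complex_of_real \<omega>) *s (x /\<^sub>R norm x) - cmat A *v (x /\<^sub>R norm x))"
          by (simp add: m_def)
        also have "(\<i> * complex_of_real \<omega>) *s (x /\<^sub>R norm x) - cmat A *v (x /\<^sub>R norm x) = ?r /\<^sub>R norm x"
          by (simp add: vec_eq_iff matrix_vector_mult_def algebra_simps scaleR_sum_right)
        finally have "m \<le> inverse (norm x) * norm ?r" by (simp only: norm_scaleR abs_inverse abs_norm_cancel)
        then have "m * norm x \<le> norm ?r" using False by (simp add: field_simps)
        then have "norm x \<le> (1 / m) * norm ?r" using m by (simp add: field_simps)
        also have "\<dots> \<le> c * norm ?r" by (intro mult_right_mono) (auto simp: c_def)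
        finally show ?thesis .
      qed simp
    next
      case False
      have "(a + 1) * norm x \<le> \<bar>\<omega>\<bar> * norm x" using False by (intro mult_right_mono) auto
      also have "\<dots> = norm ((\<i> * complex_of_real \<omega>) *s x)" by (simp add: norm_scale_complex_vec norm_mult)
      also have "\<dots> \<le> norm ?r + norm (cmat A *v x)" by (metis diff_add_cancel norm_triangle_ineq)
      also have "\<dots> \<le> norm ?r + a * norm x" using a(2) by simp
      finally have "norm x \<le> 1 * norm ?r" by (simp add: algebra_simps)
      also have "\<dots> \<le> c * norm ?r" by (intro mult_right_mono) (auto simp: c_def)
      finally show ?thesis .
    qed
  qed
qed

text \<open>Trades the resolvent for a solution \<open>x\<close> of the state equation, so that
  later estimates need not mention an inverse.\<close>

lemma transfer_apply:
  assumes "hurwitz A"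
  shows "\<exists>x. cmat A *v x + cmat B *v w = (\<i> * complex_of_real \<omega>) *s x"
    and "cmat A *v x + cmat B *v w = (\<i> * complex_of_real \<omega>) *s x
      \<Longrightarrow> transfer A B C D (\<i> * complex_of_real \<omega>) *v w = cmat C *v x + cmat D *v w"
proof -
  let ?M = "mat (\<i> * complex_of_real \<omega>) - cmat A"
  have "det ?M \<noteq> 0" using assms by (force simp: hurwitz_def)
  then have "invertible ?M" by (simp add: invertible_det_nz)
  then have inv: "?M ** matrix_inv ?M = mat 1" "matrix_inv ?M ** ?M = mat 1"
    by (rule matrix_inv_inverse)+
  have M: "?M *v x = (\<i> * complex_of_real \<omega>) *s x - cmat A *v x" for x
    by (simp add: matrix_vector_mult_diff_rdistrib mat_mult_vector)
  have "?M *v (matrix_inv ?M *v (cmat B *v w)) = cmat B *v w"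
    by (simp add: matrix_vector_mul_assoc matrix_mul_assoc inv)
  then show "\<exists>x. cmat A *v x + cmat B *v w = (\<i> * complex_of_real \<omega>) *s x"
    unfolding M by (intro exI[of _ "matrix_inv ?M *v (cmat B *v w)"]) (simp add: algebra_simps)
  assume "cmat A *v x + cmat B *v w = (\<i> * complex_of_real \<omega>) *s x"
  then have "cmat B *v w = (\<i> * complex_of_real \<omega>) *s x - cmat A *v x" by (simp add: eq_diff_eq add.commute)
  then have "cmat B *v w = ?M *v x" by (simp only: M)
  then have "matrix_inv ?M *v (cmat B *v w) = x" by (simp add: matrix_vector_mul_assoc inv)
  then show "transfer A B C D (\<i> * complex_of_real \<omega>) *v w = cmat C *v x + cmat D *v w"
    by (simp add: transfer_def matrix_vector_mult_add_rdistrib flip: matrix_vector_mul_assoc)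
qed

lemma frequency_state_bound:
  assumes "hurwitz A"
  obtains c where "c > 0"
    "\<And>\<omega> x w. cmat A *v x + cmat B *v w = (\<i> * complex_of_real \<omega>) *s x \<Longrightarrow> norm x \<le> c * norm w"
proof -
  obtain c where c: "c > 0" "\<And>\<omega> x. norm x \<le> c * norm ((\<i> * complex_of_real \<omega>) *s x - cmat A *v x)"
    using resolvent_bound[OF assms] by blast
  obtain b where b: "b \<ge> 0" "\<And>w. norm (cmat B *v w) \<le> b * norm w"
    by (rule norm_matrix_vector_bound[of "cmat B"]) blast
  show ?thesis
  proof (rule that[of "c * (b + 1)"])
    show "c * (b + 1) > 0" using b c by simp
    fix \<omega> x w assume "cmat A *v x + cmat B *v w = (\<i> * complex_of_real \<omega>) *s x"
    then have "(\<i> * complex_of_real \<omega>) *s x - cmat A *v x = cmat B *v w" by (simp add: algebra_simps)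
    then have "norm x \<le> c * norm (cmat B *v w)" using c(2)[of x \<omega>] by simp
    also have "\<dots> \<le> c * ((b + 1) * norm w)"
      using b(2)[of w] c(1) by (intro mult_left_mono) (auto simp: algebra_simps intro: order_trans[of _ "b * norm w"])
    finally show "norm x \<le> c * (b + 1) * norm w" by simp
  qed
qed

lemma norm_le_sigma_max: "norm (M *v w) \<le> sigma_max M * norm w"
  unfolding sigma_max_def by (rule onorm[OF matrix_vector_mul_bounded_linear])

lemma sigma_max_nonneg: "0 \<le> sigma_max M"
  unfolding sigma_max_def by (rule onorm_pos_le[OF matrix_vector_mul_bounded_linear])

text \<open>The supremum in \<open>hinf_norm\<close> is taken in \<open>real\<close>, where it is
  known to dominate its family only if that family is bounded.\<close>

lemma bdd_above_frequency_response:
  assumes "hurwitz A"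
  shows "bdd_above (range (\<lambda>\<omega>::real. sigma_max (transfer A B C D (\<i> * complex_of_real \<omega>))))"
proof -
  obtain c where c: "c > 0"
    "\<And>\<omega> x w. cmat A *v x + cmat B *v w = (\<i> * complex_of_real \<omega>) *s x \<Longrightarrow> norm x \<le> c * norm w"
    using frequency_state_bound[OF assms] by blast
  obtain b where b: "b \<ge> 0" "\<And>x. norm (cmat C *v x) \<le> b * norm x"
    by (rule norm_matrix_vector_bound[of "cmat C"]) blast
  obtain d where d: "d \<ge> 0" "\<And>w. norm (cmat D *v w) \<le> d * norm w"
    by (rule norm_matrix_vector_bound[of "cmat D"]) blast
  have "sigma_max (transfer A B C D (\<i> * complex_of_real \<omega>)) \<le> b * c + d" for \<omega>
    unfolding sigma_max_def
  proof (rule onorm_le)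
    fix w
    obtain x where x: "cmat A *v x + cmat B *v w = (\<i> * complex_of_real \<omega>) *s x"
      using transfer_apply(1)[OF assms] by blast
    have "norm (transfer A B C D (\<i> * complex_of_real \<omega>) *v w) = norm (cmat C *v x + cmat D *v w)"
      by (simp add: transfer_apply(2)[OF assms x])
    also have "\<dots> \<le> b * norm x + d * norm w"
      using b(2)[of x] d(2)[of w] norm_triangle_ineq[of "cmat C *v x" "cmat D *v w"] by linarith
    also have "b * norm x \<le> b * (c * norm w)" using c(2)[OF x] b(1) by (intro mult_left_mono)
    finally show "norm (transfer A B C D (\<i> * complex_of_real \<omega>) *v w) \<le> (b * c + d) * norm w"
      by (simp add: algebra_simps)
  qed
  then show ?thesis by (auto intro!: bdd_aboveI)
qed

text \<open>\<open>D\<close> is the limit of the transfer matrix at infinite frequency: the state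
  excited by a fixed \<open>w\<close> has size of order \<open>1 / \<omega>\<close>.\<close>

lemma feedthrough_bound:
  assumes "hurwitz A"
    and H: "\<And>\<omega> x w. cmat A *v x + cmat B *v w = (\<i> * complex_of_real \<omega>) *s x \<Longrightarrow>
      norm (cmat C *v x + cmat D *v w) \<le> h * norm w"
  shows "norm (cmat D *v w) \<le> h * norm w"
proof -
  obtain c where c: "c > 0"
    "\<And>\<omega> x w. cmat A *v x + cmat B *v w = (\<i> * complex_of_real \<omega>) *s x \<Longrightarrow> norm x \<le> c * norm w"
    using frequency_state_bound[OF assms(1)] by blast
  obtain a where a: "a \<ge> 0" "\<And>x. norm (cmat A *v x) \<le> a * norm x"
    by (rule norm_matrix_vector_bound[of "cmat A"]) blast
  obtain b where b: "b \<ge> 0" "\<And>x. norm (cmat B *v x) \<le> b * norm x"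
    by (rule norm_matrix_vector_bound[of "cmat B"]) blast
  obtain l where l: "l \<ge> 0" "\<And>x. norm (cmat C *v x) \<le> l * norm x"
    by (rule norm_matrix_vector_bound[of "cmat C"]) blast
  let ?k = "l * (a * c + b) * norm w"
  show ?thesis
  proof (rule field_le_epsilon)
    fix \<epsilon> :: real assume \<epsilon>: "\<epsilon> > 0"
    obtain n :: nat where n: "?k / \<epsilon> < real n" using reals_Archimedean2 by blast
    define \<omega> where "\<omega> = real n + 1"
    have \<omega>: "\<omega> > 0" by (simp add: \<omega>_def)
    have "?k / \<epsilon> \<le> \<omega>" using n by (simp add: \<omega>_def)
    then have k: "?k / \<omega> \<le> \<epsilon>" using \<epsilon> \<omega> by (simp add: field_simps)
    obtain x where x: "cmat A *v x + cmat B *v w = (\<i> * complex_of_real \<omega>) *s x"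
      using transfer_apply(1)[OF assms(1)] by blast
    have "\<omega> * norm x = norm ((\<i> * complex_of_real \<omega>) *s x)"
      using \<omega> by (simp add: norm_scale_complex_vec norm_mult)
    also have "\<dots> \<le> a * norm x + b * norm w"
      unfolding x[symmetric] using a(2)[of x] b(2)[of w] norm_triangle_ineq[of "cmat A *v x" "cmat B *v w"] by linarith
    also have "a * norm x \<le> a * (c * norm w)" using c(2)[OF x] a(1) by (intro mult_left_mono)
    finally have "norm x \<le> (a * c + b) * norm w / \<omega>" using \<omega> by (simp add: field_simps)
    then have "l * norm x \<le> ?k / \<omega>"
      using l(1) mult_left_mono by fastforce
    moreover have "norm (cmat D *v w) \<le> norm (cmat C *v x + cmat D *v w) + norm (cmat C *v x)"
      by (metis add_diff_cancel_left' norm_triangle_ineq4)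
    ultimately show "norm (cmat D *v w) \<le> h * norm w + \<epsilon>"
      using H[OF x] l(2)[of x] k by linarith
  qed
qed

subsection \<open>The Kalman--Yakubovich--Popov lemma\<close>

text \<open>For symmetric \<open>P\<close> the wanted inequality is
  \<open>P \<bullet> outer z + val z < 0\<close> on the unit sphere, which is affine in
  \<open>P\<close>. Separation solves it once the convex hull of the points
  \<open>(outer z, val z)\<close> misses the ray \<open>{0} \<times> {0..}\<close>. A common point
  would be a finite family with vanishing \<open>outer\<close> sum and nonnegative
  \<open>val\<close> sum, which \<open>frequency_inequality_family\<close> excludes.\<close>

lemma kyp_strict:
  fixes A :: "real^'n^'n" and B :: "real^'w^'n" and C :: "real^'n^'z" and D :: "real^'w^'z"
  assumes freq: "\<And>\<omega> x w. cmat A *v x + cmat B *v w = (\<i> * complex_of_real \<omega>) *s x \<Longrightarrow>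
        (norm (cmat C *v x + cmat D *v w))\<^sup>2 + d * (norm x)\<^sup>2 \<le> g * (norm w)\<^sup>2"
    and zero: "\<And>w. (norm (cmat D *v w))\<^sup>2 \<le> g * (norm w)\<^sup>2"
    and d: "d > 0" and g: "g < \<gamma>\<^sup>2"
  obtains P :: "real^'n^'n" where "\<And>x y. (P *v x) \<bullet> y = x \<bullet> (P *v y)"
    "\<And>x w. x \<noteq> 0 \<or> w \<noteq> 0 \<Longrightarrow> 2 * ((P *v x) \<bullet> (A *v x + B *v w)) + (norm (C *v x + D *v w))\<^sup>2 - \<gamma>\<^sup>2 * (norm w)\<^sup>2 < 0"
proof -
  define y where "y z = A *v fst z + B *v snd z" for z :: "(real^'n) \<times> (real^'w)"
  define outer :: "(real^'n) \<times> (real^'w) \<Rightarrow> real^'n^'n" where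
    "outer z = (\<chi> i j. fst z $ i * y z $ j + y z $ i * fst z $ j)" for z
  define val where "val z = (norm (C *v fst z + D *v snd z))\<^sup>2 - \<gamma>\<^sup>2 * (norm (snd z))\<^sup>2" for z
  define \<Phi> where "\<Phi> z = (outer z, val z)" for z
  let ?Q = "convex hull (\<Phi> ` sphere 0 1)"
  let ?R = "{0::real^'n^'n} \<times> {0::real..}"
  have dual: "?R \<inter> ?Q = {}"
  proof (rule ccontr)
    assume "?R \<inter> ?Q \<noteq> {}"
    then obtain t where t: "t \<ge> 0" "(0, t) \<in> ?Q" by auto
    then obtain S u where S: "finite S" "S \<subseteq> \<Phi> ` sphere 0 1" "\<forall>v\<in>S. 0 \<le> u v" "sum u S = 1"
        "(\<Sum>v\<in>S. u v *\<^sub>R v) = (0, t)"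
      by (auto simp: convex_hull_explicit)
    then have "\<forall>v\<in>S. \<exists>z. z \<in> sphere 0 1 \<and> \<Phi> z = v" by blast
    then obtain pre where pre: "\<And>v. v \<in> S \<Longrightarrow> pre v \<in> sphere 0 1" "\<And>v. v \<in> S \<Longrightarrow> \<Phi> (pre v) = v"
      by metis
    \<comment> \<open>Square roots of the convex weights are absorbed into the vectors, which turns
      weighted sums into plain sums over a family.\<close>
    define r where "r v = sqrt (u v)" for v
    have rr: "r v * r v = u v" if "v \<in> S" for v using S(3) that by (simp add: r_def)
    define x where "x v = r v *\<^sub>R fst (pre v)" for v
    define w where "w v = r v *\<^sub>R snd (pre v)" for v
    have yxw: "A *v x v + B *v w v = r v *\<^sub>R y (pre v)" for v
      by (simp add: y_def x_def w_def matrix_vector_mult_scaleR scaleR_add_right)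
    have sum_outer: "(\<Sum>v\<in>S. u v *\<^sub>R outer (pre v)) = 0" and sum_val: "(\<Sum>v\<in>S. u v * val (pre v)) = t"
    proof -
      have "(\<Sum>v\<in>S. u v *\<^sub>R v) = (\<Sum>v\<in>S. u v *\<^sub>R \<Phi> (pre v))" using pre by (intro sum.cong) auto
      then show "(\<Sum>v\<in>S. u v *\<^sub>R outer (pre v)) = 0" "(\<Sum>v\<in>S. u v * val (pre v)) = t"
        using S(5) by (auto simp: \<Phi>_def sum_prod prod_eq_iff fst_sum snd_sum)
    qed
    have "(\<Sum>v\<in>S. (norm (cmat C *v cvec (x v) + cmat D *v cvec (w v)))\<^sup>2 + d * (norm (cvec (x v)))\<^sup>2)
        \<le> g * (\<Sum>v\<in>S. (norm (cvec (w v)))\<^sup>2)"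
    proof (rule frequency_inequality_family[OF S(1)])
      show "(norm (cmat C *v x + cmat D *v w))\<^sup>2 + d * (norm x)\<^sup>2 \<le> g * (norm w)\<^sup>2"
        if "cmat A *v x + cmat B *v w = (\<i> * complex_of_real \<omega>) *s x" for \<omega> x w
        using that by (rule freq)
      show "(norm (cmat D *v w))\<^sup>2 \<le> g * (norm w)\<^sup>2" for w by (rule zero)
      fix i j
      have "(\<Sum>k\<in>S. cvec (x k) $ i * cnj ((cmat A *v cvec (x k) + cmat B *v cvec (w k)) $ j)
            + (cmat A *v cvec (x k) + cmat B *v cvec (w k)) $ i * cnj (cvec (x k) $ j))
          = (\<Sum>k\<in>S. complex_of_real (u k * outer (pre k) $ i $ j))"
      proof (rule sum.cong)
        fix k assume k: "k \<in> S"
        have "x k $ i * (r k * y (pre k) $ j) + (r k * y (pre k) $ i) * x k $ j = (r k * r k) * outer (pre k) $ i $ j"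
          by (simp add: x_def outer_def algebra_simps)
        then have "complex_of_real (x k $ i * (r k * y (pre k) $ j) + (r k * y (pre k) $ i) * x k $ j)
            = complex_of_real (u k * outer (pre k) $ i $ j)"
          by (simp only: rr[OF k])
        then show "cvec (x k) $ i * cnj ((cmat A *v cvec (x k) + cmat B *v cvec (w k)) $ j)
            + (cmat A *v cvec (x k) + cmat B *v cvec (w k)) $ i * cnj (cvec (x k) $ j)
          = complex_of_real (u k * outer (pre k) $ i $ j)"
          unfolding cmat_mult_cvec cvec_add[symmetric] yxw by (simp add: cvec_def)
      qed simp
      also have "\<dots> = complex_of_real ((\<Sum>v\<in>S. u v *\<^sub>R outer (pre v)) $ i $ j)"
        by (simp add: sum_component)
      finally show "(\<Sum>k\<in>S. cvec (x k) $ i * cnj ((cmat A *v cvec (x k) + cmat B *v cvec (w k)) $ j)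
            + (cmat A *v cvec (x k) + cmat B *v cvec (w k)) $ i * cnj (cvec (x k) $ j)) = 0"
        by (simp only: sum_outer) simp
    qed
    moreover have "(norm (cmat C *v cvec (x v) + cmat D *v cvec (w v)))\<^sup>2 = u v * (norm (C *v fst (pre v) + D *v snd (pre v)))\<^sup>2"
      "(norm (cvec (x v)))\<^sup>2 = u v * (norm (fst (pre v)))\<^sup>2" "(norm (cvec (w v)))\<^sup>2 = u v * (norm (snd (pre v)))\<^sup>2"
      if "v \<in> S" for v
      unfolding cmat_mult_cvec cvec_add[symmetric] norm_cvec x_def w_def matrix_vector_mult_scaleR
        scaleR_add_right[symmetric] norm_scaleR power_mult_distrib power2_abs
      using rr[OF that] by (simp_all add: power2_eq_square)
    ultimately have "(\<Sum>v\<in>S. u v * (norm (C *v fst (pre v) + D *v snd (pre v)))\<^sup>2 + d * (u v * (norm (fst (pre v)))\<^sup>2))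
        \<le> g * (\<Sum>v\<in>S. u v * (norm (snd (pre v)))\<^sup>2)"
      by (simp cong: sum.cong)
    then have "t \<le> (\<Sum>v\<in>S. u v * (- (d * (norm (fst (pre v)))\<^sup>2) - (\<gamma>\<^sup>2 - g) * (norm (snd (pre v)))\<^sup>2))"
      unfolding sum_val[symmetric] val_def
      by (simp add: algebra_simps sum.distrib sum_subtractf sum_negf sum_distrib_left)
    \<comment> \<open>\<open>d\<close> penalises the state and \<open>\<gamma>\<^sup>2 - g\<close>
      the input. Each \<open>pre v\<close> is a unit vector, so the smaller of the two bounds the
      sum away from 0.\<close>
    also have "\<dots> \<le> (\<Sum>v\<in>S. u v * (- min d (\<gamma>\<^sup>2 - g)))"
    proof (intro sum_mono mult_left_mono)
      fix v assume v: "v \<in> S"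
      let ?m = "min d (\<gamma>\<^sup>2 - g)"
      have "1 = (norm (fst (pre v)))\<^sup>2 + (norm (snd (pre v)))\<^sup>2"
        using pre(1)[OF v] by (cases "pre v") (auto simp: norm_Pair)
      then have "?m = ?m * (norm (fst (pre v)))\<^sup>2 + ?m * (norm (snd (pre v)))\<^sup>2"
        by (metis distrib_left mult.right_neutral)
      also have "\<dots> \<le> d * (norm (fst (pre v)))\<^sup>2 + (\<gamma>\<^sup>2 - g) * (norm (snd (pre v)))\<^sup>2"
        by (intro add_mono mult_right_mono) auto
      finally show "- (d * (norm (fst (pre v)))\<^sup>2) - (\<gamma>\<^sup>2 - g) * (norm (snd (pre v)))\<^sup>2 \<le> - ?m" by simp
      show "0 \<le> u v" using S(3) v by blast
    qed
    also have "\<dots> = - min d (\<gamma>\<^sup>2 - g)" by (simp only: S(4) sum_distrib_right[symmetric] mult_1)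
    also have "\<dots> < 0" using d g by simp
    finally show False using t(1) by simp
  qed
  have "continuous_on (sphere 0 1) \<Phi>"
    unfolding \<Phi>_def[abs_def] outer_def val_def y_def matrix_vector_mult_def
    by (intro continuous_intros)
  then have "compact (\<Phi> ` sphere 0 1)" by (intro compact_continuous_image) auto
  then have "compact ?Q" by (rule compact_convex_hull)
  moreover have w0: "(0, axis undefined 1) \<in> sphere (0 :: (real^'n) \<times> (real^'w)) 1" by (simp add: norm_Pair)
  then have "?Q \<noteq> {}" by auto
  moreover have "convex ?R" "closed ?R" by (auto intro!: convex_Times closed_Times)
  ultimately obtain a b where ab: "\<forall>x\<in>?R. inner a x < b" "\<forall>x\<in>?Q. inner a x > b"
    using separating_hyperplane_closed_compact[of ?R ?Q] dual by auto
  obtain P0 c where a: "a = (P0, c)" by (cases a)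
  have b0: "b > 0" using ab(1)[rule_format, of "(0, 0)"] by (simp add: a)
  have "c \<le> 0"
  proof (rule ccontr)
    assume "\<not> c \<le> 0"
    then show False using ab(1)[rule_format, of "(0, b / c)"] b0 by (simp add: a)
  qed
  have pos: "P0 \<bullet> outer z + c * val z > 0" if "z \<in> sphere 0 1" for z
  proof -
    have "\<Phi> z \<in> ?Q" using that hull_subset[of "\<Phi> ` sphere 0 1" convex] by blast
    then have "inner a (\<Phi> z) > b" using ab(2) by blast
    then show ?thesis using b0 by (simp add: a \<Phi>_def)
  qed
  \<comment> \<open>At \<open>x = 0\<close> the \<open>outer\<close> part vanishes, so
    \<open>c = 0\<close> would contradict the strict positivity in \<open>pos\<close>.\<close>
  have "c \<noteq> 0"
  proof
    assume "c = 0"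
    then show False using pos[OF w0] by (simp add: outer_def inner_vec_def)
  qed
  then have c: "c < 0" using \<open>c \<le> 0\<close> by simp
  have inner_outer: "P0 \<bullet> outer z = (P0 *v fst z) \<bullet> y z + fst z \<bullet> (P0 *v y z)" for z
  proof -
    have "P0 \<bullet> outer z = (\<Sum>i\<in>UNIV. \<Sum>j\<in>UNIV. fst z $ i * (P0 $ i $ j * y z $ j)) + (\<Sum>i\<in>UNIV. \<Sum>j\<in>UNIV. P0 $ i $ j * fst z $ j * y z $ i)"
      by (simp add: inner_vec_def outer_def algebra_simps sum.distrib)
    then show ?thesis
      by (simp add: inner_vec_def matrix_vector_mult_def sum_distrib_left sum_distrib_right)
  qed
  \<comment> \<open>Division by the negative \<open>c\<close> normalises the coefficient of
    \<open>val\<close> to 1 and reverses the inequality; averaging with the transpose makes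
    \<open>P\<close> symmetric.\<close>
  define P where "P = (1 / (2 * c)) *\<^sub>R (P0 + transpose P0)"
  have P: "P *v x = (1 / (2 * c)) *\<^sub>R (P0 *v x + transpose P0 *v x)" for x
    by (simp add: P_def scaleR_matrix_vector_assoc[symmetric] matrix_vector_mult_add_rdistrib)
  have tr: "(transpose P0 *v x) \<bullet> y = x \<bullet> (P0 *v y)" for x y
    using dot_lmul_matrix[of x P0 y] by (simp only: transpose_matrix_vector)
  have tr': "x \<bullet> (transpose P0 *v y) = (P0 *v x) \<bullet> y" for x y
    using tr[of y x] by (simp add: inner_commute)
  show ?thesis
  proof (rule that[of P])
    show "(P *v x) \<bullet> y = x \<bullet> (P *v y)" for x y
      by (simp add: P inner_add_left inner_add_right tr tr' del: transpose_matrix_vector)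
    fix x :: "real^'n" and w :: "real^'w" assume xw: "x \<noteq> 0 \<or> w \<noteq> 0"
    define n where "n = norm (x, w)"
    have n: "n > 0" using xw by (simp add: n_def zero_prod_def)
    define z where "z = (1 / n) *\<^sub>R (x, w)"
    have z: "z \<in> sphere 0 1" using n by (simp add: z_def n_def del: scaleR_Pair)
    have xz: "x = n *\<^sub>R fst z" "w = n *\<^sub>R snd z" using n by (simp_all add: z_def)
    have "2 * ((P *v fst z) \<bullet> y z) = (P0 \<bullet> outer z) / c"
      using c by (simp add: inner_outer P tr inner_add_left add_divide_distrib del: transpose_matrix_vector)
    then have "2 * ((P *v fst z) \<bullet> y z) + val z = (P0 \<bullet> outer z + c * val z) / c"
      using c by (simp add: field_simps)
    also have "\<dots> < 0" using pos[OF z] c by (simp add: divide_pos_neg)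
    finally have neg: "2 * ((P *v fst z) \<bullet> y z) + val z < 0" .
    have "2 * ((P *v x) \<bullet> (A *v x + B *v w)) + (norm (C *v x + D *v w))\<^sup>2 - \<gamma>\<^sup>2 * (norm w)\<^sup>2
        = n\<^sup>2 * (2 * ((P *v fst z) \<bullet> y z) + val z)"
      unfolding xz y_def val_def matrix_vector_mult_scaleR scaleR_add_right[symmetric]
        norm_scaleR power_mult_distrib power2_abs inner_scaleR_left inner_scaleR_right
      by (simp add: algebra_simps power2_eq_square)
    also have "\<dots> < 0" using n neg by (simp add: mult_pos_neg)
    finally show "2 * ((P *v x) \<bullet> (A *v x + B *v w)) + (norm (C *v x + D *v w))\<^sup>2 - \<gamma>\<^sup>2 * (norm w)\<^sup>2 < 0" .
  qed
qed

subsection \<open>Lyapunov functions for Hurwitz matrices\<close>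

primrec shifted_prod :: "complex^'n^'n \<Rightarrow> complex list \<Rightarrow> complex^'n \<Rightarrow> complex^'n" where
  "shifted_prod A [] f = f"
| "shifted_prod A (s # ss) f = A *v shifted_prod A ss f - s *s shifted_prod A ss f"

lemma shifted_prod_add: "shifted_prod A ss (f + g) = shifted_prod A ss f + shifted_prod A ss g"
  by (induction ss) (simp_all add: matrix_vector_right_distrib vector_add_ldistrib)

lemma shifted_prod_scale: "shifted_prod A ss (c *s f) = c *s shifted_prod A ss f"
  by (induction ss) (simp_all add: vector_scalar_commute vector_ssub_ldistrib vector_smult_assoc mult.commute)

lemma shifted_prod_diff: "shifted_prod A ss (f - g) = shifted_prod A ss f - shifted_prod A ss g"
  using shifted_prod_add[of A ss "f - g" g] by simp

lemma shifted_prod_mult: "shifted_prod A ss (A *v f) = A *v shifted_prod A ss f"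
  by (induction ss) (simp_all add: vector_scalar_commute matrix_vector_mult_diff_distrib)

lemma scaleR_eq_scalar_mult: "r *\<^sub>R (f :: complex^'n) = complex_of_real r *s f"
  by (simp add: vec_eq_iff) (simp add: scaleR_conv_of_real)

lemma linear_shifted_prod: "linear (shifted_prod A ss)"
  by (rule linearI) (simp_all add: shifted_prod_add scaleR_eq_scalar_mult shifted_prod_scale)

definition poly_apply :: "complex poly \<Rightarrow> complex^'n^'n \<Rightarrow> complex^'n \<Rightarrow> complex^'n" where
  "poly_apply p A f = (\<Sum>i\<le>degree p. coeff p i *s (((*v) A ^^ i) f))"

lemma poly_apply_altdef:
  assumes "degree p \<le> n"
  shows "poly_apply p A f = (\<Sum>i\<le>n. coeff p i *s (((*v) A ^^ i) f))"
  unfolding poly_apply_def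
  by (rule sum.mono_neutral_left) (use assms in \<open>auto simp: coeff_eq_0\<close>)

lemma poly_apply_linear_factor:
  "poly_apply ([:- s, 1:] * q) A f = A *v poly_apply q A f - s *s poly_apply q A f"
proof -
  let ?n = "Suc (degree q)"
  let ?g = "\<lambda>i. (((*v) A ^^ i) f)"
  have "degree ([:- s, 1:] * q) \<le> ?n"
    by (rule order_trans[OF degree_mult_le]) simp
  then have "poly_apply ([:- s, 1:] * q) A f = (\<Sum>i\<le>?n. coeff ([:- s, 1:] * q) i *s ?g i)"
    by (rule poly_apply_altdef)
  also have "\<dots> = (\<Sum>i\<le>?n. coeff (pCons 0 q) i *s ?g i - s *s (coeff q i *s ?g i))"
    by (rule sum.cong) (simp_all add: vec_eq_iff algebra_simps)
  also have "\<dots> = (\<Sum>i\<le>?n. coeff (pCons 0 q) i *s ?g i) - s *s (\<Sum>i\<le>?n. coeff q i *s ?g i)"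
    by (simp add: sum_subtractf vec.scale_sum_right)
  also have "(\<Sum>i\<le>?n. coeff q i *s ?g i) = poly_apply q A f"
    by (rule poly_apply_altdef[symmetric]) simp
  also have "(\<Sum>i\<le>?n. coeff (pCons 0 q) i *s ?g i) = (\<Sum>i\<le>degree q. coeff q i *s ?g (Suc i))"
    by (subst sum.atMost_Suc_shift) simp
  also have "\<dots> = A *v poly_apply q A f"
    by (simp add: poly_apply_def vec.linear_sum[OF matrix_vector_mul_linear_gen] vector_scalar_commute)
  finally show ?thesis .
qed

text \<open>The fundamental theorem of algebra splits off one root at a time; \<open>c\<close> is
  the leading coefficient.\<close>

lemma poly_apply_shifted_prod:
  assumes "p \<noteq> 0"
  shows "\<exists>c ss. c \<noteq> 0 \<and> (\<forall>f. poly_apply p A f = c *s shifted_prod A ss f)"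
  using assms
proof (induction "degree p" arbitrary: p)
  case 0
  then obtain c where "p = [:c:]" "c \<noteq> 0" by (metis degree_eq_zeroE pCons_eq_0_iff)
  then show ?case by (intro exI[of _ c] exI[of _ "[]"]) (simp add: poly_apply_def)
next
  case (Suc n)
  then have "\<not> constant (poly p)" by (simp add: constant_degree)
  then obtain s where "poly p s = 0" using fundamental_theorem_of_algebra by blast
  then obtain q where q: "p = [:- s, 1:] * q" by (meson poly_eq_0_iff_dvd dvdE)
  then have "q \<noteq> 0" using Suc.prems by auto
  have "degree p = Suc (degree q)"
    unfolding q by (subst degree_mult_eq) (use \<open>q \<noteq> 0\<close> in auto)
  then obtain c ss where c: "c \<noteq> 0" "\<And>f. poly_apply q A f = c *s shifted_prod A ss f"
    using Suc.hyps(1)[of q] Suc.hyps(2) \<open>q \<noteq> 0\<close> by auto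
  show ?case
  proof (intro exI conjI allI)
    show "c \<noteq> 0" by (rule c)
    show "poly_apply p A f = c *s shifted_prod A (s # ss) f" for f
      unfolding q poly_apply_linear_factor c(2)
      by (simp add: vector_scalar_commute vector_ssub_ldistrib vector_smult_assoc mult.commute)
  qed
qed

lemma exists_linear_relation:
  fixes M :: "nat \<Rightarrow> 'a::euclidean_space"
  shows "\<exists>c :: nat \<Rightarrow> real. (\<exists>i\<le>DIM('a). c i \<noteq> 0) \<and> (\<Sum>i\<le>DIM('a). c i *\<^sub>R M i) = 0"
proof (cases "inj_on M {..DIM('a)}")
  case True
  let ?S = "M ` {..DIM('a)}"
  have "card ?S > DIM('a)" using True by (simp add: card_image)
  then have "dependent ?S" by (intro dependent_biggerset) auto
  then obtain u where u: "\<exists>v\<in>?S. u v \<noteq> 0" "(\<Sum>v\<in>?S. u v *\<^sub>R v) = 0"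
    by (auto simp: dependent_finite)
  then show ?thesis
    using True by (intro exI[of _ "u \<circ> M"]) (auto simp: sum.reindex)
next
  case False
  \<comment> \<open>A repetition \<open>M i = M j\<close> is itself a linear relation.\<close>
  then obtain i j where ij: "i \<le> DIM('a)" "j \<le> DIM('a)" "i \<noteq> j" "M i = M j" by (auto simp: inj_on_def)
  have "(\<Sum>k\<le>DIM('a). (of_bool (k = i) - of_bool (k = j)) *\<^sub>R M k) = M i - M j"
    using ij by (simp add: scaleR_diff_left sum_subtractf of_bool_def if_distrib[of "\<lambda>x. x *\<^sub>R _"] cong: if_cong)
  then show ?thesis
    using ij by (intro exI[of _ "\<lambda>k. of_bool (k = i) - of_bool (k = j)"]) auto
qed

text \<open>There are more powers of \<open>A\<close> than the dimension of the matrix space, so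
  some polynomial kills \<open>A\<close>, and it is then factored. Its coefficients may be taken
  real because the dimension is counted over the reals.\<close>

lemma exists_annihilating_shifted_prod:
  fixes A :: "complex^'n^'n"
  shows "\<exists>ss. \<forall>f. shifted_prod A ss f = 0"
proof -
  define M where "M i = (((**) A) ^^ i) (mat 1)" for i
  have M: "M i *v f = ((*v) A ^^ i) f" for i f
    by (induction i) (simp_all add: M_def flip: matrix_vector_mul_assoc)
  let ?N = "DIM(complex^'n^'n)"
  obtain c :: "nat \<Rightarrow> real" where c: "\<exists>i\<le>?N. c i \<noteq> 0" "(\<Sum>i\<le>?N. c i *\<^sub>R M i) = 0"
    using exists_linear_relation[of M] by blast
  define p where "p = (\<Sum>i\<le>?N. monom (complex_of_real (c i)) i)"
  have coeff_p: "coeff p i = (if i \<le> ?N then complex_of_real (c i) else 0)" for i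
    by (simp add: p_def coeff_sum)
  then have "p \<noteq> 0" using c(1) by (metis coeff_0 of_real_eq_0_iff)
  have deg: "degree p \<le> ?N" by (rule degree_le) (simp add: coeff_p)
  have "poly_apply p A f = 0" for f
  proof -
    have "poly_apply p A f = (\<Sum>i\<le>?N. c i *\<^sub>R (M i *v f))"
      unfolding poly_apply_altdef[OF deg] by (rule sum.cong) (simp_all add: coeff_p M scaleR_eq_scalar_mult)
    also have "\<dots> = (\<Sum>i\<le>?N. c i *\<^sub>R M i) *v f"
      by (simp add: vec_eq_iff matrix_vector_mult_def sum_component scaleR_sum_right sum_distrib_right)
        (subst sum.swap, simp)
    finally show ?thesis using c(2) by simp
  qed
  then show ?thesis
    using poly_apply_shifted_prod[OF \<open>p \<noteq> 0\<close>, of A] by (metis vec.scale_eq_0_iff)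
qed

lemma exists_annihilating_eigenvalues:
  fixes A :: "complex^'n^'n"
  shows "\<exists>ss. (\<forall>s\<in>set ss. \<exists>x. x \<noteq> 0 \<and> A *v x = s *s x) \<and> (\<forall>f. shifted_prod A ss f = 0)"
proof -
  have "\<exists>ss'. (\<forall>s\<in>set ss'. \<exists>x. x \<noteq> 0 \<and> A *v x = s *s x)
      \<and> (\<forall>f. shifted_prod A ss f = 0 \<longrightarrow> shifted_prod A ss' f = 0)" for ss
  proof (induction ss)
    case Nil
    then show ?case by (intro exI[of _ "[]"]) simp
  next
    case (Cons s ss)
    then obtain ss' where ss': "\<forall>s\<in>set ss'. \<exists>x. x \<noteq> 0 \<and> A *v x = s *s x"
        "\<And>f. shifted_prod A ss f = 0 \<Longrightarrow> shifted_prod A ss' f = 0" by blast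
    show ?case
    proof (cases "\<exists>x. x \<noteq> 0 \<and> A *v x = s *s x")
      case True
      have "shifted_prod A (s # ss') f = 0" if "shifted_prod A (s # ss) f = 0" for f
      proof -
        \<comment> \<open>The factors commute, so the eigenvalue factor is made to act first and the
          induction hypothesis is applied to its result.\<close>
        have "shifted_prod A ss (A *v f - s *s f) = 0"
          using that by (simp add: shifted_prod_diff shifted_prod_mult shifted_prod_scale)
        from ss'(2)[OF this] show ?thesis
          by (simp add: shifted_prod_diff shifted_prod_mult shifted_prod_scale)
      qed
      then show ?thesis using ss'(1) True by (intro exI[of _ "s # ss'"]) auto
    next
      case False
      then have "shifted_prod A ss f = 0" if "shifted_prod A (s # ss) f = 0" for f
        using that by (metis eq_iff_diff_eq_0 shifted_prod.simps(2))
      then show ?thesis using ss' by blast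
    qed
  qed
  then show ?thesis using exists_annihilating_shifted_prod[of A] by metis
qed

section \<open>Lyapunov operators of complex matrices with eigenvalues in the left half
  plane\<close>

lemma inner_scalar_mult_self: "(s *s f) \<bullet> (f :: complex^'n) = Re s * (norm f)\<^sup>2"
  unfolding inner_complex_vec norm_complex_vec
  by (simp add: mult.assoc algebra_simps flip: sum_distrib_left)

lemma inner_scalar_mult_self': "(f :: complex^'n) \<bullet> (s *s f) = Re s * (norm f)\<^sup>2"
  using inner_scalar_mult_self[of s f] by (simp add: inner_commute)

text \<open>With \<open>F\<close> the product so far, the form \<open>|F f|^2\<close> decays along
  \<open>A\<close> at a rate given by \<open>- Re s\<close>, up to an error in the next product
  \<open>(A - s) F f\<close>. Adding a multiple of this form to \<open>G\<close> pushes the error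
  term one factor further; it disappears once the product annihilates every vector.\<close>

lemma lyapunov_operator_partial:
  fixes A :: "complex^'n^'n"
  assumes "\<forall>s\<in>set ss. Re s < 0"
  shows "\<exists>G \<kappa>. linear G \<and> (\<forall>f g. G f \<bullet> g = f \<bullet> G g) \<and> (\<forall>f. G f \<bullet> f \<ge> 0) \<and> \<kappa> \<ge> 0 \<and>
    (\<forall>f. G f \<bullet> (A *v f) \<le> - (norm f)\<^sup>2 + \<kappa> * (norm (shifted_prod A ss f))\<^sup>2)"
  using assms
proof (induction ss)
  case Nil
  show ?case
    by (rule exI[of _ "\<lambda>_. 0"], rule exI[of _ 1]) (auto intro: linear_zero)
next
  case (Cons s ss)
  then obtain G \<kappa> where G: "linear G" "\<And>f g. G f \<bullet> g = f \<bullet> G g" "\<And>f. G f \<bullet> f \<ge> 0" "\<kappa> \<ge> 0"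
    "\<And>f. G f \<bullet> (A *v f) \<le> - (norm f)\<^sup>2 + \<kappa> * (norm (shifted_prod A ss f))\<^sup>2" by auto
  define r where "r = - Re s"
  have r: "r > 0" using Cons.prems by (simp add: r_def)
  \<comment> \<open>With this weight the decay \<open>c * r / 2\<close> of \<open>|F f|^2\<close>
    absorbs exactly the old error \<open>\<kappa>\<close>; the new error constant is
    \<open>c / (2 * r) = \<kappa> / r^2\<close>.\<close>
  define c where "c = 2 * \<kappa> / r"
  have c: "c \<ge> 0" using r G(4) by (simp add: c_def)
  let ?F = "shifted_prod A ss"
  let ?F' = "shifted_prod A (s # ss)"
  have adj: "adjoint ?F x \<bullet> g = x \<bullet> ?F g" for x g
    using adjoint_works[OF linear_shifted_prod, of g A ss x] by (simp add: inner_commute)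
  let ?G = "\<lambda>f. G f + c *\<^sub>R adjoint ?F (?F f)"
  have "linear ?G"
    using linear_compose[OF linear_shifted_prod[of A ss] adjoint_linear[OF linear_shifted_prod[of A ss]]] G(1)
    by (auto simp: o_def intro!: linear_compose_add linear_compose_scale_right)
  moreover have "?G f \<bullet> g = f \<bullet> ?G g" for f g
  proof -
    have "f \<bullet> adjoint ?F (?F g) = ?F f \<bullet> ?F g" using adj[of "?F g" f] by (simp add: inner_commute)
    then show ?thesis by (simp add: inner_add_left inner_add_right G(2) adj)
  qed
  moreover have "?G f \<bullet> f \<ge> 0" for f
    using G(3)[of f] c by (simp add: inner_add_left adj)
  moreover have "?G f \<bullet> (A *v f) \<le> - (norm f)\<^sup>2 + (\<kappa> / r\<^sup>2) * (norm (?F' f))\<^sup>2" for f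
  proof -
    let ?a = "norm (?F f)" and ?b = "norm (?F' f)"
    have "?F (A *v f) = ?F' f + s *s ?F f" by (simp add: shifted_prod_mult)
    then have "?F f \<bullet> ?F (A *v f) = ?F f \<bullet> ?F' f - r * ?a\<^sup>2"
      by (simp add: inner_diff_right inner_scalar_mult_self' r_def)
    moreover have "?F f \<bullet> ?F' f \<le> ?a * ?b" by (rule norm_cauchy_schwarz)
    moreover have "?a * ?b \<le> r / 2 * ?a\<^sup>2 + ?b\<^sup>2 / (2 * r)"
    proof -
      have "0 \<le> (r * ?a - ?b)\<^sup>2 / (2 * r)" using r by simp
      also have "\<dots> = r / 2 * ?a\<^sup>2 + ?b\<^sup>2 / (2 * r) - ?a * ?b"
        using r by (simp add: power2_eq_square field_simps)
      finally show ?thesis by simp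
    qed
    ultimately have "?F f \<bullet> ?F (A *v f) \<le> - (r / 2) * ?a\<^sup>2 + ?b\<^sup>2 / (2 * r)" by simp
    then have "c * (?F f \<bullet> ?F (A *v f)) \<le> c * (- (r / 2) * ?a\<^sup>2 + ?b\<^sup>2 / (2 * r))"
      using c by (rule mult_left_mono)
    also have "\<dots> = - \<kappa> * ?a\<^sup>2 + (\<kappa> / r\<^sup>2) * ?b\<^sup>2"
      using r by (simp add: c_def power2_eq_square field_simps)
    finally show ?thesis using G(5)[of f] by (simp add: inner_add_left adj)
  qed
  moreover have "\<kappa> / r\<^sup>2 \<ge> 0" using G(4) by simp
  ultimately show ?case by blast
qed

lemma lyapunov_operator:
  fixes A :: "complex^'n^'n"
  assumes "\<And>s x. x \<noteq> 0 \<Longrightarrow> A *v x = s *s x \<Longrightarrow> Re s < 0"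
  obtains G where "linear G" "\<And>f g. G f \<bullet> g = f \<bullet> G g" "\<And>f. f \<noteq> 0 \<Longrightarrow> G f \<bullet> f > 0"
    "\<And>f. f \<noteq> 0 \<Longrightarrow> G f \<bullet> (A *v f) < 0"
proof -
  obtain ss where ss: "\<forall>s\<in>set ss. \<exists>x. x \<noteq> 0 \<and> A *v x = s *s x" "\<And>f. shifted_prod A ss f = 0"
    using exists_annihilating_eigenvalues[of A] by blast
  have "\<forall>s\<in>set ss. Re s < 0" using ss(1) assms by blast
  from lyapunov_operator_partial[OF this, of A] ss(2)
  obtain G where G: "linear G" "\<And>f g. G f \<bullet> g = f \<bullet> G g" "\<And>f. G f \<bullet> f \<ge> 0"
    "\<And>f. G f \<bullet> (A *v f) \<le> - (norm f)\<^sup>2" by auto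
  have neg: "G f \<bullet> (A *v f) < 0" if "f \<noteq> 0" for f
    using G(4)[of f] that by (smt (verit) zero_less_norm_iff zero_less_power)
  have "G f \<bullet> f > 0" if f: "f \<noteq> 0" for f
  proof (rule ccontr)
    assume "\<not> ?thesis"
    then have 0: "G f \<bullet> f = 0" using G(3)[of f] by simp
    \<comment> \<open>A semidefinite form that vanishes at \<open>f\<close> has \<open>G f\<close>
      orthogonal to every \<open>d\<close>, which contradicts \<open>neg\<close> at
      \<open>d = A *v f\<close>.\<close>
    have "0 \<le> 2 * t * (G f \<bullet> d) + t\<^sup>2 * (G d \<bullet> d)" for t d
      using G(3)[of "f + t *\<^sub>R d"] 0 G(2)[of d f]
      by (simp add: linear_add[OF G(1)] linear_scale[OF G(1)] inner_add_left inner_add_right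
          power2_eq_square algebra_simps inner_commute)
    then have "G f \<bullet> (A *v f) = 0" by (rule quadratic_nonneg_imp_linear_zero)
    then show False using neg[OF f] by simp
  qed
  then show ?thesis using that G(1,2) neg by blast
qed

text \<open>Let \<open>l\<close> be the maximal quotient of \<open>- P\<close> by the Lyapunov form
  \<open>G\<close>, attained at \<open>f\<close> with \<open>- P f = l G f\<close>. Pairing this
  with \<open>A f\<close> gives a positive left side, while \<open>G f \<bullet> A f < 0\<close>.
  Hence \<open>l < 0\<close>, and \<open>- P\<close> is negative definite.\<close>

lemma lyapunov_positive:
  fixes A P :: "real^'n^'n"
  assumes A: "hurwitz A" and sym: "\<And>x y. (P *v x) \<bullet> y = x \<bullet> (P *v y)"
    and neg: "\<And>x. x \<noteq> 0 \<Longrightarrow> (P *v x) \<bullet> (A *v x) < 0" and x: "x \<noteq> 0"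
  shows "(P *v x) \<bullet> x > 0"
proof -
  have "Re s < 0" if "x \<noteq> 0" "cmat A *v x = s *s x" for s x
    using A that unfolding hurwitz_iff_eigenvalues by blast
  then obtain G where G: "linear G" "\<And>f g. G f \<bullet> g = f \<bullet> G g" "\<And>f. f \<noteq> 0 \<Longrightarrow> G f \<bullet> f > 0"
    "\<And>f. f \<noteq> 0 \<Longrightarrow> G f \<bullet> (cmat A *v f) < 0" using lyapunov_operator by blast
  let ?T = "\<lambda>f. - (cmat P *v f)"
  have "linear ?T" by (intro linear_compose_neg matrix_vector_mul_linear)
  moreover have "?T f \<bullet> g = f \<bullet> ?T g" for f g
  proof -
    have "(cmat P *v f) \<bullet> g = f \<bullet> (cmat P *v g)"
      by (simp add: inner_re_im re_vec_cmat im_vec_cmat sym)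
    then show ?thesis by simp
  qed
  moreover have "(UNIV :: (complex^'n) set) \<noteq> {0}"
    by (metis UNIV_I axis_eq_0_iff singletonD zero_neq_one)
  ultimately obtain f l where f: "f \<noteq> 0" "?T f = l *\<^sub>R G f" "\<And>g. ?T g \<bullet> g \<le> l * (G g \<bullet> g)"
    using generalized_rayleigh[of UNIV ?T G] G by (metis subspace_UNIV subset_UNIV UNIV_I)
  have "?T f \<bullet> (cmat A *v f) > 0"
  proof -
    have le: "(P *v x) \<bullet> (A *v x) \<le> 0" for x using neg[of x] by (cases "x = 0") auto
    have "re_vec f \<noteq> 0 \<or> im_vec f \<noteq> 0" using f(1) re_im_vec_eq_0_iff by blast
    then have "(P *v re_vec f) \<bullet> (A *v re_vec f) + (P *v im_vec f) \<bullet> (A *v im_vec f) < 0"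
      using neg le by (smt (verit))
    then have "(cmat P *v f) \<bullet> (cmat A *v f) < 0" by (simp add: inner_re_im re_vec_cmat im_vec_cmat)
    then show ?thesis by simp
  qed
  then have "l * (G f \<bullet> (cmat A *v f)) > 0" using f(2) by simp
  then have l: "l < 0" using G(4)[OF f(1)] by (simp add: zero_less_mult_iff)
  have rc: "re_vec (cvec x) = x" "im_vec (cvec x) = 0"
    by (simp_all add: re_vec_def im_vec_def cvec_def vec_eq_iff)
  then have "cvec x \<noteq> 0" using x re_im_vec_eq_0_iff[of "cvec x"] by auto
  then have "l * (G (cvec x) \<bullet> cvec x) < 0" using l G(3) by (simp add: mult_neg_pos)
  moreover have "(cmat P *v cvec x) \<bullet> cvec x = (P *v x) \<bullet> x"
    by (simp add: inner_re_im re_vec_cmat im_vec_cmat rc)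
  ultimately show ?thesis using f(3)[of "cvec x"] by simp
qed

subsection \<open>The bounded real lemma\<close>

text \<open>The strict dissipation inequality for the storage function
  \<open>x \<bullet> P x\<close> and the supply rate \<open>\<gamma>^2 |w|^2 - |z|^2\<close>.
  Stating it as a quadratic form avoids block matrices and Schur complements.\<close>

definition brl_certificate ::
  "real^'n^'n \<Rightarrow> real^'w^'n \<Rightarrow> real^'n^'z \<Rightarrow> real^'w^'z \<Rightarrow> real \<Rightarrow> real^'n^'n \<Rightarrow> bool" where
  "brl_certificate A B C D \<gamma> P \<longleftrightarrow>
    (\<forall>x y. (P *v x) \<bullet> y = x \<bullet> (P *v y)) \<and> (\<forall>x. x \<noteq> 0 \<longrightarrow> (P *v x) \<bullet> x > 0) \<and>
    (\<forall>x w. x \<noteq> 0 \<or> w \<noteq> 0 \<longrightarrow>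
      2 * ((P *v x) \<bullet> (A *v x + B *v w)) + (norm (C *v x + D *v w))\<^sup>2 - \<gamma>\<^sup>2 * (norm w)\<^sup>2 < 0)"

lemma bounded_real_necessary:
  assumes A: "hurwitz A"
    and lt: "(SUP \<omega>::real. sigma_max (transfer A B C D (\<i> * complex_of_real \<omega>))) < \<gamma>"
  shows "\<exists>P. brl_certificate A B C D \<gamma> P"
proof -
  define h where "h = (SUP \<omega>::real. sigma_max (transfer A B C D (\<i> * complex_of_real \<omega>)))"
  have sig: "sigma_max (transfer A B C D (\<i> * complex_of_real \<omega>)) \<le> h" for \<omega> :: real
    unfolding h_def by (rule cSUP_upper[OF UNIV_I bdd_above_frequency_response[OF A]])
  then have h0: "h \<ge> 0" using sigma_max_nonneg order_trans by blast
  have h\<gamma>: "h\<^sup>2 < \<gamma>\<^sup>2" using lt h0 by (simp add: h_def power_strict_mono)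
  have freq: "norm (cmat C *v x + cmat D *v w) \<le> h * norm w"
    if x: "cmat A *v x + cmat B *v w = (\<i> * complex_of_real \<omega>) *s x" for \<omega> x w
  proof -
    have "norm (cmat C *v x + cmat D *v w) = norm (transfer A B C D (\<i> * complex_of_real \<omega>) *v w)"
      by (simp add: transfer_apply(2)[OF A x])
    also have "\<dots> \<le> sigma_max (transfer A B C D (\<i> * complex_of_real \<omega>)) * norm w"
      by (rule norm_le_sigma_max)
    also have "\<dots> \<le> h * norm w" by (intro mult_right_mono sig) simp
    finally show ?thesis .
  qed
  obtain c where c: "c > 0"
    "\<And>\<omega> x w. cmat A *v x + cmat B *v w = (\<i> * complex_of_real \<omega>) *s x \<Longrightarrow> norm x \<le> c * norm w"
    using frequency_state_bound[OF A] by blast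
  \<comment> \<open>\<open>g\<close> is the midpoint of \<open>h^2\<close> and
    \<open>\<gamma>^2\<close>; \<open>d\<close> spends the part of the gap below it on the state,
    through \<open>|x| \<le> c |w|\<close>.\<close>
  define g where "g = (\<gamma>\<^sup>2 + h\<^sup>2) / 2"
  define d where "d = (\<gamma>\<^sup>2 - h\<^sup>2) / (2 * c\<^sup>2)"
  have d: "d > 0" using c(1) h\<gamma> by (simp add: d_def)
  have dg: "h\<^sup>2 + d * c\<^sup>2 = g" using c(1) by (simp add: d_def g_def field_simps)
  have "(norm (cmat C *v x + cmat D *v w))\<^sup>2 + d * (norm x)\<^sup>2 \<le> g * (norm w)\<^sup>2"
    if x: "cmat A *v x + cmat B *v w = (\<i> * complex_of_real \<omega>) *s x" for \<omega> x w
  proof -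
    have "(norm (cmat C *v x + cmat D *v w))\<^sup>2 \<le> (h * norm w)\<^sup>2"
      by (intro power_mono freq[OF x]) simp
    moreover have "d * (norm x)\<^sup>2 \<le> d * (c * norm w)\<^sup>2"
      using d c(2)[OF x] by (intro mult_left_mono power_mono) auto
    ultimately show ?thesis unfolding dg[symmetric] by (simp add: power_mult_distrib algebra_simps)
  qed
  moreover have "(norm (cmat D *v w))\<^sup>2 \<le> g * (norm w)\<^sup>2" for w
  proof -
    have "norm (cmat D *v w) \<le> h * norm w" by (rule feedthrough_bound[OF A freq])
    then have "(norm (cmat D *v w))\<^sup>2 \<le> (h * norm w)\<^sup>2" by (intro power_mono) auto
    also have "\<dots> \<le> g * (norm w)\<^sup>2"
      unfolding power_mult_distrib by (intro mult_right_mono) (use h\<gamma> in \<open>auto simp: g_def\<close>)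
    finally show ?thesis .
  qed
  moreover have "g < \<gamma>\<^sup>2" using h\<gamma> by (simp add: g_def)
  ultimately obtain P where P: "\<And>x y. (P *v x) \<bullet> y = x \<bullet> (P *v y)"
    "\<And>x w. x \<noteq> 0 \<or> w \<noteq> 0 \<Longrightarrow> 2 * ((P *v x) \<bullet> (A *v x + B *v w)) + (norm (C *v x + D *v w))\<^sup>2 - \<gamma>\<^sup>2 * (norm w)\<^sup>2 < 0"
    using kyp_strict[of A B C D d g \<gamma>] d by metis
  have "(P *v x) \<bullet> (A *v x) < 0" if "x \<noteq> 0" for x
  proof -
    have "2 * ((P *v x) \<bullet> (A *v x)) + (norm (C *v x))\<^sup>2 < 0" using P(2)[of x 0] that by simp
    then show ?thesis using zero_le_power2[of "norm (C *v x)"] by linarith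
  qed
  then have "(P *v x) \<bullet> x > 0" if "x \<noteq> 0" for x
    using lyapunov_positive[OF A P(1)] that by blast
  then show ?thesis unfolding brl_certificate_def using P by blast
qed

text \<open>By homogeneity only the unit sphere matters; it is compact, so there \<open>f\<close>
  stays away from 0 and \<open>g\<close> is bounded.\<close>

lemma quadratic_form_perturb:
  fixes f g :: "'a::euclidean_space \<Rightarrow> real"
  assumes cont: "continuous_on UNIV f" "continuous_on UNIV g"
    and hom: "\<And>c z. f (c *\<^sub>R z) = c\<^sup>2 * f z" "\<And>c z. g (c *\<^sub>R z) = c\<^sup>2 * g z"
    and neg: "\<And>z. z \<noteq> 0 \<Longrightarrow> f z < 0"
  obtains \<epsilon> where "\<epsilon> > 0" "\<And>e z. \<bar>e\<bar> \<le> \<epsilon> \<Longrightarrow> z \<noteq> 0 \<Longrightarrow> f z + e * g z < 0"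
proof -
  have comp: "compact (sphere (0::'a) 1)" and ne: "sphere (0::'a) 1 \<noteq> {}" by simp_all
  obtain p where p: "p \<in> sphere 0 1" "\<And>z. z \<in> sphere 0 1 \<Longrightarrow> f z \<le> f p"
    using continuous_attains_sup[OF comp ne continuous_on_subset[OF cont(1)]] by auto
  obtain q where q: "q \<in> sphere 0 1" "\<And>z. z \<in> sphere 0 1 \<Longrightarrow> \<bar>g z\<bar> \<le> \<bar>g q\<bar>"
    using continuous_attains_sup[OF comp ne continuous_on_rabs[OF continuous_on_subset[OF cont(2)]]] by auto
  have "p \<noteq> 0" using p(1) by auto
  then have fp: "f p < 0" by (rule neg)
  \<comment> \<open>Half of the gap \<open>- f p\<close> is left to the perturbation; the
    \<open>+ 1\<close> guards against \<open>g q = 0\<close>.\<close>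
  define \<epsilon> where "\<epsilon> = - f p / (2 * (\<bar>g q\<bar> + 1))"
  have \<epsilon>: "\<epsilon> > 0" unfolding \<epsilon>_def using fp by (intro divide_pos_pos) auto
  have "\<epsilon> * \<bar>g q\<bar> \<le> \<epsilon> * (\<bar>g q\<bar> + 1)" using \<epsilon> by simp
  also have "\<dots> = - f p / 2" by (simp add: \<epsilon>_def field_simps)
  finally have \<epsilon>g: "\<epsilon> * \<bar>g q\<bar> \<le> - f p / 2" .
  show ?thesis
  proof (rule that[OF \<epsilon>])
    fix e :: real and z :: 'a assume e: "\<bar>e\<bar> \<le> \<epsilon>" and z: "z \<noteq> 0"
    define y where "y = z /\<^sub>R norm z"
    have y: "y \<in> sphere 0 1" and zy: "z = norm z *\<^sub>R y" using z by (auto simp: y_def)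
    have "e * g y \<le> \<bar>e\<bar> * \<bar>g y\<bar>" by (metis abs_ge_self abs_mult)
    also have "\<dots> \<le> \<epsilon> * \<bar>g q\<bar>" using e \<epsilon> q(2)[OF y] by (intro mult_mono) auto
    finally have "f y + e * g y < 0" using p(2)[OF y] \<epsilon>g fp by linarith
    then have "(norm z)\<^sup>2 * (f y + e * g y) < 0" using z by (simp add: mult_pos_neg)
    moreover have "f z + e * g z = (norm z)\<^sup>2 * (f y + e * g y)"
      using hom(1)[of "norm z" y] hom(2)[of "norm z" y] unfolding zy[symmetric] by (simp add: algebra_simps)
    ultimately show "f z + e * g z < 0" by simp
  qed
qed

lemma brl_form_continuous:
  "continuous_on UNIV (\<lambda>z::(real^'n) \<times> (real^'w). 2 * ((P *v fst z) \<bullet> (A *v fst z + B *v snd z))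
    + (norm (C *v fst z + D *v snd z))\<^sup>2 - \<gamma>\<^sup>2 * (norm (snd z))\<^sup>2)"
  unfolding matrix_vector_mult_def by (intro continuous_intros)

lemma brl_form_homogeneous:
  fixes A P :: "real^'n^'n" and B :: "real^'w^'n" and C :: "real^'n^'z" and D :: "real^'w^'z"
  shows "2 * ((P *v fst (c *\<^sub>R z)) \<bullet> (A *v fst (c *\<^sub>R z) + B *v snd (c *\<^sub>R z)))
      + (norm (C *v fst (c *\<^sub>R z) + D *v snd (c *\<^sub>R z)))\<^sup>2 - \<gamma>\<^sup>2 * (norm (snd (c *\<^sub>R z)))\<^sup>2
    = c\<^sup>2 * (2 * ((P *v fst z) \<bullet> (A *v fst z + B *v snd z))
      + (norm (C *v fst z + D *v snd z))\<^sup>2 - \<gamma>\<^sup>2 * (norm (snd z))\<^sup>2)"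
  unfolding fst_scaleR snd_scaleR matrix_vector_mult_scaleR scaleR_add_right[symmetric]
    norm_scaleR power_mult_distrib power2_abs inner_scaleR_left inner_scaleR_right
  by (simp add: algebra_simps power2_eq_square)

lemma bounded_real_sufficient:
  fixes A :: "real^'n^'n" and B :: "real^'w^'n" and C :: "real^'n^'z" and D :: "real^'w^'z"
  assumes cert: "brl_certificate A B C D \<gamma> P" and \<gamma>: "\<gamma> > 0"
  shows "hurwitz A \<and> (SUP \<omega>::real. sigma_max (transfer A B C D (\<i> * complex_of_real \<omega>))) < \<gamma>"
proof
  have sym: "(P *v x) \<bullet> y = x \<bullet> (P *v y)" for x y using cert by (simp add: brl_certificate_def)
  have pos: "(P *v x) \<bullet> x > 0" if "x \<noteq> 0" for x using cert that unfolding brl_certificate_def by blast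
  let ?f = "\<lambda>z::(real^'n) \<times> (real^'w). 2 * ((P *v fst z) \<bullet> (A *v fst z + B *v snd z))
    + (norm (C *v fst z + D *v snd z))\<^sup>2 - \<gamma>\<^sup>2 * (norm (snd z))\<^sup>2"
  have neg: "?f z < 0" if "z \<noteq> 0" for z
    using cert that by (cases z) (auto simp: brl_certificate_def zero_prod_def)
  have negA: "(P *v x) \<bullet> (A *v x) < 0" if "x \<noteq> 0" for x
  proof -
    have "2 * ((P *v x) \<bullet> (A *v x)) + (norm (C *v x))\<^sup>2 < 0" using neg[of "(x, 0)"] that by (simp add: zero_prod_def)
    then show ?thesis using zero_le_power2[of "norm (C *v x)"] by linarith
  qed
  \<comment> \<open>Multiplication by \<open>a + i b\<close>, written on real and imaginary parts:
    symmetry of \<open>P\<close> cancels the terms in \<open>b\<close>.\<close>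
  have cross: "(P *v x1) \<bullet> (a *\<^sub>R x1 - b *\<^sub>R x2) + (P *v x2) \<bullet> (a *\<^sub>R x2 + b *\<^sub>R x1)
      = a * ((P *v x1) \<bullet> x1 + (P *v x2) \<bullet> x2)" for x1 x2 a b
    using sym[of x1 x2] by (simp add: inner_diff_right inner_add_right algebra_simps inner_commute)
  show hur: "hurwitz A"
    unfolding hurwitz_iff_eigenvalues
  proof (intro allI impI)
    fix s x assume x: "x \<noteq> 0" "cmat A *v x = s *s x"
    have A1: "A *v re_vec x = Re s *\<^sub>R re_vec x - Im s *\<^sub>R im_vec x"
      and A2: "A *v im_vec x = Re s *\<^sub>R im_vec x + Im s *\<^sub>R re_vec x"
      using x(2) re_vec_cmat[of A x] im_vec_cmat[of A x] by (simp_all add: re_vec_scale im_vec_scale)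
    have nz: "re_vec x \<noteq> 0 \<or> im_vec x \<noteq> 0" using x(1) re_im_vec_eq_0_iff by blast
    have le: "(P *v y) \<bullet> (A *v y) \<le> 0" "(P *v y) \<bullet> y \<ge> 0" for y
      using negA[of y] pos[of y] by (cases "y = 0"; auto)+
    have "(P *v re_vec x) \<bullet> (A *v re_vec x) + (P *v im_vec x) \<bullet> (A *v im_vec x) < 0"
      using nz negA le by (smt (verit))
    then have "Re s * ((P *v re_vec x) \<bullet> re_vec x + (P *v im_vec x) \<bullet> im_vec x) < 0"
      unfolding A1 A2 cross .
    moreover have "(P *v re_vec x) \<bullet> re_vec x + (P *v im_vec x) \<bullet> im_vec x > 0"
      using nz pos le(2) by (smt (verit))
    ultimately show "Re s < 0" by (simp add: mult_less_0_iff)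
  qed
  have normcont: "continuous_on UNIV (\<lambda>z::(real^'n) \<times> (real^'w). (norm z)\<^sup>2)"
    by (intro continuous_intros)
  have normhom: "(norm (c *\<^sub>R z))\<^sup>2 = c\<^sup>2 * (norm z)\<^sup>2" for c and z :: "(real^'n) \<times> (real^'w)"
    by (simp add: power_mult_distrib)
  \<comment> \<open>Pointwise strictness would bound the supremum only by
    \<open>\<le> \<gamma>\<close>; the uniform slack \<open>\<epsilon>\<close> yields a bound
    \<open>\<rho> < \<gamma>\<close>.\<close>
  obtain \<epsilon> where \<epsilon>: "\<epsilon> > 0" "\<And>e z. \<bar>e\<bar> \<le> \<epsilon> \<Longrightarrow> z \<noteq> 0 \<Longrightarrow> ?f z + e * (norm z)\<^sup>2 < 0"
    by (rule quadratic_form_perturb[OF brl_form_continuous normcont brl_form_homogeneous normhom neg])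
       (assumption | rule that)+
  have fle: "2 * ((P *v x) \<bullet> (A *v x + B *v w)) + (norm (C *v x + D *v w))\<^sup>2 - \<gamma>\<^sup>2 * (norm w)\<^sup>2 + \<epsilon> * (norm w)\<^sup>2 \<le> 0" for x w
  proof (cases "(x, w) = 0")
    case False
    have "\<epsilon> * (norm w)\<^sup>2 \<le> \<epsilon> * (norm (x, w))\<^sup>2"
      using \<epsilon>(1) by (intro mult_left_mono) (auto simp: norm_Pair)
    moreover have "?f (x, w) + \<epsilon> * (norm (x, w))\<^sup>2 < 0"
      using \<epsilon>(2)[OF _ False, of \<epsilon>] \<epsilon>(1) by simp
    ultimately show ?thesis unfolding fst_conv snd_conv by linarith
  qed (simp add: zero_prod_def)
  \<comment> \<open>\<open>\<gamma>\<^sup>2 - \<epsilon>\<close> is not known to be nonnegative,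
    hence the \<open>max 0\<close>.\<close>
  define \<rho> where "\<rho> = sqrt (max 0 (\<gamma>\<^sup>2 - \<epsilon>))"
  have \<rho>: "\<rho> < \<gamma>" "\<rho> \<ge> 0" "\<gamma>\<^sup>2 - \<epsilon> \<le> \<rho>\<^sup>2"
    using \<gamma> \<epsilon>(1) by (auto simp: \<rho>_def intro!: real_less_lsqrt)
  have "sigma_max (transfer A B C D (\<i> * complex_of_real \<omega>)) \<le> \<rho>" for \<omega>
    unfolding sigma_max_def
  proof (rule onorm_le)
    fix w
    obtain x where x: "cmat A *v x + cmat B *v w = (\<i> * complex_of_real \<omega>) *s x"
      using transfer_apply(1)[OF hur] by blast
    let ?h = "cmat C *v x + cmat D *v w"
    have A1: "A *v re_vec x + B *v re_vec w = 0 *\<^sub>R re_vec x - \<omega> *\<^sub>R im_vec x"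
      and A2: "A *v im_vec x + B *v im_vec w = 0 *\<^sub>R im_vec x + \<omega> *\<^sub>R re_vec x"
      using arg_cong[OF x, of re_vec] arg_cong[OF x, of im_vec]
      by (simp_all add: re_vec_add im_vec_add re_vec_cmat im_vec_cmat re_vec_scale im_vec_scale)
    have h: "(norm ?h)\<^sup>2 = (norm (C *v re_vec x + D *v re_vec w))\<^sup>2 + (norm (C *v im_vec x + D *v im_vec w))\<^sup>2"
      by (simp add: norm_re_im[of ?h] re_vec_add im_vec_add re_vec_cmat im_vec_cmat)
    have "2 * ((P *v re_vec x) \<bullet> (0 *\<^sub>R re_vec x - \<omega> *\<^sub>R im_vec x) + (P *v im_vec x) \<bullet> (0 *\<^sub>R im_vec x + \<omega> *\<^sub>R re_vec x))
        + (norm ?h)\<^sup>2 \<le> (\<gamma>\<^sup>2 - \<epsilon>) * (norm w)\<^sup>2"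
      using fle[of "re_vec x" "re_vec w"] fle[of "im_vec x" "im_vec w"]
      unfolding A1 A2 h norm_re_im[of w] by (simp add: algebra_simps)
    then have "(norm ?h)\<^sup>2 \<le> (\<gamma>\<^sup>2 - \<epsilon>) * (norm w)\<^sup>2" unfolding cross by simp
    also have "\<dots> \<le> \<rho>\<^sup>2 * (norm w)\<^sup>2" using \<rho>(3) by (intro mult_right_mono) auto
    finally have "(norm ?h)\<^sup>2 \<le> (\<rho> * norm w)\<^sup>2" by (simp only: power_mult_distrib)
    then have "norm ?h \<le> \<rho> * norm w"
      by (rule power2_le_imp_le) (use \<rho>(2) in simp)
    then show "norm (transfer A B C D (\<i> * complex_of_real \<omega>) *v w) \<le> \<rho> * norm w"
      by (simp add: transfer_apply(2)[OF hur x])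
  qed
  then have "(SUP \<omega>::real. sigma_max (transfer A B C D (\<i> * complex_of_real \<omega>))) \<le> \<rho>"
    by (rule cSUP_least[OF UNIV_not_empty])
  then show "(SUP \<omega>::real. sigma_max (transfer A B C D (\<i> * complex_of_real \<omega>))) < \<gamma>"
    using \<rho>(1) by simp
qed

text \<open>Positivity and dissipation are strict quadratic inequalities that depend affinely on
  \<open>P\<close>, so both survive a small symmetric perturbation.\<close>

lemma brl_certificate_perturb:
  fixes A :: "real^'n^'n" and B :: "real^'w^'n"
  assumes cert: "brl_certificate A B C D \<gamma> P" and J: "\<And>x y. (J *v x) \<bullet> y = x \<bullet> (J *v y)"
  obtains \<epsilon> where "\<epsilon> > 0" "\<And>e. \<bar>e\<bar> \<le> \<epsilon> \<Longrightarrow> brl_certificate A B C D \<gamma> (P + e *\<^sub>R J)"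
proof -
  have sym: "(P *v x) \<bullet> y = x \<bullet> (P *v y)" for x y using cert by (simp add: brl_certificate_def)
  let ?f = "\<lambda>z::(real^'n) \<times> (real^'w). 2 * ((P *v fst z) \<bullet> (A *v fst z + B *v snd z))
    + (norm (C *v fst z + D *v snd z))\<^sup>2 - \<gamma>\<^sup>2 * (norm (snd z))\<^sup>2"
  let ?g = "\<lambda>z::(real^'n) \<times> (real^'w). 2 * ((J *v fst z) \<bullet> (A *v fst z + B *v snd z))"
  let ?p = "\<lambda>x. - ((P *v x) \<bullet> x)" and ?q = "\<lambda>x. - ((J *v x) \<bullet> x)"
  have neg: "?f z < 0" if "z \<noteq> 0" for z
    using cert that by (cases z) (auto simp: brl_certificate_def zero_prod_def)
  have pneg: "?p x < 0" if "x \<noteq> 0" for x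
  proof -
    have "(P *v x) \<bullet> x > 0" using cert that unfolding brl_certificate_def by blast
    then show ?thesis by simp
  qed
  have contg: "continuous_on UNIV ?g" and contp: "continuous_on UNIV ?p" and contq: "continuous_on UNIV ?q"
    unfolding matrix_vector_mult_def by (intro continuous_intros)+
  have homg: "?g (c *\<^sub>R z) = c\<^sup>2 * ?g z" for c z
    unfolding fst_scaleR snd_scaleR matrix_vector_mult_scaleR scaleR_add_right[symmetric]
      inner_scaleR_left inner_scaleR_right by (simp add: power2_eq_square)
  have homp: "?p (c *\<^sub>R x) = c\<^sup>2 * ?p x" and homq: "?q (c *\<^sub>R x) = c\<^sup>2 * ?q x" for c x
    by (simp_all add: matrix_vector_mult_scaleR power2_eq_square)
  obtain \<epsilon>1 where \<epsilon>1: "\<epsilon>1 > 0" "\<And>e z. \<bar>e\<bar> \<le> \<epsilon>1 \<Longrightarrow> z \<noteq> 0 \<Longrightarrow> ?f z + e * ?g z < 0"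
    by (rule quadratic_form_perturb[OF brl_form_continuous contg brl_form_homogeneous homg neg])
       (assumption | rule that)+
  obtain \<epsilon>2 where \<epsilon>2: "\<epsilon>2 > 0" "\<And>e x. \<bar>e\<bar> \<le> \<epsilon>2 \<Longrightarrow> x \<noteq> 0 \<Longrightarrow> ?p x + e * ?q x < 0"
    by (rule quadratic_form_perturb[OF contp contq homp homq pneg]) (assumption | rule that)+
  have PJ: "(P + e *\<^sub>R J) *v x = P *v x + e *\<^sub>R (J *v x)" for e x
    by (simp add: matrix_vector_mult_add_rdistrib scaleR_matrix_vector_assoc)
  show ?thesis
  proof (rule that[of "min \<epsilon>1 \<epsilon>2"])
    show "min \<epsilon>1 \<epsilon>2 > 0" using \<epsilon>1 \<epsilon>2 by simp
    fix e :: real assume e: "\<bar>e\<bar> \<le> min \<epsilon>1 \<epsilon>2"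
    show "brl_certificate A B C D \<gamma> (P + e *\<^sub>R J)"
      unfolding brl_certificate_def
    proof (intro conjI allI impI)
      show "((P + e *\<^sub>R J) *v x) \<bullet> y = x \<bullet> ((P + e *\<^sub>R J) *v y)" for x y
        by (simp add: PJ inner_add_left inner_add_right sym J)
      show "((P + e *\<^sub>R J) *v x) \<bullet> x > 0" if "x \<noteq> 0" for x
        using \<epsilon>2(2)[OF _ that, of e] e by (simp add: PJ inner_add_left)
      show "2 * (((P + e *\<^sub>R J) *v x) \<bullet> (A *v x + B *v w)) + (norm (C *v x + D *v w))\<^sup>2 - \<gamma>\<^sup>2 * (norm w)\<^sup>2 < 0"
        if "x \<noteq> 0 \<or> w \<noteq> 0" for x w
      proof -
        have "(x, w) \<noteq> 0" using that by (auto simp: zero_prod_def)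
        from \<epsilon>1(2)[OF _ this, of e] e show ?thesis
          unfolding PJ inner_add_left inner_scaleR_left by simp
      qed
    qed
  qed
qed

lemma invertible_iff_kernel: "invertible (M :: real^'n^'n) \<longleftrightarrow> (\<forall>x. M *v x = 0 \<longrightarrow> x = 0)"
  using invertible_left_inverse[of M] matrix_left_invertible_ker[of M] by blast

text \<open>The determinant is a polynomial in \<open>e\<close> that is not identically zero, so its
  finitely many roots cannot fill \<open>{0<..\<epsilon>}\<close>.\<close>

lemma exists_small_invertible_shift:
  fixes N :: "real^'n^'n"
  assumes "\<epsilon> > 0"
  shows "\<exists>e. 0 < e \<and> e \<le> \<epsilon> \<and> invertible (N + e *\<^sub>R mat 1)"
proof -
  let ?d = "\<lambda>e. det (N + e *\<^sub>R mat 1)"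
  have "real_polynomial_function ?d"
    unfolding det_def
  proof (intro real_polynomial_function_sum real_polynomial_function.intros(4) real_polynomial_function_prod)
    show "finite {p. p permutes (UNIV::'n set)}" by (simp add: finite_permutations)
    show "finite (UNIV::'n set)" by simp
    show "real_polynomial_function (\<lambda>e. of_int (sign p))" for p :: "'n \<Rightarrow> 'n"
      by (rule real_polynomial_function.intros(2))
    have "real_polynomial_function (\<lambda>e. N $ i $ j + e * mat 1 $ i $ j)" for i j
      by (intro real_polynomial_function.intros(2-4) real_polynomial_function.intros(1)[OF bounded_linear_ident])
    then show "real_polynomial_function (\<lambda>e. (N + e *\<^sub>R mat 1) $ i $ p i)" for i p
      by simp
  qed
  then obtain a n where an: "?d = (\<lambda>e. \<Sum>i\<le>n. a i * e ^ i)"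
    by (auto simp: real_polynomial_function_iff_sum)
  have "\<exists>i\<le>n. a i \<noteq> 0"
  proof (rule ccontr)
    assume "\<not> ?thesis"
    then have zero: "?d e = 0" for e by (simp add: fun_cong[OF an, of e])
    obtain b where b: "b \<ge> 0" "\<And>x. norm (N *v x) \<le> b * norm x"
      using bounded_linear.nonneg_bounded[OF matrix_vector_mul_bounded_linear[of N]] by (metis mult.commute)
    \<comment> \<open>A shift larger than the operator bound \<open>b\<close> leaves no kernel,
      which refutes a vanishing determinant.\<close>
    have "\<not> invertible (N + (b + 1) *\<^sub>R mat 1)" using zero by (simp add: invertible_det_nz)
    then obtain x where x: "x \<noteq> 0" "(N + (b + 1) *\<^sub>R mat 1) *v x = 0"
      unfolding invertible_iff_kernel by blast
    then have "N *v x + (b + 1) *\<^sub>R x = 0"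
      by (simp only: matrix_vector_mult_add_rdistrib scaleR_matrix_vector_assoc[symmetric] matrix_vector_mul_lid)
    then have "N *v x = - ((b + 1) *\<^sub>R x)" by (simp only: eq_neg_iff_add_eq_0)
    then have "(b + 1) * norm x \<le> b * norm x" using b(2)[of x] b(1) by simp
    then show False using x(1) by (simp add: algebra_simps)
  qed
  then have "finite {e. (\<Sum>i\<le>n. a i * e ^ i) = 0}"
    by (subst polyfun_finite_roots)
  then have "finite {e. ?d e = 0}" by (simp only: fun_cong[OF an])
  moreover have "infinite {0<..\<epsilon>}" using assms by simp
  ultimately have "\<not> {0<..\<epsilon>} \<subseteq> {e. ?d e = 0}" using finite_subset by blast
  then obtain e where "e \<in> {0<..\<epsilon>}" "?d e \<noteq> 0" by blast
  then show ?thesis by (auto simp: invertible_det_nz)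
qed

subsection \<open>Block vectors\<close>

definition join :: "real^'a \<Rightarrow> real^'b \<Rightarrow> real^('a+'b)" where
  "join a b = (\<chi> i. case i of Inl k \<Rightarrow> a $ k | Inr k \<Rightarrow> b $ k)"

lemma join_cases: obtains a b where "v = join a b"
  by (rule that[of "\<chi> k. v $ Inl k" "\<chi> k. v $ Inr k"])
     (simp add: join_def vec_eq_iff split: sum.split)

lemma sum_UNIV_sum_type: "(\<Sum>i\<in>(UNIV::('a::finite + 'b::finite) set). f i) = (\<Sum>i\<in>UNIV. f (Inl i)) + (\<Sum>i\<in>UNIV. f (Inr i))"
  by (simp add: sum.Plus flip: UNIV_Plus_UNIV)

lemma inner_join [simp]: "join a b \<bullet> join c d = a \<bullet> c + b \<bullet> d"
  by (simp add: inner_vec_def join_def sum_UNIV_sum_type)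

lemma join_eq_iff [simp]: "join a b = join c d \<longleftrightarrow> a = c \<and> b = d"
  by (auto simp: join_def vec_eq_iff split: sum.split_asm sum.split)

lemma join_eq_0_iff [simp]: "join a b = 0 \<longleftrightarrow> a = 0 \<and> b = 0"
proof -
  have "(0 :: real^('a+'b)) = join 0 0" by (simp add: join_def vec_eq_iff split: sum.split)
  then have "join a b = 0 \<longleftrightarrow> join a b = join 0 0" by simp
  then show ?thesis by (simp only: join_eq_iff)
qed

lemma join_add: "join a b + join c d = join (a + c) (b + d)"
  by (simp add: join_def vec_eq_iff split: sum.split)

lemma blk_mult_join [simp]: "blk M11 M12 M21 M22 *v join a b = join (M11 *v a + M12 *v b) (M21 *v a + M22 *v b)"
  by (simp add: blk_def join_def vec_eq_iff matrix_vector_mult_def sum_UNIV_sum_type split: sum.split)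

lemma vblk_mult [simp]: "vblk M1 M2 *v w = join (M1 *v w) (M2 *v w)"
  by (simp add: vblk_def join_def vec_eq_iff matrix_vector_mult_def split: sum.split)

lemma hblk_mult_join [simp]: "hblk M1 M2 *v join a b = M1 *v a + M2 *v b"
  by (simp add: hblk_def join_def vec_eq_iff matrix_vector_mult_def sum_UNIV_sum_type)

lemma blk_cases: obtains M11 M12 M21 M22 where "M = blk M11 M12 M21 M22"
  by (rule that[of "\<chi> i j. M $ Inl i $ Inl j" "\<chi> i j. M $ Inl i $ Inr j"
        "\<chi> i j. M $ Inr i $ Inl j" "\<chi> i j. M $ Inr i $ Inr j"])
     (simp add: blk_def vec_eq_iff split: sum.split)

lemma blk_add_scaleR:
  "blk M11 M12 M21 M22 + e *\<^sub>R blk L11 L12 L21 L22 = blk (M11 + e *\<^sub>R L11) (M12 + e *\<^sub>R L12) (M21 + e *\<^sub>R L21) (M22 + e *\<^sub>R L22)"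
  by (simp add: blk_def vec_eq_iff split: sum.split)

lemma matrix_inv_vector:
  assumes "invertible (M :: real^'n^'n)"
  shows "M *v (matrix_inv M *v x) = x" "matrix_inv M *v (M *v x) = x"
  using matrix_inv_inverse[OF assms] by (simp_all add: matrix_vector_mul_assoc)

lemma transpose_mult_inner: "(transpose M *v x) \<bullet> y = x \<bullet> ((M :: real^'n^'m) *v y)"
  by (simp add: dot_lmul_matrix)

section \<open>Continuity of determinant and inverse, and convexity estimates\<close>

lemma continuous_on_det [continuous_intros]:
  fixes f :: "'a::topological_space \<Rightarrow> real^'n^'n"
  assumes "continuous_on S f"
  shows "continuous_on S (\<lambda>x. det (f x))"
  unfolding det_def by (intro continuous_intros assms)

text \<open>Cramer's rule writes each entry of the inverse as a quotient of determinants whose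
  denominator does not vanish on \<open>S\<close>.\<close>

lemma continuous_on_matrix_inv [continuous_intros]:
  fixes f :: "'a::topological_space \<Rightarrow> real^'n^'n"
  assumes f: "continuous_on S f" and inv: "\<And>x. x \<in> S \<Longrightarrow> invertible (f x)"
  shows "continuous_on S (\<lambda>x. matrix_inv (f x))"
proof -
  let ?C = "\<lambda>x i k. (\<chi> r c. if c = i then axis k 1 $ r else f x $ r $ c) :: real^'n^'n"
  have entry: "matrix_inv (f x) $ i $ k = det (?C x i k) / det (f x)" if "x \<in> S" for x i k
  proof -
    have "f x *v (matrix_inv (f x) *v axis k 1) = axis k 1"
      by (rule matrix_inv_vector(1)[OF inv[OF that]])
    moreover have "det (f x) \<noteq> 0" using inv[OF that] by (simp add: invertible_det_nz)
    ultimately have "matrix_inv (f x) *v axis k 1 = (\<chi> i. det (\<chi> r c. if c = i then axis k 1 $ r else f x $ r $ c) / det (f x))"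
      using cramer by blast
    then have "(matrix_inv (f x) *v axis k 1) $ i = det (?C x i k) / det (f x)" by simp
    then show ?thesis
      by (simp add: matrix_vector_mult_def axis_def if_distrib cong: if_cong)
  qed
  have contC: "continuous_on S (\<lambda>x. ?C x i k)" for i k
  proof (intro continuous_on_vec_lambda)
    show "continuous_on S (\<lambda>x. if c = i then axis k 1 $ r else f x $ r $ c)" for r c
      by (cases "c = i") (auto intro!: continuous_intros f)
  qed
  have "continuous_on S (\<lambda>x. \<chi> i k. det (?C x i k) / det (f x))"
    by (intro continuous_on_vec_lambda continuous_on_divide continuous_on_det contC f)
       (use inv in \<open>auto simp: invertible_det_nz\<close>)
  then show ?thesis
    by (rule continuous_on_eq) (simp add: vec_eq_iff entry)
qed

lemma norm_convex_square:
  fixes p q :: "'v::real_inner"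
  assumes "0 \<le> t" "t \<le> 1"
  shows "(norm ((1 - t) *\<^sub>R p + t *\<^sub>R q))\<^sup>2 \<le> (1 - t) * (norm p)\<^sup>2 + t * (norm q)\<^sup>2"
proof -
  have "(1 - t) * (norm p)\<^sup>2 + t * (norm q)\<^sup>2 - (norm ((1 - t) *\<^sub>R p + t *\<^sub>R q))\<^sup>2 = (t * (1 - t)) * (norm (p - q))\<^sup>2"
    by (simp add: power2_norm_eq_inner inner_add_left inner_add_right inner_diff_left inner_diff_right inner_commute) algebra
  then show ?thesis using assms by (smt (verit) mult_nonneg_nonneg zero_le_power2)
qed

lemma convex_combination_neg:
  fixes p q :: real
  assumes "0 \<le> t" "t \<le> 1" "p < 0" "q < 0"
  shows "(1 - t) * p + t * q < 0"
proof (cases "t = 0")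
  case False
  then have "t * q < 0" using assms by (simp add: mult_pos_neg)
  moreover have "(1 - t) * p \<le> 0" using assms by (simp add: mult_nonneg_nonpos)
  ultimately show ?thesis by simp
qed (use assms in simp)

subsection \<open>The linearizing change of variables\<close>

type_synonym ('x,'u,'y) lmi_var =
  "(real^'x^'x) \<times> (real^'x^'x) \<times> (real^'x^'x) \<times> (real^'y^'x) \<times> (real^'x^'u) \<times> (real^'y^'u)"

locale plant =
  fixes A :: "real^'x^'x" and B1 :: "real^'w^'x" and B2 :: "real^'u^'x"
    and C1 :: "real^'x^'z" and D11 :: "real^'w^'z" and D12 :: "real^'u^'z"
    and C2 :: "real^'x^'y" and D21 :: "real^'w^'y"
begin

text \<open>This is \<open>P x \<bullet> (Acl x + Bcl w)\<close> in the coordinates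
  \<open>x = (X a + b, W a)\<close>, \<open>P x = (a + Y b, N^T b)\<close>. The variables
  \<open>Ah\<close>, \<open>Bh\<close>, \<open>Ch\<close>, \<open>Dh\<close> absorb the products of
  controller blocks with Lyapunov blocks, which makes the form affine in the six variables.\<close>

definition lin_form :: "('x,'u,'y) lmi_var \<Rightarrow> real^'x \<Rightarrow> real^'x \<Rightarrow> real^'w \<Rightarrow> real" where
  "lin_form = (\<lambda>(X, Y, Ah, Bh, Ch, Dh) a b w.
     a \<bullet> (A *v (X *v a + b) + B2 *v (Ch *v a + Dh *v (C2 *v b + D21 *v w)) + B1 *v w)
   + b \<bullet> (Ah *v a + Y *v (A *v b + B1 *v w) + Bh *v (C2 *v b + D21 *v w)))"

definition out_form :: "('x,'u,'y) lmi_var \<Rightarrow> real^'x \<Rightarrow> real^'x \<Rightarrow> real^'w \<Rightarrow> real^'z" where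
  "out_form = (\<lambda>(X, Y, Ah, Bh, Ch, Dh) a b w.
     C1 *v (X *v a + b) + D12 *v (Ch *v a + Dh *v (C2 *v b + D21 *v w)) + D11 *v w)"

text \<open>The third conjunct is positive definiteness of the block matrix with diagonal
  \<open>X\<close>, \<open>Y\<close> and identity off-diagonal blocks: it expresses
  \<open>P > 0\<close> in the new coordinates. The last conjunct is the dissipation
  inequality.\<close>

definition lmi :: "real \<Rightarrow> ('x,'u,'y) lmi_var \<Rightarrow> bool" where
  "lmi \<gamma> = (\<lambda>\<theta>. case \<theta> of (X, Y, Ah, Bh, Ch, Dh) \<Rightarrow>
     (\<forall>a b. (X *v a) \<bullet> b = a \<bullet> (X *v b)) \<and> (\<forall>a b. (Y *v a) \<bullet> b = a \<bullet> (Y *v b)) \<and>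
     (\<forall>a b. a \<noteq> 0 \<or> b \<noteq> 0 \<longrightarrow> (X *v a) \<bullet> a + 2 * (a \<bullet> b) + (Y *v b) \<bullet> b > 0) \<and>
     (\<forall>a b w. a \<noteq> 0 \<or> b \<noteq> 0 \<or> w \<noteq> 0 \<longrightarrow>
        2 * lin_form \<theta> a b w + (norm (out_form \<theta> a b w))\<^sup>2 - \<gamma>\<^sup>2 * (norm w)\<^sup>2 < 0))"

lemma lmi_iff:
  "lmi \<gamma> (X, Y, Ah, Bh, Ch, Dh) \<longleftrightarrow>
     (\<forall>a b. (X *v a) \<bullet> b = a \<bullet> (X *v b)) \<and> (\<forall>a b. (Y *v a) \<bullet> b = a \<bullet> (Y *v b)) \<and>
     (\<forall>a b. a \<noteq> 0 \<or> b \<noteq> 0 \<longrightarrow> (X *v a) \<bullet> a + 2 * (a \<bullet> b) + (Y *v b) \<bullet> b > 0) \<and>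
     (\<forall>a b w. a \<noteq> 0 \<or> b \<noteq> 0 \<or> w \<noteq> 0 \<longrightarrow> 2 * lin_form (X, Y, Ah, Bh, Ch, Dh) a b w
        + (norm (out_form (X, Y, Ah, Bh, Ch, Dh) a b w))\<^sup>2 - \<gamma>\<^sup>2 * (norm w)\<^sup>2 < 0)"
  by (simp only: lmi_def prod.case)

lemma lmiD:
  assumes "lmi \<gamma> \<theta>" "\<theta> = (X, Y, Ah, Bh, Ch, Dh)"
  shows "(X *v a) \<bullet> b = a \<bullet> (X *v b)" "(Y *v a) \<bullet> b = a \<bullet> (Y *v b)"
    "a \<noteq> 0 \<or> b \<noteq> 0 \<Longrightarrow> (X *v a) \<bullet> a + 2 * (a \<bullet> b) + (Y *v b) \<bullet> b > 0"
    "a \<noteq> 0 \<or> b \<noteq> 0 \<or> w \<noteq> 0 \<Longrightarrow> 2 * lin_form \<theta> a b w + (norm (out_form \<theta> a b w))\<^sup>2 - \<gamma>\<^sup>2 * (norm w)\<^sup>2 < 0"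
proof -
  note * = assms(1)[unfolded assms(2) lmi_iff]
  show "(X *v a) \<bullet> b = a \<bullet> (X *v b)" by (rule *[THEN conjunct1, rule_format])
  show "(Y *v a) \<bullet> b = a \<bullet> (Y *v b)" by (rule *[THEN conjunct2, THEN conjunct1, rule_format])
  show "a \<noteq> 0 \<or> b \<noteq> 0 \<Longrightarrow> (X *v a) \<bullet> a + 2 * (a \<bullet> b) + (Y *v b) \<bullet> b > 0"
    by (rule *[THEN conjunct2, THEN conjunct2, THEN conjunct1, rule_format])
  show "a \<noteq> 0 \<or> b \<noteq> 0 \<or> w \<noteq> 0 \<Longrightarrow> 2 * lin_form \<theta> a b w + (norm (out_form \<theta> a b w))\<^sup>2 - \<gamma>\<^sup>2 * (norm w)\<^sup>2 < 0"
    unfolding assms(2) by (rule *[THEN conjunct2, THEN conjunct2, THEN conjunct2, rule_format])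
qed

text \<open>\<open>W\<close> is the transposed off-diagonal block of the inverse Lyapunov matrix; the off-diagonal block
  \<open>N\<close> of the Lyapunov matrix itself is then determined by \<open>Y X + N W = 1\<close>.\<close>

definition recon :: "('x,'u,'y) lmi_var \<Rightarrow> real^'x^'x \<Rightarrow> ('x,'u,'y) ctrl" where
  "recon = (\<lambda>(X, Y, Ah, Bh, Ch, Dh) W.
     let N = (mat 1 - Y ** X) ** matrix_inv W in
     (Dh, (Ch - Dh ** C2 ** X) ** matrix_inv W, matrix_inv N ** (Bh - Y ** B2 ** Dh),
      matrix_inv N ** (Ah - Y ** A ** X - Y ** B2 ** Ch - Bh ** C2 ** X + Y ** B2 ** Dh ** C2 ** X) ** matrix_inv W))"

text \<open>The three relations are exactly what cancels the products of unknown blocks. They are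
  stated on vectors so that they serve both the reconstruction of a controller and the
  representation of a given one.\<close>

lemma closed_loop_forms:
  assumes Y: "\<And>a b. (Y *v a) \<bullet> b = a \<bullet> (Y *v b)"
    and C: "\<And>a. CK *v (W *v a) = Ch *v a - DK *v (C2 *v (X *v a))"
    and B: "\<And>y. N *v (BK *v y) = Bh *v y - Y *v (B2 *v (DK *v y))"
    and AK: "\<And>a. N *v (AK *v (W *v a)) = Ah *v a - Y *v (A *v (X *v a)) - Y *v (B2 *v (Ch *v a))
        - Bh *v (C2 *v (X *v a)) + Y *v (B2 *v (DK *v (C2 *v (X *v a))))"
  defines "K \<equiv> (DK, CK, BK, AK)" and "\<theta> \<equiv> (X, Y, Ah, Bh, Ch, DK)"
  shows "join (a + Y *v b) (transpose N *v b) \<bullet>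
      (Acl A B2 C2 K *v join (X *v a + b) (W *v a) + Bcl B1 B2 D21 K *v w) = lin_form \<theta> a b w"
    and "Ccl C1 D12 C2 K *v join (X *v a + b) (W *v a) + Dcl D11 D12 D21 K *v w = out_form \<theta> a b w"
proof -
  \<comment> \<open>\<open>x\<close>, \<open>y\<close>, \<open>u\<close> are the plant state, the
    measurement and the control input when the controller state is \<open>W *v a\<close>.\<close>
  define x where "x = X *v a + b"
  define y where "y = C2 *v x + D21 *v w"
  define u where "u = Ch *v a + DK *v (C2 *v b + D21 *v w)"
  have u: "u = DK *v y + CK *v (W *v a)"
    unfolding u_def C y_def x_def by (simp add: algebra_simps matrix_vector_right_distrib)
  have cl: "Acl A B2 C2 K *v join x (W *v a) + Bcl B1 B2 D21 K *v w
      = join (A *v x + B2 *v u + B1 *v w) (BK *v y + AK *v (W *v a))"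
    by (simp add: K_def Acl_def Bcl_def join_add u y_def matrix_vector_mult_add_rdistrib matrix_vector_right_distrib
        flip: matrix_vector_mul_assoc)
  have sec: "Y *v (A *v x + B2 *v u + B1 *v w) + N *v (BK *v y + AK *v (W *v a))
      = Ah *v a + Y *v (A *v b + B1 *v w) + Bh *v (C2 *v b + D21 *v w)"
    unfolding matrix_vector_right_distrib B AK u_def y_def x_def
    by (simp only: add_diff_eq diff_add_eq diff_diff_eq2 diff_diff_eq diff_eq_eq eq_diff_eq add_ac)
  have "join (a + Y *v b) (transpose N *v b) \<bullet> join (A *v x + B2 *v u + B1 *v w) (BK *v y + AK *v (W *v a))
      = a \<bullet> (A *v x + B2 *v u + B1 *v w) + b \<bullet> (Y *v (A *v x + B2 *v u + B1 *v w) + N *v (BK *v y + AK *v (W *v a)))"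
    unfolding inner_join transpose_mult_inner inner_add_left Y inner_add_right[of b] by simp
  then show "join (a + Y *v b) (transpose N *v b) \<bullet>
      (Acl A B2 C2 K *v join (X *v a + b) (W *v a) + Bcl B1 B2 D21 K *v w) = lin_form \<theta> a b w"
    unfolding x_def[symmetric] cl sec by (simp add: lin_form_def \<theta>_def u_def x_def)
  have "Ccl C1 D12 C2 K *v join x (W *v a) + Dcl D11 D12 D21 K *v w = C1 *v x + D12 *v u + D11 *v w"
    by (simp add: K_def Ccl_def Dcl_def u y_def matrix_vector_mult_add_rdistrib matrix_vector_right_distrib
        flip: matrix_vector_mul_assoc)
  then show "Ccl C1 D12 C2 K *v join (X *v a + b) (W *v a) + Dcl D11 D12 D21 K *v w = out_form \<theta> a b w"
    by (simp only: out_form_def \<theta>_def u_def x_def prod.case)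
qed

text \<open>If \<open>Y X a = a\<close>, the coupling form vanishes at the pair
  \<open>(a, - X a)\<close>, so positivity forces \<open>a = 0\<close>.\<close>

lemma lmi_invertible:
  assumes "lmi \<gamma> (X, Y, r)"
  shows "invertible (mat 1 - Y ** X)"
  unfolding invertible_iff_kernel
proof (intro allI impI)
  fix a assume "(mat 1 - Y ** X) *v a = 0"
  then have a: "Y *v (X *v a) = a" by (simp add: matrix_vector_mult_diff_rdistrib matrix_vector_mul_assoc)
  obtain Ah Bh Ch Dh where r: "r = (Ah, Bh, Ch, Dh)" by (rule prod_cases4)
  note X = lmiD(1)[OF assms[unfolded r] refl] and coupling = lmiD(3)[OF assms[unfolded r] refl]
  show "a = 0"
  proof (rule ccontr)
    assume "a \<noteq> 0"
    moreover have "Y *v (- (X *v a)) = - a"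
      using a by (metis (no_types) matrix_vector_mult_diff_distrib diff_0 matrix_vector_mult_0_right)
    ultimately show False using coupling[of a "- (X *v a)"] by (simp add: X[of a a] inner_commute)
  qed
qed

lemma recon_relations:
  assumes W: "invertible W" and NI: "invertible (mat 1 - Y ** X)"
    and K: "recon (X, Y, Ah, Bh, Ch, Dh) W = (DK, CK, BK, AK)"
  defines "N \<equiv> (mat 1 - Y ** X) ** matrix_inv W"
  shows "DK = Dh" "N *v (W *v a) = a - Y *v (X *v a)"
    "CK *v (W *v a) = Ch *v a - DK *v (C2 *v (X *v a))"
    "N *v (BK *v y) = Bh *v y - Y *v (B2 *v (DK *v y))"
    "N *v (AK *v (W *v a)) = Ah *v a - Y *v (A *v (X *v a)) - Y *v (B2 *v (Ch *v a))
        - Bh *v (C2 *v (X *v a)) + Y *v (B2 *v (DK *v (C2 *v (X *v a))))"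
proof -
  have "invertible (matrix_inv W)" using matrix_inv_inverse[OF W] by (auto simp: invertible_def)
  then have N: "invertible N" unfolding N_def using NI by (intro invertible_mult)
  have K': "DK = Dh" "CK = (Ch - Dh ** C2 ** X) ** matrix_inv W" "BK = matrix_inv N ** (Bh - Y ** B2 ** Dh)"
    "AK = matrix_inv N ** (Ah - Y ** A ** X - Y ** B2 ** Ch - Bh ** C2 ** X + Y ** B2 ** Dh ** C2 ** X) ** matrix_inv W"
    using K by (auto simp: recon_def Let_def N_def)
  note simps = matrix_vector_mult_add_rdistrib matrix_vector_mult_diff_rdistrib matrix_inv_vector[OF W] matrix_inv_vector[OF N]
  show "DK = Dh" by (rule K')
  show "N *v (W *v a) = a - Y *v (X *v a)"
    by (simp add: N_def simps flip: matrix_vector_mul_assoc)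
  show "CK *v (W *v a) = Ch *v a - DK *v (C2 *v (X *v a))"
    by (simp add: K' simps flip: matrix_vector_mul_assoc)
  show "N *v (BK *v y) = Bh *v y - Y *v (B2 *v (DK *v y))"
    by (simp add: K' simps flip: matrix_vector_mul_assoc)
  show "N *v (AK *v (W *v a)) = Ah *v a - Y *v (A *v (X *v a)) - Y *v (B2 *v (Ch *v a))
        - Bh *v (C2 *v (X *v a)) + Y *v (B2 *v (DK *v (C2 *v (X *v a))))"
    by (simp add: K' simps flip: matrix_vector_mul_assoc)
qed

lemma recon_unique:
  assumes W: "invertible W" and N: "invertible N"
    and NW: "\<And>a. N *v (W *v a) = a - Y *v (X *v a)"
    and Bh: "Bh = Y ** B2 ** DK + N ** BK" and Ch: "Ch = DK ** C2 ** X + CK ** W"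
  shows "recon (X, Y, Y ** A ** X + Y ** B2 ** Ch + Bh ** C2 ** X - Y ** B2 ** DK ** C2 ** X + N ** AK ** W,
      Bh, Ch, DK) W = (DK, CK, BK, AK)"
proof -
  have "N ** W = mat 1 - Y ** X"
    using NW by (simp add: matrix_eq matrix_vector_mult_diff_rdistrib flip: matrix_vector_mul_assoc)
  then have N': "(mat 1 - Y ** X) ** matrix_inv W = N"
    using matrix_inv_inverse(1)[OF W] by (metis matrix_mul_assoc matrix_mul_rid)
  have c: "M ** W ** matrix_inv W = M" for M :: "real^'x^'m"
    by (simp add: matrix_inv_inverse(1)[OF W] flip: matrix_mul_assoc)
  have d: "matrix_inv N ** (N ** M) = M" for M :: "real^'m^'x"
    by (simp add: matrix_mul_assoc matrix_inv_inverse(2)[OF N])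
  have CK: "(Ch - DK ** C2 ** X) ** matrix_inv W = CK"
    by (simp only: Ch add_diff_cancel_left' c)
  have BK: "matrix_inv N ** (Bh - Y ** B2 ** DK) = BK"
    by (simp only: Bh add_diff_cancel_left' d)
  have "matrix_inv N ** (N ** AK ** W) ** matrix_inv W = AK"
    by (simp only: matrix_mul_assoc[of N, symmetric] d c)
  moreover have "p + q + r - s + n - p - q - r + s = n" for p q r s n :: "real^'x^'x" by simp
  ultimately show ?thesis
    unfolding recon_def Let_def prod.case N' CK BK by simp
qed

lemma hinf_norm_eq: "hinf_norm A B1 B2 C1 D11 D12 C2 D21 K =
    (SUP \<omega>::real. sigma_max (transfer (Acl A B2 C2 K) (Bcl B1 B2 D21 K) (Ccl C1 D12 C2 K) (Dcl D11 D12 D21 K) (\<i> * complex_of_real \<omega>)))"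
  by (simp add: hinf_norm_def Tzw_def transfer_def)

lemma Kgamma_recon:
  assumes \<theta>: "lmi \<gamma> \<theta>" and W: "invertible W" and \<gamma>: "\<gamma> > 0"
  shows "recon \<theta> W \<in> Kgamma A B1 B2 C1 D11 D12 C2 D21 \<gamma>"
proof -
  obtain X Y Ah Bh Ch Dh where \<theta>_eq: "\<theta> = (X, Y, Ah, Bh, Ch, Dh)" by (rule prod_cases6)
  obtain DK CK BK AK where K: "recon \<theta> W = (DK, CK, BK, AK)" by (rule prod_cases4)
  note X = lmiD(1)[OF \<theta> \<theta>_eq] and Y = lmiD(2)[OF \<theta> \<theta>_eq]
    and coupling = lmiD(3)[OF \<theta> \<theta>_eq] and neg = lmiD(4)[OF \<theta> \<theta>_eq]
  have NI: "invertible (mat 1 - Y ** X)" using \<theta> unfolding \<theta>_eq by (rule lmi_invertible)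
  define N where "N = (mat 1 - Y ** X) ** matrix_inv W"
  note rel = recon_relations[OF W NI K[unfolded \<theta>_eq], folded N_def]
  have \<theta>_eq': "\<theta> = (X, Y, Ah, Bh, Ch, DK)" by (simp add: \<theta>_eq rel(1))
  note forms = closed_loop_forms[OF Y rel(3-5), folded \<theta>_eq' K]
  \<comment> \<open>\<open>T\<close> is the coordinate change from \<open>(a, b)\<close> to the
    closed-loop state, and \<open>S\<close> is what the Lyapunov matrix has to make of it; so
    \<open>P\<close> is defined by \<open>P T = S\<close>.\<close>
  define T where "T = blk X (mat 1) W 0"
  define S where "S = blk (mat 1) Y 0 (transpose N)"
  have Tj: "T *v join a b = join (X *v a + b) (W *v a)" and Sj: "S *v join a b = join (a + Y *v b) (transpose N *v b)" for a b
    by (simp_all add: T_def S_def del: transpose_matrix_vector)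
  have W0: "a = 0" if "W *v a = 0" for a using W that by (simp add: invertible_iff_kernel)
  have Tinv: "invertible T"
    unfolding invertible_iff_kernel
  proof (intro allI impI)
    fix v assume v0: "T *v v = 0"
    obtain a b where v: "v = join a b" by (rule join_cases)
    have "X *v a + b = 0" "W *v a = 0" using v0 by (simp_all add: v Tj)
    moreover from this have "a = 0" using W0 by blast
    ultimately show "v = 0" by (simp add: v)
  qed
  define P where "P = S ** matrix_inv T"
  have PT: "P *v (T *v v) = S *v v" for v
    by (simp only: P_def matrix_inv_vector[OF Tinv] matrix_vector_mul_assoc[symmetric])
  have Pj: "P *v join (X *v a + b) (W *v a) = join (a + Y *v b) (transpose N *v b)" for a b
    using PT[of "join a b"] by (simp only: Tj Sj)
  have repr: "\<exists>a b. v = T *v join a b" for v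
  proof -
    have "v = T *v (matrix_inv T *v v)" by (simp only: matrix_inv_vector[OF Tinv])
    moreover obtain a b where "matrix_inv T *v v = join a b" by (rule join_cases)
    ultimately show ?thesis by metis
  qed
  \<comment> \<open>\<open>N W = 1 - Y X\<close> cancels the term pairing \<open>Y b\<close> with
    \<open>X a'\<close>. What remains is symmetric in the two pairs and reduces to the coupling form
    when they agree.\<close>
  have ST: "(S *v join a b) \<bullet> (T *v join a' b') = (X *v a) \<bullet> a' + a \<bullet> b' + b \<bullet> a' + (Y *v b) \<bullet> b'" for a b a' b'
    unfolding Tj Sj inner_join transpose_mult_inner rel(2)
    by (simp add: inner_add_left inner_add_right inner_diff_right X Y)
  have "brl_certificate (Acl A B2 C2 (recon \<theta> W)) (Bcl B1 B2 D21 (recon \<theta> W)) (Ccl C1 D12 C2 (recon \<theta> W)) (Dcl D11 D12 D21 (recon \<theta> W)) \<gamma> P"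
    unfolding brl_certificate_def
  proof (intro conjI allI impI)
    fix x y :: "real^('x+'x)"
    obtain a b where x: "x = T *v join a b" using repr by blast
    obtain a' b' where y: "y = T *v join a' b'" using repr by blast
    show "(P *v x) \<bullet> y = x \<bullet> (P *v y)"
    proof -
      have "x \<bullet> (P *v y) = (S *v join a' b') \<bullet> (T *v join a b)"
        unfolding x y PT by (rule inner_commute)
      then show ?thesis
        unfolding x y PT ST
        using X[of a a'] Y[of b b'] inner_commute[of a "X *v a'"] inner_commute[of b "Y *v b'"]
          inner_commute[of a b'] inner_commute[of b a'] by linarith
    qed
  next
    fix x :: "real^('x+'x)" assume "x \<noteq> 0"
    obtain a b where x: "x = T *v join a b" using repr by blast
    have "a \<noteq> 0 \<or> b \<noteq> 0"
    proof (rule ccontr)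
      assume "\<not> ?thesis"
      then have "x = 0" by (simp add: x Tj)
      then show False using \<open>x \<noteq> 0\<close> by contradiction
    qed
    from coupling[OF this] show "(P *v x) \<bullet> x > 0"
      unfolding x PT ST by (simp add: inner_commute)
  next
    fix x :: "real^('x+'x)" and w :: "real^'w" assume xw: "x \<noteq> 0 \<or> w \<noteq> 0"
    obtain a b where x: "x = T *v join a b" using repr by blast
    have "a \<noteq> 0 \<or> b \<noteq> 0 \<or> w \<noteq> 0"
    proof (rule ccontr)
      assume neg: "\<not> ?thesis"
      then have "x = 0" by (simp add: x Tj)
      then show False using xw neg by blast
    qed
    from neg[OF this]
    show "2 * ((P *v x) \<bullet> (Acl A B2 C2 (recon \<theta> W) *v x + Bcl B1 B2 D21 (recon \<theta> W) *v w))
      + (norm (Ccl C1 D12 C2 (recon \<theta> W) *v x + Dcl D11 D12 D21 (recon \<theta> W) *v w))\<^sup>2 - \<gamma>\<^sup>2 * (norm w)\<^sup>2 < 0"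
      unfolding x Tj Pj forms .
  qed
  from bounded_real_sufficient[OF this \<gamma>] show ?thesis
    by (simp add: Kgamma_def Cstab_def hinf_norm_eq)
qed

lemma Kgamma_represent:
  assumes K: "K \<in> Kgamma A B1 B2 C1 D11 D12 C2 D21 \<gamma>"
  shows "\<exists>\<theta> W. lmi \<gamma> \<theta> \<and> invertible W \<and> recon \<theta> W = K"
proof -
  obtain DK CK BK AK where K_eq: "K = (DK, CK, BK, AK)" by (rule prod_cases4)
  let ?cert = "brl_certificate (Acl A B2 C2 K) (Bcl B1 B2 D21 K) (Ccl C1 D12 C2 K) (Dcl D11 D12 D21 K) \<gamma>"
  have "hurwitz (Acl A B2 C2 K)" "hinf_norm A B1 B2 C1 D11 D12 C2 D21 K < \<gamma>"
    using K by (simp_all add: Kgamma_def Cstab_def)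
  from bounded_real_necessary[OF this[unfolded hinf_norm_eq]] obtain P0 where P0: "?cert P0" ..
  \<comment> \<open>\<open>J\<close> shifts both off-diagonal blocks by multiples of the identity
    and leaves the diagonal blocks alone.\<close>
  define J :: "real^('x+'x)^('x+'x)" where "J = blk 0 (mat 1) (mat 1) 0"
  have J: "(J *v x) \<bullet> y = x \<bullet> (J *v y)" for x y
    by (cases x rule: join_cases; cases y rule: join_cases) (simp add: J_def)
  obtain \<epsilon> where \<epsilon>: "\<epsilon> > 0" "\<And>e. \<bar>e\<bar> \<le> \<epsilon> \<Longrightarrow> ?cert (P0 + e *\<^sub>R J)"
    by (rule brl_certificate_perturb[OF P0 J]) (assumption | rule that)+
  obtain Y N0 N0' Q where P0_eq: "P0 = blk Y N0 N0' Q" by (rule blk_cases)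
  obtain e where e: "0 < e" "e \<le> \<epsilon>" "invertible (N0 + e *\<^sub>R mat 1)"
    using exists_small_invertible_shift[OF \<epsilon>(1)] by blast
  define N where "N = N0 + e *\<^sub>R mat 1"
  define N' where "N' = N0' + e *\<^sub>R mat 1"
  define P where "P = blk Y N N' Q"
  have Ninv: "invertible N" using e(3) by (simp add: N_def)
  have "P = P0 + e *\<^sub>R J" by (simp add: P_def P0_eq J_def blk_add_scaleR N_def N'_def)
  then have cert: "?cert P" using \<epsilon>(2)[of e] e by simp
  have sym: "(P *v x) \<bullet> y = x \<bullet> (P *v y)" for x y
    using cert unfolding brl_certificate_def by blast
  have pos: "(P *v x) \<bullet> x > 0" if "x \<noteq> 0" for x
    using cert that unfolding brl_certificate_def by blast
  have neg: "2 * ((P *v x) \<bullet> (Acl A B2 C2 K *v x + Bcl B1 B2 D21 K *v w))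
      + (norm (Ccl C1 D12 C2 K *v x + Dcl D11 D12 D21 K *v w))\<^sup>2 - \<gamma>\<^sup>2 * (norm w)\<^sup>2 < 0" if "x \<noteq> 0 \<or> w \<noteq> 0" for x w
    using cert that unfolding brl_certificate_def by blast
  have Y: "(Y *v a) \<bullet> b = a \<bullet> (Y *v b)" and NN: "(N' *v a) \<bullet> b = a \<bullet> (N *v b)" for a b
    using sym[of "join a 0" "join b 0"] sym[of "join a 0" "join 0 b"] by (simp_all add: P_def)
  have N': "N' *v b = transpose N *v b" for b
    by (rule vector_eq_rdot[THEN iffD1]) (simp only: NN transpose_mult_inner simp_thms)
  have Pinv: "invertible P"
    unfolding invertible_iff_kernel using pos by (metis inner_zero_left less_irrefl)
  \<comment> \<open>Only the first block column of the inverse is used: it gives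
    \<open>P (X a, W a) = (a, 0)\<close>.\<close>
  obtain X L W R where Pi: "matrix_inv P = blk X L W R" by (rule blk_cases)
  have PXW: "P *v join (X *v a) (W *v a) = join a 0" for a
    using matrix_inv_vector(1)[OF Pinv, of "join a 0"] by (simp add: Pi)
  then have NW: "Y *v (X *v a) + N *v (W *v a) = a" and N'W: "N' *v (X *v a) + Q *v (W *v a) = 0" for a
    by (simp_all add: P_def)
  have NW': "N *v (W *v a) = a - Y *v (X *v a)" for a using NW[of a] by (simp add: algebra_simps)
  have P0b: "P *v join b 0 = join (Y *v b) (N' *v b)" for b by (simp add: P_def)
  have Pv: "P *v join (X *v a + b) (W *v a) = join (a + Y *v b) (transpose N *v b)" for a b
  proof -
    have "P *v (join (X *v a) (W *v a) + join b 0) = join a 0 + join (Y *v b) (N' *v b)"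
      by (simp only: matrix_vector_right_distrib PXW P0b)
    then show ?thesis by (simp only: join_add N' add_0 add_0_right)
  qed
  have X: "(X *v a) \<bullet> b = a \<bullet> (X *v b)" for a b
    using sym[of "join (X *v a) (W *v a)" "join (X *v b) (W *v b)"] by (simp add: PXW)
  \<comment> \<open>With \<open>W a = 0\<close>, the second block row gives
    \<open>N^T X a = 0\<close>, hence \<open>X a = 0\<close> since \<open>N\<close> is invertible;
    the first block row then gives \<open>a = 0\<close>.\<close>
  have W0: "a = 0" if "W *v a = 0" for a
  proof -
    have "transpose N *v (X *v a) = 0" using N'W[of a] that by (simp add: N')
    moreover have "invertible (transpose N)" using Ninv by (simp add: transpose_invertible)
    ultimately have "X *v a = 0" by (simp only: invertible_iff_kernel)
    then show ?thesis using NW[of a] that by simp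
  qed
  then have Winv: "invertible W" by (simp add: invertible_iff_kernel)
  \<comment> \<open>The formulas of \<open>recon\<close>, solved for the transformed
    variables.\<close>
  define Ch where "Ch = DK ** C2 ** X + CK ** W"
  define Bh where "Bh = Y ** B2 ** DK + N ** BK"
  define Ah where "Ah = Y ** A ** X + Y ** B2 ** Ch + Bh ** C2 ** X - Y ** B2 ** DK ** C2 ** X + N ** AK ** W"
  let ?\<theta> = "(X, Y, Ah, Bh, Ch, DK)"
  have rec: "recon ?\<theta> W = K"
    unfolding K_eq Ah_def by (rule recon_unique[OF Winv Ninv NW' Bh_def Ch_def])
  note expand = matrix_vector_mult_add_rdistrib matrix_vector_mult_diff_rdistrib matrix_vector_mul_assoc[symmetric]
  have C: "CK *v (W *v a) = Ch *v a - DK *v (C2 *v (X *v a))" for a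
    unfolding Ch_def expand by simp
  have B: "N *v (BK *v y) = Bh *v y - Y *v (B2 *v (DK *v y))" for y
    unfolding Bh_def expand by simp
  have AK: "N *v (AK *v (W *v a)) = Ah *v a - Y *v (A *v (X *v a)) - Y *v (B2 *v (Ch *v a))
        - Bh *v (C2 *v (X *v a)) + Y *v (B2 *v (DK *v (C2 *v (X *v a))))" for a
    unfolding Ah_def expand by simp
  have forms: "join (a + Y *v b) (transpose N *v b) \<bullet>
      (Acl A B2 C2 K *v join (X *v a + b) (W *v a) + Bcl B1 B2 D21 K *v w) = lin_form ?\<theta> a b w"
    "Ccl C1 D12 C2 K *v join (X *v a + b) (W *v a) + Dcl D11 D12 D21 K *v w = out_form ?\<theta> a b w" for a b w
    unfolding K_eq by (rule closed_loop_forms[OF Y C B AK])+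
  have nz: "join (X *v a + b) (W *v a) \<noteq> 0" if "a \<noteq> 0 \<or> b \<noteq> 0" for a b
  proof
    assume "join (X *v a + b) (W *v a) = 0"
    then have "X *v a + b = 0" "W *v a = 0" by simp_all
    moreover from this have "a = 0" using W0 by blast
    ultimately show False using that by simp
  qed
  have "lmi \<gamma> ?\<theta>"
    unfolding lmi_iff
  proof (intro conjI allI impI)
    show "(X *v a) \<bullet> b = a \<bullet> (X *v b)" "(Y *v a) \<bullet> b = a \<bullet> (Y *v b)" for a b by (rule X Y)+
    show "(X *v a) \<bullet> a + 2 * (a \<bullet> b) + (Y *v b) \<bullet> b > 0" if "a \<noteq> 0 \<or> b \<noteq> 0" for a b
    proof -
      have "join (a + Y *v b) (transpose N *v b) \<bullet> join (X *v a + b) (W *v a)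
          = (X *v a) \<bullet> a + 2 * (a \<bullet> b) + (Y *v b) \<bullet> b"
        unfolding inner_join transpose_mult_inner NW' inner_add_left inner_add_right inner_diff_right
        using Y[of b "X *v a"] inner_commute[of a "X *v a"] inner_commute[of b a] by linarith
      then show ?thesis using pos[OF nz[OF that]] by (simp only: Pv)
    qed
    show "2 * lin_form ?\<theta> a b w + (norm (out_form ?\<theta> a b w))\<^sup>2 - \<gamma>\<^sup>2 * (norm w)\<^sup>2 < 0"
      if "a \<noteq> 0 \<or> b \<noteq> 0 \<or> w \<noteq> 0" for a b w
    proof -
      have "join (X *v a + b) (W *v a) \<noteq> 0 \<or> w \<noteq> 0" using that nz by blast
      from neg[OF this] show ?thesis unfolding Pv forms .
    qed
  qed
  then show ?thesis using Winv rec by blast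
qed

text \<open>\<open>lin_form\<close> and the coupling form are affine in the variables, and
  \<open>out_form\<close>, also affine, enters through its squared norm, which is convex.\<close>

lemma lmi_convex:
  assumes \<theta>0: "lmi \<gamma> \<theta>0" and \<theta>1: "lmi \<gamma> \<theta>1" and t: "0 \<le> t" "t \<le> 1"
  shows "lmi \<gamma> ((1 - t) *\<^sub>R \<theta>0 + t *\<^sub>R \<theta>1)"
proof -
  obtain X Y Ah Bh Ch Dh where e0: "\<theta>0 = (X, Y, Ah, Bh, Ch, Dh)" by (rule prod_cases6)
  obtain X' Y' Ah' Bh' Ch' Dh' where e1: "\<theta>1 = (X', Y', Ah', Bh', Ch', Dh')" by (rule prod_cases6)
  let ?c = "\<lambda>p q. (1 - t) *\<^sub>R p + t *\<^sub>R q"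
  let ?\<theta> = "?c \<theta>0 \<theta>1"
  have e: "?\<theta> = (?c X X', ?c Y Y', ?c Ah Ah', ?c Bh Bh', ?c Ch Ch', ?c Dh Dh')"
    by (simp add: e0 e1)
  have mv: "?c M M' *v v = (1 - t) *\<^sub>R (M *v v) + t *\<^sub>R (M' *v v)" for M M' :: "real^'m^'k" and v
    by (simp add: matrix_vector_mult_add_rdistrib scaleR_matrix_vector_assoc)
  have lin: "lin_form ?\<theta> a b w = (1 - t) * lin_form \<theta>0 a b w + t * lin_form \<theta>1 a b w" for a b w
    unfolding e unfolding e0 e1 lin_form_def prod.case mv
    by (simp add: matrix_vector_right_distrib matrix_vector_mult_scaleR inner_add_right algebra_simps)
  have out: "out_form ?\<theta> a b w = (1 - t) *\<^sub>R out_form \<theta>0 a b w + t *\<^sub>R out_form \<theta>1 a b w" for a b w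
    unfolding e unfolding e0 e1 out_form_def prod.case mv
    by (simp add: matrix_vector_right_distrib matrix_vector_mult_scaleR algebra_simps)
  note X = lmiD(1)[OF \<theta>0 e0] and Y = lmiD(2)[OF \<theta>0 e0] and X' = lmiD(1)[OF \<theta>1 e1] and Y' = lmiD(2)[OF \<theta>1 e1]
    and coupling = lmiD(3)[OF \<theta>0 e0] lmiD(3)[OF \<theta>1 e1] and neg = lmiD(4)[OF \<theta>0 e0] lmiD(4)[OF \<theta>1 e1]
  have "2 * lin_form ?\<theta> a b w + (norm (out_form ?\<theta> a b w))\<^sup>2 - \<gamma>\<^sup>2 * (norm w)\<^sup>2 < 0"
    if "a \<noteq> 0 \<or> b \<noteq> 0 \<or> w \<noteq> 0" for a b w
  proof -
    have "2 * lin_form ?\<theta> a b w + (norm (out_form ?\<theta> a b w))\<^sup>2 - \<gamma>\<^sup>2 * (norm w)\<^sup>2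
        \<le> 2 * ((1 - t) * lin_form \<theta>0 a b w + t * lin_form \<theta>1 a b w)
          + ((1 - t) * (norm (out_form \<theta>0 a b w))\<^sup>2 + t * (norm (out_form \<theta>1 a b w))\<^sup>2) - \<gamma>\<^sup>2 * (norm w)\<^sup>2"
      unfolding lin out using norm_convex_square[OF t] by (intro diff_right_mono add_left_mono)
    also have "\<dots> = (1 - t) * (2 * lin_form \<theta>0 a b w + (norm (out_form \<theta>0 a b w))\<^sup>2 - \<gamma>\<^sup>2 * (norm w)\<^sup>2)
        + t * (2 * lin_form \<theta>1 a b w + (norm (out_form \<theta>1 a b w))\<^sup>2 - \<gamma>\<^sup>2 * (norm w)\<^sup>2)"
      by (simp add: algebra_simps)
    also have "\<dots> < 0" by (rule convex_combination_neg[OF t neg(1)[OF that] neg(2)[OF that]])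
    finally show ?thesis .
  qed
  moreover have "(?c X X' *v a) \<bullet> a + 2 * (a \<bullet> b) + (?c Y Y' *v b) \<bullet> b > 0" if "a \<noteq> 0 \<or> b \<noteq> 0" for a b
  proof -
    have "(?c X X' *v a) \<bullet> a + 2 * (a \<bullet> b) + (?c Y Y' *v b) \<bullet> b
      = - ((1 - t) * - ((X *v a) \<bullet> a + 2 * (a \<bullet> b) + (Y *v b) \<bullet> b) + t * - ((X' *v a) \<bullet> a + 2 * (a \<bullet> b) + (Y' *v b) \<bullet> b))"
      unfolding mv by (simp add: inner_add_left algebra_simps)
    also have "\<dots> > 0"
      using convex_combination_neg[OF t, of "- ((X *v a) \<bullet> a + 2 * (a \<bullet> b) + (Y *v b) \<bullet> b)" "- ((X' *v a) \<bullet> a + 2 * (a \<bullet> b) + (Y' *v b) \<bullet> b)"]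
        coupling(1)[OF that] coupling(2)[OF that] by linarith
    finally show ?thesis .
  qed
  moreover have "(?c X X' *v a) \<bullet> b = a \<bullet> (?c X X' *v b)" "(?c Y Y' *v a) \<bullet> b = a \<bullet> (?c Y Y' *v b)" for a b
    unfolding mv by (simp_all add: inner_add_left inner_add_right X X' Y Y')
  ultimately show ?thesis unfolding e lmi_iff by blast
qed

text \<open>Every inverse in \<open>recon\<close> exists along the path: \<open>W t\<close> is
  invertible by hypothesis and \<open>1 - Y X\<close> by the coupling condition.\<close>

lemma continuous_on_recon:
  fixes \<theta> :: "real \<Rightarrow> ('x,'u,'y) lmi_var"
  assumes \<theta>: "continuous_on S \<theta>" and W: "continuous_on S W"
    and lmi: "\<And>t. t \<in> S \<Longrightarrow> lmi \<gamma> (\<theta> t)" and inv: "\<And>t. t \<in> S \<Longrightarrow> invertible (W t)"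
  shows "continuous_on S (\<lambda>t. recon (\<theta> t) (W t))"
proof -
  define X where "X t = fst (\<theta> t)" for t
  define Y where "Y t = fst (snd (\<theta> t))" for t
  define Ah where "Ah t = fst (snd (snd (\<theta> t)))" for t
  define Bh where "Bh t = fst (snd (snd (snd (\<theta> t))))" for t
  define Ch where "Ch t = fst (snd (snd (snd (snd (\<theta> t)))))" for t
  define Dh where "Dh t = snd (snd (snd (snd (snd (\<theta> t)))))" for t
  have e: "\<theta> t = (X t, Y t, Ah t, Bh t, Ch t, Dh t)" for t
    by (simp add: X_def Y_def Ah_def Bh_def Ch_def Dh_def)
  have cont: "continuous_on S X" "continuous_on S Y" "continuous_on S Ah" "continuous_on S Bh" "continuous_on S Ch" "continuous_on S Dh"
    unfolding X_def Y_def Ah_def Bh_def Ch_def Dh_def by (intro continuous_intros \<theta>)+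
  have I: "invertible (mat 1 - Y t ** X t)" if "t \<in> S" for t
    using lmi[OF that] unfolding e by (rule lmi_invertible)
  have invW: "invertible (matrix_inv (W t))" if "t \<in> S" for t
    using matrix_inv_inverse[OF inv[OF that]] by (auto simp: invertible_def)
  have "invertible ((mat 1 - Y t ** X t) ** matrix_inv (W t))" if "t \<in> S" for t
    using I invW that by (intro invertible_mult)
  then show ?thesis
    unfolding e recon_def Let_def prod.case
    by (intro continuous_intros cont W inv)
qed

text \<open>The segment in the convex set and the path in \<open>GL\<close> are traversed
  simultaneously.\<close>

lemma path_component_recon:
  assumes \<theta>: "lmi \<gamma> \<theta>0" "lmi \<gamma> \<theta>1" and W: "path_component GL W0 W1" and \<gamma>: "\<gamma> > 0"
  shows "path_component (Kgamma A B1 B2 C1 D11 D12 C2 D21 \<gamma>) (recon \<theta>0 W0) (recon \<theta>1 W1)"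
proof -
  obtain g where g: "path g" "path_image g \<subseteq> GL" "g 0 = W0" "g 1 = W1"
    using W by (auto simp: path_component_def pathstart_def pathfinish_def)
  let ?\<theta> = "\<lambda>t. (1 - t) *\<^sub>R \<theta>0 + t *\<^sub>R \<theta>1"
  have lmi: "lmi \<gamma> (?\<theta> t)" if "t \<in> {0..1}" for t using lmi_convex[OF \<theta>] that by simp
  have inv: "invertible (g t)" if "t \<in> {0..1}" for t
    using g(2) that unfolding path_image_def by blast
  have "path_component (Kgamma A B1 B2 C1 D11 D12 C2 D21 \<gamma>) (recon (?\<theta> 0) (g 0)) (recon (?\<theta> 1) (g 1))"
  proof (rule path_component_param)
    show "continuous_on {0..1} (\<lambda>t. recon (?\<theta> t) (g t))"
      by (rule continuous_on_recon) (use g(1) lmi inv in \<open>auto simp: path_def intro!: continuous_intros\<close>)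
    show "recon (?\<theta> t) (g t) \<in> Kgamma A B1 B2 C1 D11 D12 C2 D21 \<gamma>" if "t \<in> {0..1}" for t
      by (rule Kgamma_recon[OF lmi[OF that] inv[OF that] \<gamma>])
  qed
  then show ?thesis by (simp add: g)
qed

lemma Kgamma_components:
  fixes \<gamma> :: real
  defines "\<K> \<equiv> Kgamma A B1 B2 C1 D11 D12 C2 D21 \<gamma>"
  shows "finite {path_component_set \<K> K | K. K \<in> \<K>} \<and> card {path_component_set \<K> K | K. K \<in> \<K>} \<le> 2"
proof (cases "\<K> = {}")
  case False
  then obtain K where K: "K \<in> \<K>" by blast
  \<comment> \<open>Any member of the set forces this: its supremum is below \<open>\<gamma>\<close>
    and at least the nonnegative value at frequency 0.\<close>
  have \<gamma>: "\<gamma> > 0"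
  proof -
    let ?s = "\<lambda>\<omega>::real. sigma_max (Tzw A B1 B2 C1 D11 D12 C2 D21 K (\<i> * complex_of_real \<omega>))"
    have "hurwitz (Acl A B2 C2 K)" "Sup (range ?s) < \<gamma>"
      using K by (auto simp: \<K>_def Kgamma_def Cstab_def hinf_norm_def)
    moreover have "bdd_above (range ?s)"
      using bdd_above_frequency_response[OF calculation(1)] by (simp add: Tzw_def transfer_def)
    then have "?s 0 \<le> Sup (range ?s)" by (rule cSUP_upper[OF UNIV_I])
    moreover have "0 \<le> ?s 0" by (rule sigma_max_nonneg)
    ultimately show ?thesis by linarith
  qed
  have "\<forall>K. \<exists>p. K \<in> \<K> \<longrightarrow> lmi \<gamma> (fst p) \<and> invertible (snd p) \<and> recon (fst p) (snd p) = K"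
  proof
    fix K
    show "\<exists>p. K \<in> \<K> \<longrightarrow> lmi \<gamma> (fst p) \<and> invertible (snd p) \<and> recon (fst p) (snd p) = K"
    proof (cases "K \<in> \<K>")
      case True
      then obtain \<theta> W where "lmi \<gamma> \<theta> \<and> invertible W \<and> recon \<theta> W = K"
        using Kgamma_represent[of K \<gamma>] unfolding \<K>_def by blast
      then show ?thesis by (intro exI[of _ "(\<theta>, W)"]) simp
    qed simp
  qed
  from choice[OF this] obtain p where p: "\<forall>K. K \<in> \<K> \<longrightarrow> lmi \<gamma> (fst (p K)) \<and> invertible (snd (p K)) \<and> recon (fst (p K)) (snd (p K)) = K" ..
  define \<theta> where "\<theta> K = fst (p K)" for K
  define W where "W K = snd (p K)" for K
  have rep: "lmi \<gamma> (\<theta> K) \<and> invertible (W K) \<and> recon (\<theta> K) (W K) = K" if "K \<in> \<K>" for K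
    using p that unfolding \<theta>_def W_def by blast
  \<comment> \<open>\<open>c\<close> depends on the chosen representation and is not claimed to be
    an invariant of the component; it suffices that equal values force equal components.\<close>
  define c where "c K \<longleftrightarrow> path_component GL (mat 1) (W K)" for K
  have conn: "path_component_set \<K> K = path_component_set \<K> K'" if "K \<in> \<K>" "K' \<in> \<K>" "c K = c K'" for K K'
  proof -
    have "path_component GL (W K) (W K')"
    proof (cases "c K")
      case True
      then show ?thesis
        using that(3) unfolding c_def by (metis path_component_sym path_component_trans)
    next
      case False
      \<comment> \<open>Outside the component of \<open>mat 1\<close>, both \<open>W K\<close> and
        \<open>W K'\<close> are joined to this one reflection.\<close>
      let ?R = "reflection (axis undefined 1)"
      have "path_component GL ?R (W K)" "path_component GL ?R (W K')"
        using False that(3) path_component_GL_cases[of "W K" undefined] path_component_GL_cases[of "W K'" undefined]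
          rep[OF that(1)] rep[OF that(2)] unfolding c_def by auto
      then show ?thesis by (metis path_component_sym path_component_trans)
    qed
    then have "path_component \<K> K K'"
      using path_component_recon[of \<gamma> "\<theta> K" "\<theta> K'" "W K" "W K'"] \<gamma> rep[OF that(1)] rep[OF that(2)]
      unfolding \<K>_def by simp
    then show ?thesis by (intro path_component_eq[symmetric]) simp
  qed
  let ?S = "{path_component_set \<K> K | K. K \<in> \<K>}"
  \<comment> \<open>Each value of \<open>c\<close> that occurs picks one representative controller,
    so the components are covered by the image of \<open>bool\<close>. For a value that does not
    occur the \<open>SOME\<close> term is arbitrary and can only enlarge that image.\<close>
  have "\<exists>f. ?S \<subseteq> f ` (UNIV :: bool set)"
  proof (intro exI subsetI)
    fix Z assume "Z \<in> ?S"
    then obtain K where K: "K \<in> \<K>" "Z = path_component_set \<K> K" by blast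
    then have "\<exists>K'. K' \<in> \<K> \<and> c K' = c K" by blast
    then have "(SOME K'. K' \<in> \<K> \<and> c K' = c K) \<in> \<K> \<and> c (SOME K'. K' \<in> \<K> \<and> c K' = c K) = c K"
      by (rule someI_ex)
    then show "Z \<in> (\<lambda>b. path_component_set \<K> (SOME K'. K' \<in> \<K> \<and> c K' = b)) ` UNIV"
      using conn K by blast
  qed
  then obtain f where f: "?S \<subseteq> f ` (UNIV :: bool set)" by blast
  have "card (f ` (UNIV :: bool set)) \<le> 2" using card_image_le[of "UNIV :: bool set" f] by simp
  moreover have "card ?S \<le> card (f ` (UNIV :: bool set))" by (rule card_mono[OF _ f]) simp
  moreover have "finite ?S" using finite_subset[OF f] by simp
  ultimately show ?thesis by linarith
qed simp

end

theorem theorem1: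
  fixes A :: "real^'x^'x" and B1 :: "real^'w^'x" and B2 :: "real^'u^'x"
    and C1 :: "real^'x^'z" and D11 :: "real^'w^'z" and D12 :: "real^'u^'z"
    and C2 :: "real^'x^'y" and D21 :: "real^'w^'y" and \<gamma> :: real
  assumes "stabilizable A B2"
    and "detectable C2 A"
    and "\<gamma> > gamma_star A B1 B2 C1 D11 D12 C2 D21"
  shows "finite {path_component_set (Kgamma A B1 B2 C1 D11 D12 C2 D21 \<gamma>) K | K.
                   K \<in> Kgamma A B1 B2 C1 D11 D12 C2 D21 \<gamma>}
       \<and> card {path_component_set (Kgamma A B1 B2 C1 D11 D12 C2 D21 \<gamma>) K | K.
                   K \<in> Kgamma A B1 B2 C1 D11 D12 C2 D21 \<gamma>} \<le> 2"
  by (rule plant.Kgamma_components)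

end
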